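(* Let $\alpha\in(\tfrac14,\tfrac12]$, $s\in(\tfrac12-\alpha,2\alpha)$, let $\varepsilon>0$ be arbitrarily small, and let $u_0^\omega=\sum_{n\in\mathbb Z}\frac{g_n(\omega)}{\langle n\rangle^\alpha}e^{inx}$. Let $\Sigma\subset\Omega$ be a set with $\mathbb P(\Sigma)=1$ such that for every $\omega\in\Sigma$ there exist $T^\omega>0$ and a unique solution $u^\omega$ to the BBM equation $i\partial_tu=\varphi(D_x)u+\frac12\mathcal N(u)$ on $[0,T^\omega]$ with $u^\omega|_{t=0}=u_0^\omega$ in the class $e^{-it\varphi(D_x)}u_0^\omega+C([0,T^\omega];H^s(\mathbb T))\subset C([0,T^\omega];H^{\alpha-\frac12-\varepsilon}(\mathbb T))$. Denote by $u_{0,k}^\omega=\rho_k*u_0^\omega$ the regularisation of $u_0^\omega$ by a smooth mollifier $\{\rho_k\}_{k\in\mathbb N}$ and let $u_k^\omega$ be the solution to the BBM equation with $u_k^\omega|_{t=0}=u_{0,k}^\omega$. Then, almost surely, $$\lim_{k\to\infty}\|u_{0,k}^\omega-u_0^\omega\|_{H^{\alpha-\frac12-\varepsilon}(\mathbb T)}=0\quad\text{and}\quad\lim_{k\to\infty}\|u_k^\omega-u^\omega\|_{C([0,T^\omega];H^{\alpha-\frac12-\varepsilon}(\mathbb T))}=0.$$ Moreover, the limit $u^\omega$ is independent of the choice of mollification kernel $\rho$.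
   Context: $\mathbb T=\mathbb R/(2\pi\mathbb Z)$, $\langle n\rangle=(1+n^2)^{1/2}$, $D_x=-i\partial_x$, and $\varphi(D_x)$ is the Fourier multiplier with symbol $\varphi(n)=\frac{n}{1+n^2}$; $S(t)=e^{-it\varphi(D_x)}$. $\{g_n\}_{n\in\mathbb Z}$ are standard complex-valued Gaussian random variables ($\mathbb E[g_n]=0$, $\mathbb E|g_n|^2=1$) on a probability space $(\Omega,\mathcal F,\mathbb P)$, with $g_{-n}=\overline{g_n}$, $g_0$ real, and $\{g_n\}_{n\ge0}$ independent. A smooth mollifier is a family $\rho_k(x)=k\rho(kx)$ with $\rho:\mathbb R\to[0,\infty)$ smooth, supported in $(-\tfrac12,\tfrac12]$, $\int_{\mathbb R}\rho\,dx=1$, regarded as functions on $\mathbb T$. The nonlinearity is $$\mathcal N(u)=\sum_{n\ne0}\varphi(n)e^{inx}\sum_{n_1+n_2=n}\widehat u(n_1)\widehat u(n_2)$$ (equal to $\varphi(D_x)(u^2)$ for $u\in L^2(\mathbb T)$). Solutions are understood via the Duhamel formula $u(t)=S(t)u_0-\frac i2\int_0^tS(t-t')\mathcal N(u(t'))\,dt'$. With $z=S(t)u_0^\omega$ and $u=z+v$, $v\in C([0,T];H^s(\mathbb T))$, the nonlinearity means $\mathcal N(u)=\varphi(D_x)(v^2+2zv)+\mathcal N(z)$, where in $\mathcal N(z)$ the inner sum for each $n\neq0$ is the limit in $L^2(\Omega)$ as $M\to\infty$ of the sums restricted to $|n_1|,|n_2|\le M$. For smooth data the equation has a unique global smooth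 solution, and $u_k^\omega$ denotes this solution. *)

theory Defs
  imports "HOL-Probability.Probability"
begin

text \<open>
  A distribution on the torus is represented by its Fourier coefficients
  \<open>c :: int \<Rightarrow> complex\<close>, i.e. it is the formal series with \<open>n\<close>-th term \<open>c n * exp (\<i> n x)\<close>.
\<close>

definition jbracket :: "int \<Rightarrow> real" where
  "jbracket n = sqrt (1 + (of_int n)\<^sup>2)"

definition bbm_symbol :: "int \<Rightarrow> real" where
  "bbm_symbol n = of_int n / (1 + (of_int n)\<^sup>2)"

definition bbm_group :: "real \<Rightarrow> (int \<Rightarrow> complex) \<Rightarrow> int \<Rightarrow> complex" where
  "bbm_group t c n = exp (- (\<i> * of_real (t * bbm_symbol n))) * c n"

section \<open>Sobolev spaces\<close>

definition sobolev :: "real \<Rightarrow> (int \<Rightarrow> complex) set" where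
  "sobolev r = {c. (\<lambda>n. jbracket n powr (2 * r) * (cmod (c n))\<^sup>2) summable_on UNIV}"

definition sobolev_norm :: "real \<Rightarrow> (int \<Rightarrow> complex) \<Rightarrow> real" where
  "sobolev_norm r c = sqrt (\<Sum>\<^sub>\<infinity>n. jbracket n powr (2 * r) * (cmod (c n))\<^sup>2)"

text \<open>
  Curves in \<open>C([0,T]; H^r)\<close>, given as functions on all of \<open>real\<close> whose values outside
  \<open>[0,T]\<close> are irrelevant.
\<close>

definition cont_sobolev :: "real \<Rightarrow> real \<Rightarrow> (real \<Rightarrow> int \<Rightarrow> complex) set" where
  "cont_sobolev T r = {u. \<forall>t\<in>{0..T}. u t \<in> sobolev r \<and>
     ((\<lambda>t'. sobolev_norm r (\<lambda>n. u t' n - u t n)) \<longlongrightarrow> 0) (at t within {0..T})}"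

definition cont_sobolev_norm :: "real \<Rightarrow> real \<Rightarrow> (real \<Rightarrow> int \<Rightarrow> complex) \<Rightarrow> real" where
  "cont_sobolev_norm T r u = (SUP t\<in>{0..T}. sobolev_norm r (u t))"

text \<open>
  The two norms above are meaningful only on the respective spaces, so the notions of
  convergence include membership.
\<close>

definition sobolev_converges ::
  "real \<Rightarrow> (nat \<Rightarrow> int \<Rightarrow> complex) \<Rightarrow> (int \<Rightarrow> complex) \<Rightarrow> bool" where
  "sobolev_converges r X c \<longleftrightarrow>
     c \<in> sobolev r \<and> (\<forall>\<^sub>F k in sequentially. X k \<in> sobolev r) \<and>
     (\<lambda>k. sobolev_norm r (\<lambda>n. X k n - c n)) \<longlonglongrightarrow> 0"

definition cont_sobolev_converges ::
  "real \<Rightarrow> real \<Rightarrow> (nat \<Rightarrow> real \<Rightarrow> int \<Rightarrow> complex) \<Rightarrow> (real \<Rightarrow> int \<Rightarrow> complex) \<Rightarrow> bool" where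
  "cont_sobolev_converges T r X u \<longleftrightarrow>
     u \<in> cont_sobolev T r \<and> (\<forall>\<^sub>F k in sequentially. X k \<in> cont_sobolev T r) \<and>
     (\<lambda>k. cont_sobolev_norm T r (\<lambda>t n. X k t n - u t n)) \<longlonglongrightarrow> 0"

section \<open>The BBM equation\<close>

text \<open>
  Fourier coefficients of a product. The sums converge absolutely for \<open>a \<in> H^s\<close> and
  \<open>b \<in> H^(-s)\<close>, \<open>s \<ge> 0\<close>, which covers all products formed below for data in
  \<open>H^(-s)\<close>.
\<close>

definition coeff_mult :: "(int \<Rightarrow> complex) \<Rightarrow> (int \<Rightarrow> complex) \<Rightarrow> int \<Rightarrow> complex" where
  "coeff_mult a b n = (\<Sum>\<^sub>\<infinity>m. a m * b (n - m))"

definition bbm_nonlinearity :: "(int \<Rightarrow> complex) \<Rightarrow> int \<Rightarrow> complex" where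
  "bbm_nonlinearity w n = (if n = 0 then 0 else of_real (bbm_symbol n) * w n)"

text \<open>
  The Duhamel formula, read on each Fourier coefficient. Here \<open>w \<tau> n\<close>, for \<open>n \<noteq> 0\<close>, is the
  \<open>n\<close>-th Fourier coefficient of the square of \<open>u \<tau>\<close>, whose meaning depends on the class of
  solutions considered.
\<close>

definition duhamel ::
  "real \<Rightarrow> (int \<Rightarrow> complex) \<Rightarrow> (real \<Rightarrow> int \<Rightarrow> complex) \<Rightarrow> (real \<Rightarrow> int \<Rightarrow> complex) \<Rightarrow> bool" where
  "duhamel T c w u \<longleftrightarrow> (\<forall>t\<in>{0..T}. \<forall>n.
     (\<lambda>\<tau>. bbm_group (t - \<tau>) (bbm_nonlinearity (w \<tau>)) n) absolutely_integrable_on {0..t} \<and>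
     u t n = bbm_group t c n -
       \<i> / 2 * integral {0..t} (\<lambda>\<tau>. bbm_group (t - \<tau>) (bbm_nonlinearity (w \<tau>)) n))"

definition bbm_smooth_solution :: "(int \<Rightarrow> complex) \<Rightarrow> (real \<Rightarrow> int \<Rightarrow> complex) \<Rightarrow> bool" where
  "bbm_smooth_solution c u \<longleftrightarrow> (\<forall>T\<ge>0.
     (\<forall>r. u \<in> cont_sobolev T r) \<and> duhamel T c (\<lambda>\<tau>. coeff_mult (u \<tau>) (u \<tau>)) u)"

text \<open>
  Solutions \<open>u = z + v\<close> with \<open>z t = bbm_group t c\<close> and \<open>v \<in> C([0,T]; H^s)\<close>. The square of \<open>z\<close>
  is not determined by \<open>c\<close> alone; its coefficients are the argument \<open>q\<close>.
\<close>

definition bbm_rough_solution ::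
  "real \<Rightarrow> real \<Rightarrow> (int \<Rightarrow> complex) \<Rightarrow> (real \<Rightarrow> int \<Rightarrow> complex) \<Rightarrow> (real \<Rightarrow> int \<Rightarrow> complex) \<Rightarrow> bool"
  where
  "bbm_rough_solution s T c q u \<longleftrightarrow> (\<exists>v\<in>cont_sobolev T s.
     (\<forall>t\<in>{0..T}. \<forall>n. u t n = bbm_group t c n + v t n) \<and>
     duhamel T c
       (\<lambda>\<tau> n. coeff_mult (v \<tau>) (v \<tau>) n + 2 * coeff_mult (bbm_group \<tau> c) (v \<tau>) n + q \<tau> n) u)"

section \<open>Random data\<close>

text \<open>
  The density \<open>exp (-|x|^2) / pi\<close> on the complex plane is that of the standard complex Gaussian,
  whose real and imaginary parts are independent with variance \<open>1/2\<close>.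
\<close>

definition gaussian_family :: "'w measure \<Rightarrow> (int \<Rightarrow> 'w \<Rightarrow> complex) \<Rightarrow> bool" where
  "gaussian_family M g \<longleftrightarrow>
     (\<forall>n\<ge>1. distributed M lborel (g n) (\<lambda>x. ennreal (exp (- (cmod x)\<^sup>2) / pi))) \<and>
     distributed M lborel (\<lambda>\<omega>. Re (g 0 \<omega>)) (\<lambda>x. ennreal (std_normal_density x)) \<and>
     (\<forall>\<omega>\<in>space M. g 0 \<omega> \<in> \<real>) \<and>
     (\<forall>n. \<forall>\<omega>\<in>space M. g (- n) \<omega> = cnj (g n \<omega>)) \<and>
     prob_space.indep_vars M (\<lambda>_. borel) g {0..}"

definition random_data :: "real \<Rightarrow> (int \<Rightarrow> 'w \<Rightarrow> complex) \<Rightarrow> 'w \<Rightarrow> int \<Rightarrow> complex" where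
  "random_data \<alpha> g \<omega> n = g n \<omega> / of_real (jbracket n powr \<alpha>)"

definition truncated_square :: "nat \<Rightarrow> (int \<Rightarrow> complex) \<Rightarrow> int \<Rightarrow> complex" where
  "truncated_square N c n =
     (\<Sum>(n1, n2) \<in> {(n1, n2). \<bar>n1\<bar> \<le> int N \<and> \<bar>n2\<bar> \<le> int N \<and> n1 + n2 = n}. c n1 * c n2)"

text \<open>
  \<open>q\<close> is a version of the square of the linear evolution \<open>z\<close> of the random data: for each time
  \<open>t\<close> and each \<open>n \<noteq> 0\<close>, the truncated sums tend to \<open>q t n\<close> in mean square. As such a limit is
  determined only up to a null set depending on \<open>t\<close>, joint measurability is demanded so that the
  time integral in the Duhamel formula makes sense; any two versions then agree, outside a null
  set, for almost every \<open>t\<close>.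
\<close>

definition linear_square_version ::
  "'w measure \<Rightarrow> ('w \<Rightarrow> int \<Rightarrow> complex) \<Rightarrow> ('w \<Rightarrow> real \<Rightarrow> int \<Rightarrow> complex) \<Rightarrow> bool" where
  "linear_square_version M u0 q \<longleftrightarrow> (\<forall>n. n \<noteq> 0 \<longrightarrow>
     (\<lambda>(\<omega>, t). q \<omega> t n) \<in> borel_measurable (M \<Otimes>\<^sub>M borel) \<and>
     (\<forall>t. (\<lambda>N. \<integral>\<^sup>+ \<omega>. ennreal ((cmod (truncated_square N (bbm_group t (u0 \<omega>)) n - q \<omega> t n))\<^sup>2) \<partial>M)
        \<longlonglongrightarrow> 0))"

section \<open>Mollification\<close>

definition mollifier_kernel :: "(real \<Rightarrow> real) \<Rightarrow> bool" where
  "mollifier_kernel \<rho> \<longleftrightarrow>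
     (\<forall>j x. (deriv ^^ j) \<rho> field_differentiable at x) \<and>
     (\<forall>x. \<rho> x \<ge> 0) \<and>
     (\<forall>x. \<rho> x \<noteq> 0 \<longrightarrow> - 1 / 2 < x \<and> x \<le> 1 / 2) \<and>
     has_bochner_integral lborel \<rho> 1"

text \<open>
  Convolution with \<open>\<rho>\<^sub>k(x) = k \<rho>(k x)\<close>, viewed on the torus with fundamental domain
  \<open>[-pi, pi]\<close>, where convolution and the integral are taken with respect to \<open>dx\<close> (not
  \<open>dx / (2 pi)\<close>).
\<close>

definition mollify :: "(real \<Rightarrow> real) \<Rightarrow> nat \<Rightarrow> (int \<Rightarrow> complex) \<Rightarrow> int \<Rightarrow> complex" where
  "mollify \<rho> k c n =
     (LBINT x:{- pi..pi}. of_real (real k * \<rho> (real k * x)) * exp (- (\<i> * of_real (of_int n * x)))) * c n"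

end

theory Submission
  imports Defs
begin

text \<open>
  Fix the data \<open>c\<close>, let \<open>c\<^sub>k\<close> be the mollified data, and let \<open>z\<close>, \<open>z\<^sub>k\<close> be their linear evolutions, so
  that \<open>u = z + v\<close> and \<open>u\<^sub>k = z\<^sub>k + v + w\<^sub>k\<close>, where \<open>w\<^sub>k\<close> is the difference of the smoother remainders.
  Subtracting the two Duhamel formulas shows that \<open>w\<^sub>k\<close> is the Duhamel integral of
  \<open>(2 v + w\<^sub>k + 2 z\<^sub>k) w\<^sub>k + 2 (z\<^sub>k - z) v + (z\<^sub>k\<^sup>2 - q)\<close>, where \<open>q\<close> is the square of \<open>z\<close> in the mean-square
  sense. Choose \<open>\<sigma>\<close> slightly above \<open>1 / 2 - \<alpha>\<close>; almost surely the data lie in \<open>H^(-\<sigma>)\<close>.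

  The operator \<open>\<phi>(D)\<close> gains one derivative, and after this gain the product is bounded from
  \<open>H^(-\<sigma>) \<times> H^s\<close> to \<open>H^s\<close> (\<open>bilinear_estimate\<close>). Hence the first summand is bounded linearly in \<open>w\<^sub>k\<close> as long as
  \<open>w\<^sub>k\<close> has norm at most \<open>1\<close>, and the second tends to zero because \<open>z\<^sub>k \<rightarrow> z\<close> in \<open>H^(-\<sigma>)\<close> uniformly in
  time, the linear group being unitary. If the third summand tends to zero in \<open>L\<^sup>2([0,T]; H^(s-1))\<close>, then
  Gronwall's inequality together with a continuity argument (\<open>gronwall_continuation\<close>) gives
  \<open>w\<^sub>k \<rightarrow> 0\<close> in \<open>C([0,T]; H^s)\<close> on the whole interval on which \<open>u\<close> exists. This part is
  deterministic (\<open>smooth_approximation_converges\<close>).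

  The third summand is the probabilistic one (\<open>evolution_squares_converge\<close>). At a frequency \<open>n \<noteq> 0\<close> the
  coefficient of \<open>z\<^sub>k\<^sup>2\<close> is a quadratic form in the Gaussians whose products are, up to the symmetry
  \<open>m \<mapsto> n - m\<close>, pairwise orthogonal, so its second moment is at most a constant times the sum of the squared
  weights (\<open>gaussian_form_bound\<close>). This yields \<open>E \<parallel>z\<^sub>k\<^sup>2 - q\<parallel>\<^sup>2 = O(k^(-2 \<delta>))\<close>, which is too weak for almost sure
  convergence along all \<open>k\<close>. But the mollifiers at scales \<open>k\<close> and \<open>k + 1\<close> differ by a relative \<open>O(1/k)\<close>, so
  the increments satisfy \<open>E \<parallel>z\<^sub>k\<^sub>+\<^sub>1\<^sup>2 - z\<^sub>k\<^sup>2\<parallel>\<^sup>2 = O(k^(-2-2 \<delta>))\<close>. Then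
  \<open>\<Sum> k^(1+\<delta>) \<parallel>z\<^sub>k\<^sub>+\<^sub>1\<^sup>2 - z\<^sub>k\<^sup>2\<parallel>\<^sup>2\<close> has finite expectation, and by Cauchy--Schwarz the
  sequence \<open>z\<^sub>k\<^sup>2\<close> is almost surely Cauchy; no moments beyond the fourth moments of the
  Gaussians enter. Fatou's lemma identifies the limit as \<open>q\<close>.

  The limit \<open>u\<close> was chosen before the kernel, so its independence of the kernel is the uniqueness of
  limits (\<open>cont_sobolev_limit_unique\<close>).
\<close>

section \<open>Weighted sums over the integers\<close>

abbreviation zsum :: "(int \<Rightarrow> ennreal) \<Rightarrow> ennreal" where
  "zsum f \<equiv> (\<integral>\<^sup>+n. f n \<partial>count_space UNIV)"

abbreviation osc :: "real \<Rightarrow> complex" where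
  "osc x \<equiv> exp (- (\<i> * of_real x))"

abbreviation mean_square :: "'a measure \<Rightarrow> ('a \<Rightarrow> complex) \<Rightarrow> ennreal" where
  "mean_square M f \<equiv> (\<integral>\<^sup>+x. ennreal ((cmod (f x))\<^sup>2) \<partial>M)"

abbreviation time_integral :: "real \<Rightarrow> (real \<Rightarrow> ennreal) \<Rightarrow> ennreal" where
  "time_integral T f \<equiv> (\<integral>\<^sup>+t. f t * indicator {0..T} t \<partial>lborel)"

lemma zsum_reflect: "zsum (\<lambda>n. f (m - n)) = zsum f"
proof -
  have "bij_betw (\<lambda>n::int. m - n) UNIV UNIV"
    by (rule bij_betw_byWitness[where f'="\<lambda>n. m - n"]) auto
  then show ?thesis by (rule nn_integral_bij_count_space)
qed

lemma zsum_swap: "zsum (\<lambda>n. zsum (\<lambda>m. f n m)) = zsum (\<lambda>m. zsum (\<lambda>n. f n m))"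
  by (rule nn_integral_count_space_nn_integral) auto

lemma zsum_ge_term: "f n \<le> zsum f"
  by (rule nn_integral_ge_point) simp

lemma sum_le_zsum: "finite A \<Longrightarrow> (\<Sum>n\<in>A. f n) \<le> zsum f"
  by (subst nn_integral_count_space_finite[symmetric], assumption, subst nn_integral_count_space_indicator)
     (auto intro!: nn_integral_mono split: split_indicator)

lemma jbracket_ge_1: "1 \<le> jbracket n"
  by (simp add: jbracket_def)

lemma jbracket_pos: "0 < jbracket n"
  using jbracket_ge_1[of n] by linarith

lemma jbracket_powr_pos [simp]: "0 < jbracket n powr a"
  using jbracket_pos[of n] by simp

lemma jbracket_minus [simp]: "jbracket (- n) = jbracket n"
  by (simp add: jbracket_def)

lemma jbracket_commute: "jbracket (m - n) = jbracket (n - m)"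
  by (metis jbracket_minus minus_diff_eq)

lemma abs_le_jbracket: "\<bar>of_int n\<bar> \<le> jbracket n"
  unfolding jbracket_def by (rule real_le_rsqrt) simp

lemma jbracket_powr_mono: "a \<le> b \<Longrightarrow> jbracket n powr a \<le> jbracket n powr b"
  using jbracket_ge_1[of n] by (intro powr_mono) auto

lemma jbracket_triangle: "jbracket (m + n) \<le> jbracket m + jbracket n"
proof -
  have "jbracket m \<ge> \<bar>of_int m\<bar>" "jbracket n \<ge> \<bar>of_int n\<bar>" by (rule abs_le_jbracket)+
  then have "\<bar>of_int m\<bar> * \<bar>of_int n\<bar> \<le> jbracket m * jbracket n"
    by (intro mult_mono) (use jbracket_pos[of m] in auto)
  then have "of_int m * of_int n \<le> jbracket m * jbracket n"
    by (metis abs_ge_self abs_mult order_trans)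
  moreover have "(jbracket m)\<^sup>2 = 1 + (of_int m)\<^sup>2" "(jbracket n)\<^sup>2 = 1 + (of_int n)\<^sup>2"
    by (simp_all add: jbracket_def)
  ultimately have "1 + (of_int (m + n))\<^sup>2 \<le> (jbracket m + jbracket n)\<^sup>2"
    by (simp add: power2_sum)
  then show ?thesis
    unfolding jbracket_def[of "m + n"] using jbracket_pos[of m] jbracket_pos[of n]
    by (intro real_le_lsqrt) auto
qed

text \<open>The larger of the two brackets carries at least half of their sum (Peetre's inequality).\<close>
lemma jbracket_powr_triangle:
  assumes "0 \<le> a" shows "jbracket (m + n) powr a \<le> 2 powr a * (jbracket m powr a + jbracket n powr a)"
proof -
  have "jbracket (m + n) powr a \<le> (2 * max (jbracket m) (jbracket n)) powr a"
    using jbracket_triangle[of m n] jbracket_pos[of "m+n"] assms by (intro powr_mono2) auto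
  also have "\<dots> = 2 powr a * max (jbracket m) (jbracket n) powr a"
    using jbracket_pos[of m] jbracket_pos[of n] by (simp add: powr_mult)
  also have "\<dots> \<le> 2 powr a * (jbracket m powr a + jbracket n powr a)"
    by (auto simp: max_def)
  finally show ?thesis .
qed

lemma bbm_symbol_bound: "(bbm_symbol n)\<^sup>2 \<le> jbracket n powr (- 2)"
proof -
  have j: "(jbracket n)\<^sup>2 = 1 + (of_int n)\<^sup>2" by (simp add: jbracket_def)
  have "bbm_symbol n = of_int n / (jbracket n)\<^sup>2" by (simp add: bbm_symbol_def j)
  then have "(bbm_symbol n)\<^sup>2 = (of_int n)\<^sup>2 / ((jbracket n)\<^sup>2 * (jbracket n)\<^sup>2)"
    by (simp add: power_divide power2_eq_square)
  also have "\<dots> \<le> (jbracket n)\<^sup>2 / ((jbracket n)\<^sup>2 * (jbracket n)\<^sup>2)"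
    using j by (intro divide_right_mono) auto
  also have "\<dots> = jbracket n powr (- 2)"
    using jbracket_pos[of n] by (simp add: powr_minus powr_numeral field_simps)
  finally show ?thesis .
qed

lemma abs_bbm_symbol_le_1: "\<bar>bbm_symbol n\<bar> \<le> 1"
proof -
  have "(bbm_symbol n)\<^sup>2 \<le> jbracket n powr 0"
    using bbm_symbol_bound[of n] jbracket_powr_mono[of "-2" 0 n] by linarith
  then show ?thesis using jbracket_pos[of n] by (simp add: abs_square_le_1)
qed

lemma zsum_jbracket_finite:
  assumes p: "p > 1" shows "zsum (\<lambda>n. ennreal (jbracket n powr - p)) < \<infinity>"
proof -
  \<comment> \<open>Along the standard enumeration of the integers the modulus grows at least like half the index.\<close>
  have dec: "jbracket (int_decode k) powr - p \<le> 3 powr p * (of_nat (Suc k) powr - p)" for k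
  proof -
    obtain m where m: "int_decode k = m" "k = int_encode m" by (metis int_decode_inverse)
    have "real k \<le> 2 * \<bar>of_int m\<bar>"
      by (auto simp: m int_encode_def sum_encode_def)
    then have "(real k)\<^sup>2 \<le> (2 * \<bar>of_int m\<bar>)\<^sup>2" by (intro power_mono) auto
    then have 1: "(real k)\<^sup>2 \<le> 4 * (of_int m)\<^sup>2" by (simp add: power_mult_distrib)
    have "(real (Suc k) / 3)\<^sup>2 \<le> 1 + (of_int m)\<^sup>2"
    proof -
      have "(real (Suc k))\<^sup>2 = (real k)\<^sup>2 + 2 * real k + 1" by (simp add: power2_eq_square algebra_simps)
      moreover have "2 * real k \<le> 1 + (real k)\<^sup>2" using sum_squares_bound[of 1 "real k"] by simp
      ultimately have "(real (Suc k))\<^sup>2 \<le> 9 + 9 * (of_int m)\<^sup>2" using 1 by simp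
      then show ?thesis by (simp add: power_divide)
    qed
    then have "real (Suc k) / 3 \<le> jbracket m" unfolding jbracket_def by (intro real_le_rsqrt)
    then have "jbracket m powr - p \<le> (real (Suc k) / 3) powr - p"
      using p by (intro powr_mono2') auto
    also have "\<dots> = 3 powr p * (of_nat (Suc k) powr - p)"
      by (simp add: powr_divide powr_minus field_simps)
    finally show ?thesis by (simp add: m)
  qed
  have "bij_betw int_decode UNIV UNIV" using bij_int_decode by simp
  then have "zsum (\<lambda>n. ennreal (jbracket n powr - p)) = (\<integral>\<^sup>+k. ennreal (jbracket (int_decode k) powr - p) \<partial>count_space UNIV)"
    by (rule nn_integral_bij_count_space[symmetric])
  also have "\<dots> \<le> (\<integral>\<^sup>+k. ennreal (3 powr p * (of_nat (Suc k) powr - p)) \<partial>count_space UNIV)"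
    by (intro nn_integral_mono ennreal_leI dec)
  also have "\<dots> = (\<Sum>k. ennreal (3 powr p * (of_nat (Suc k) powr - p)))"
    by (rule nn_integral_count_space_nat)
  also have "\<dots> < \<infinity>"
  proof -
    have "summable (\<lambda>k. 3 powr p * (of_nat (Suc k) powr - p :: real))"
      using p summable_real_powr_iff[of "-p"] by (intro summable_mult) (subst summable_Suc_iff, simp)
    then show ?thesis by (subst suminf_ennreal2) auto
  qed
  finally show ?thesis .
qed

lemma powr_prod_le_sum:
  fixes x y a b :: real
  assumes "0 < x" "0 < y" "0 \<le> a" "0 \<le> b"
  shows "x powr - a * y powr - b \<le> x powr - (a + b) + y powr - (a + b)"
proof (cases "x \<le> y")
  case True
  have "x powr - a * y powr - b \<le> x powr - a * x powr - b"
    using assms True by (intro mult_left_mono powr_mono2') auto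
  also have "\<dots> = x powr - (a + b)" by (simp add: powr_add[symmetric])
  finally show ?thesis using assms by (simp add: add_increasing2)
next
  case False
  have "x powr - a * y powr - b \<le> y powr - a * y powr - b"
    using assms False by (intro mult_right_mono powr_mono2') auto
  also have "\<dots> = y powr - (a + b)" by (simp add: powr_add[symmetric])
  finally show ?thesis using assms by (simp add: add_increasing)
qed

text \<open>
  By Peetre's inequality a factor \<open>jbracket m powr \<mu>\<close> can be absorbed by one of the two weights;
  what is left is a product of weights with total exponent above \<open>1\<close>, which is summable uniformly
  in \<open>m\<close>.
\<close>
lemma weight_convolution:
  assumes "0 \<le> \<mu>" "\<mu> \<le> p" "\<mu> \<le> r" "p + r - \<mu> > 1"
  shows "\<exists>C\<ge>0. \<forall>m. zsum (\<lambda>n. ennreal (jbracket n powr - p * jbracket (m - n) powr - r))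
            \<le> ennreal (C * jbracket m powr - \<mu>)"
proof -
  define Z where "Z = zsum (\<lambda>n. ennreal (jbracket n powr - (p + r - \<mu>)))"
  have Z: "Z < \<infinity>" unfolding Z_def by (rule zsum_jbracket_finite) fact
  define C where "C = 2 powr \<mu> * (4 * enn2real Z)"
  have "zsum (\<lambda>n. ennreal (jbracket n powr - p * jbracket (m - n) powr - r)) \<le> ennreal (C * jbracket m powr - \<mu>)" for m
  proof -
    have pt: "jbracket n powr - p * jbracket (m - n) powr - r
       \<le> 2 powr \<mu> * jbracket m powr - \<mu> *
           (2 * jbracket n powr - (p + r - \<mu>) + 2 * jbracket (m - n) powr - (p + r - \<mu>))" for n
    proof -
      let ?x = "jbracket n" and ?y = "jbracket (m - n)" and ?z = "jbracket m"
      have 1: "?z powr \<mu> \<le> 2 powr \<mu> * (?x powr \<mu> + ?y powr \<mu>)"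
        using jbracket_powr_triangle[of \<mu> n "m - n"] assms by simp
      have 2: "?x powr - (p - \<mu>) * ?y powr - r \<le> ?x powr - (p + r - \<mu>) + ?y powr - (p + r - \<mu>)"
        using powr_prod_le_sum[of ?x ?y "p - \<mu>" r] jbracket_pos assms by (simp add: algebra_simps)
      have 3: "?x powr - p * ?y powr - (r - \<mu>) \<le> ?x powr - (p + r - \<mu>) + ?y powr - (p + r - \<mu>)"
        using powr_prod_le_sum[of ?x ?y "p" "r - \<mu>"] jbracket_pos assms by (simp add: algebra_simps)
      have "?z powr \<mu> * (?x powr - p * ?y powr - r)
          \<le> 2 powr \<mu> * (?x powr \<mu> + ?y powr \<mu>) * (?x powr - p * ?y powr - r)"
        by (intro mult_right_mono 1) auto
      also have "\<dots> = 2 powr \<mu> * (?x powr - (p - \<mu>) * ?y powr - r + ?x powr - p * ?y powr - (r - \<mu>))"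
      proof -
        have "?x powr \<mu> * ?x powr - p = ?x powr - (p - \<mu>)" "?y powr \<mu> * ?y powr - r = ?y powr - (r - \<mu>)"
          by (simp_all add: powr_add[symmetric])
        then show ?thesis by (simp only: distrib_right distrib_left) (simp add: mult.assoc mult.left_commute)
      qed
      also have "\<dots> \<le> 2 powr \<mu> * (2 * ?x powr - (p + r - \<mu>) + 2 * ?y powr - (p + r - \<mu>))"
        using 2 3 by (intro mult_left_mono) auto
      finally have "?z powr - \<mu> * (?z powr \<mu> * (?x powr - p * ?y powr - r))
        \<le> ?z powr - \<mu> * (2 powr \<mu> * (2 * ?x powr - (p + r - \<mu>) + 2 * ?y powr - (p + r - \<mu>)))"
        by (intro mult_left_mono) auto
      moreover have "?z powr - \<mu> * ?z powr \<mu> = 1"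
        using jbracket_pos[of m] by (simp add: powr_add[symmetric])
      ultimately show ?thesis by (simp add: mult.assoc[symmetric]) (simp add: ac_simps)
    qed
    have "zsum (\<lambda>n. ennreal (jbracket n powr - p * jbracket (m - n) powr - r))
      \<le> zsum (\<lambda>n. ennreal (2 powr \<mu> * jbracket m powr - \<mu>) *
           (2 * ennreal (jbracket n powr - (p + r - \<mu>)) + 2 * ennreal (jbracket (m - n) powr - (p + r - \<mu>))))"
      apply (intro nn_integral_mono)
      apply (rule order_trans[OF ennreal_leI[OF pt]])
      apply (simp add: ennreal_mult ennreal_plus)
      done
    also have "\<dots> = ennreal (2 powr \<mu> * jbracket m powr - \<mu>) * (2 * Z + 2 * Z)"
      using zsum_reflect[of "\<lambda>n. ennreal (jbracket n powr - (p + r - \<mu>))" m]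
      by (simp add: nn_integral_cmult nn_integral_add Z_def)
    also have "Z = ennreal (enn2real Z)" using Z by simp
    also have "ennreal (2 powr \<mu> * jbracket m powr - \<mu>) * (2 * ennreal (enn2real Z) + 2 * ennreal (enn2real Z)) = ennreal (C * jbracket m powr - \<mu>)"
      unfolding C_def by (simp add: ennreal_mult[symmetric] ennreal_plus[symmetric] 
         ennreal_numeral[symmetric] ac_simps del: ennreal_numeral ennreal_plus)
    finally show ?thesis .
  qed
  moreover have "C \<ge> 0" by (simp add: C_def)
  ultimately show ?thesis by blast
qed

section \<open>Sobolev norms and the bilinear estimate\<close>

text \<open>
  The squared Sobolev norm with values in \<open>[0, \<infinity>]\<close>: sums over frequencies, integrals in time and
  expectations can then be interchanged without any summability side condition.
\<close>
definition esob :: "real \<Rightarrow> (int \<Rightarrow> complex) \<Rightarrow> ennreal" where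
  "esob r c = zsum (\<lambda>n. ennreal (jbracket n powr (2 * r) * (cmod (c n))\<^sup>2))"

lemma jbracket_powr_power2: "(jbracket n powr r)\<^sup>2 = jbracket n powr (2 * r)"
  by (simp add: power2_eq_square powr_add[symmetric])

lemma summable_on_iff_zsum:
  fixes f :: "int \<Rightarrow> 'a :: {banach, second_countable_topology}"
  shows "(\<lambda>n. norm (f n)) summable_on UNIV \<longleftrightarrow> zsum (\<lambda>n. ennreal (norm (f n))) < \<infinity>"
  unfolding abs_summable_equivalent Infinite_Set_Sum.abs_summable_on_def integrable_iff_bounded by simp

lemma infsum_eq_zsum:
  fixes f :: "int \<Rightarrow> real"
  assumes "(\<lambda>n. norm (f n)) summable_on UNIV" "\<And>n. 0 \<le> f n"
  shows "ennreal (infsum f UNIV) = zsum (\<lambda>n. ennreal (f n))"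
proof -
  have *: "Infinite_Set_Sum.abs_summable_on f UNIV" using assms(1) unfolding abs_summable_equivalent .
  show ?thesis
    using nn_integral_conv_infsetsum[OF *] infsetsum_infsum[OF *] assms(2) by simp
qed

lemma norm_infsum_le_zsum:
  fixes f :: "int \<Rightarrow> complex"
  shows "ennreal (norm (infsum f UNIV)) \<le> zsum (\<lambda>n. ennreal (norm (f n)))"
proof (cases "(\<lambda>n. norm (f n)) summable_on UNIV")
  case True
  then have "ennreal (norm (infsum f UNIV)) \<le> ennreal (infsum (\<lambda>n. norm (f n)) UNIV)"
    by (intro ennreal_leI norm_infsum_bound)
  also have "\<dots> = zsum (\<lambda>n. ennreal (norm (f n)))"
    using True by (intro infsum_eq_zsum) auto
  finally show ?thesis .
next
  case False
  then show ?thesis unfolding summable_on_iff_zsum by (simp add: less_top[symmetric])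
qed

lemma sobolev_iff_esob: "c \<in> sobolev r \<longleftrightarrow> esob r c < \<infinity>"
proof -
  have "c \<in> sobolev r \<longleftrightarrow> (\<lambda>n. jbracket n powr (2 * r) * (cmod (c n))\<^sup>2) summable_on UNIV"
    unfolding sobolev_def by simp
  also have "\<dots> \<longleftrightarrow> esob r c < \<infinity>"
    using summable_on_iff_zsum[of "\<lambda>n. jbracket n powr (2 * r) * (cmod (c n))\<^sup>2"]
    by (simp add: esob_def)
  finally show ?thesis .
qed

lemma sobolev_norm_nonneg: "0 \<le> sobolev_norm r c"
  unfolding sobolev_norm_def by (simp add: infsum_nonneg)

lemma esob_eq_sobolev_norm:
  assumes "c \<in> sobolev r" shows "esob r c = ennreal ((sobolev_norm r c)\<^sup>2)"
proof -
  have "(\<lambda>n. jbracket n powr (2 * r) * (cmod (c n))\<^sup>2) summable_on UNIV"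
    using assms unfolding sobolev_def by simp
  then show ?thesis
    unfolding esob_def sobolev_norm_def by (subst infsum_eq_zsum[symmetric]) (auto simp: infsum_nonneg)
qed

lemma sobolev_norm_le:
  assumes "esob r c \<le> ennreal (B\<^sup>2)" "0 \<le> B" shows "c \<in> sobolev r" "sobolev_norm r c \<le> B"
proof -
  show c: "c \<in> sobolev r" unfolding sobolev_iff_esob using assms(1) by (auto intro: le_less_trans)
  show "sobolev_norm r c \<le> B"
    using assms esob_eq_sobolev_norm[OF c] by (simp add: power2_le_iff_abs_le sobolev_norm_nonneg)
qed

lemma esob_mono:
  assumes "r \<le> r'" shows "esob r c \<le> esob r' c"
  unfolding esob_def using assms
  by (intro nn_integral_mono ennreal_leI mult_right_mono jbracket_powr_mono) auto

lemma sobolev_mono: "r \<le> r' \<Longrightarrow> c \<in> sobolev r' \<Longrightarrow> c \<in> sobolev r"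
  unfolding sobolev_iff_esob by (rule le_less_trans[OF esob_mono])

lemma sobolev_norm_mono:
  assumes "r \<le> r'" "c \<in> sobolev r'" shows "sobolev_norm r c \<le> sobolev_norm r' c"
  using esob_mono[OF assms(1), of c] unfolding esob_eq_sobolev_norm[OF assms(2)]
  by (rule sobolev_norm_le(2)) (rule sobolev_norm_nonneg)

lemma esob_le_mult:
  assumes "\<And>n. cmod (a n) \<le> B * cmod (b n)" "0 \<le> B"
  shows "esob r a \<le> ennreal (B\<^sup>2) * esob r b"
proof -
  have "(cmod (a n))\<^sup>2 \<le> B\<^sup>2 * (cmod (b n))\<^sup>2" for n
    using power_mono[OF assms(1)[of n], of 2] by (simp add: power_mult_distrib)
  then have "esob r a \<le> zsum (\<lambda>n. ennreal (B\<^sup>2) * ennreal (jbracket n powr (2 * r) * (cmod (b n))\<^sup>2))"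
    unfolding esob_def
    by (intro nn_integral_mono) (simp add: ennreal_mult[symmetric] mult_left_mono mult.left_commute[of "B\<^sup>2"])
  then show ?thesis by (simp add: nn_integral_cmult esob_def)
qed

lemma cmod_add_squared_le: "(cmod (x + y))\<^sup>2 \<le> 2 * (cmod x)\<^sup>2 + 2 * (cmod y)\<^sup>2"
proof -
  have "(cmod (x + y))\<^sup>2 \<le> (cmod x + cmod y)\<^sup>2"
    by (intro power_mono norm_triangle_ineq) auto
  also have "\<dots> \<le> 2 * (cmod x)\<^sup>2 + 2 * (cmod y)\<^sup>2"
    using sum_squares_bound[of "cmod x" "cmod y"] by (simp add: power2_sum)
  finally show ?thesis .
qed

lemma ennreal_cmod_add_squared_le:
  "ennreal ((cmod (x + y))\<^sup>2) \<le> 2 * ennreal ((cmod x)\<^sup>2) + 2 * ennreal ((cmod y)\<^sup>2)"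
  using cmod_add_squared_le by (rule order_trans[OF ennreal_leI]) (simp add: ennreal_mult)

lemma esob_add: "esob r (\<lambda>n. a n + b n) \<le> 2 * esob r a + 2 * esob r b"
proof -
  have "ennreal (jbracket n powr (2 * r) * (cmod (a n + b n))\<^sup>2) \<le>
      2 * ennreal (jbracket n powr (2 * r) * (cmod (a n))\<^sup>2) + 2 * ennreal (jbracket n powr (2 * r) * (cmod (b n))\<^sup>2)" for n
    using mult_left_mono[OF ennreal_cmod_add_squared_le, of "ennreal (jbracket n powr (2 * r))" "a n" "b n"]
    by (simp add: ennreal_mult distrib_left mult.left_commute[of _ 2])
  then have "esob r (\<lambda>n. a n + b n) \<le> zsum (\<lambda>n. 2 * ennreal (jbracket n powr (2 * r) * (cmod (a n))\<^sup>2) + 2 * ennreal (jbracket n powr (2 * r) * (cmod (b n))\<^sup>2))"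
    unfolding esob_def by (intro nn_integral_mono)
  then show ?thesis by (simp add: nn_integral_add nn_integral_cmult esob_def)
qed

lemma esob_scale: "esob r (\<lambda>n. x * a n) = ennreal ((cmod x)\<^sup>2) * esob r a"
proof -
  have "ennreal (jbracket n powr (2 * r) * (cmod (x * a n))\<^sup>2) =
      ennreal ((cmod x)\<^sup>2) * ennreal (jbracket n powr (2 * r) * (cmod (a n))\<^sup>2)" for n
    by (subst ennreal_mult[symmetric]) (simp_all add: norm_mult power_mult_distrib)
  then show ?thesis unfolding esob_def by (simp only: nn_integral_cmult borel_measurable_count_space)
qed

lemma esob_uminus: "esob r (\<lambda>n. - a n) = esob r a"
  by (simp add: esob_def)

lemma esob_diff: "esob r (\<lambda>n. a n - b n) \<le> 2 * esob r a + 2 * esob r b"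
  using esob_add[of r a "\<lambda>n. - b n"] by (simp add: esob_uminus)

lemma sobolev_add: "a \<in> sobolev r \<Longrightarrow> b \<in> sobolev r \<Longrightarrow> (\<lambda>n. a n + b n) \<in> sobolev r"
  unfolding sobolev_iff_esob
  by (rule le_less_trans[OF esob_add]) (simp add: ennreal_mult_less_top)

lemma sobolev_uminus: "a \<in> sobolev r \<Longrightarrow> (\<lambda>n. - a n) \<in> sobolev r"
  unfolding sobolev_iff_esob by (simp add: esob_uminus)

lemma sobolev_diff: "a \<in> sobolev r \<Longrightarrow> b \<in> sobolev r \<Longrightarrow> (\<lambda>n. a n - b n) \<in> sobolev r"
  using sobolev_add[of a r "\<lambda>n. - b n"] by (simp add: sobolev_uminus)

lemma sobolev_norm_minus_commute: "sobolev_norm r (\<lambda>n. a n - b n) = sobolev_norm r (\<lambda>n. b n - a n)"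
  by (simp add: sobolev_norm_def norm_minus_commute)

lemma finite_sum_le_sobolev_norm:
  assumes "c \<in> sobolev r" "finite F"
  shows "L2_set (\<lambda>n. jbracket n powr r * cmod (c n)) F \<le> sobolev_norm r c"
proof -
  have "(\<Sum>n\<in>F. (jbracket n powr r * cmod (c n))\<^sup>2) = (\<Sum>n\<in>F. jbracket n powr (2 * r) * (cmod (c n))\<^sup>2)"
    by (intro sum.cong) (simp_all add: power_mult_distrib jbracket_powr_power2)
  also have "\<dots> \<le> (\<Sum>\<^sub>\<infinity>n. jbracket n powr (2 * r) * (cmod (c n))\<^sup>2)"
    using assms unfolding sobolev_def by (intro finite_sum_le_infsum) auto
  finally show ?thesis unfolding L2_set_def sobolev_norm_def by (intro real_sqrt_le_mono)
qed

text \<open>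
  Minkowski's inequality on finite sets of frequencies, passed to the supremum.
\<close>
lemma sobolev_norm_triangle:
  assumes "a \<in> sobolev r" "b \<in> sobolev r"
  shows "sobolev_norm r (\<lambda>n. a n + b n) \<le> sobolev_norm r a + sobolev_norm r b"
proof -
  let ?S = "sobolev_norm r a + sobolev_norm r b"
  have "(\<Sum>\<^sub>\<infinity>n. jbracket n powr (2 * r) * (cmod (a n + b n))\<^sup>2) \<le> ?S\<^sup>2"
  proof (rule infsum_le_finite_sums)
    show "(\<lambda>n. jbracket n powr (2 * r) * (cmod (a n + b n))\<^sup>2) summable_on UNIV"
      using sobolev_add[OF assms] by (simp add: sobolev_def)
    fix F :: "int set" assume F: "finite F"
    have "L2_set (\<lambda>n. jbracket n powr r * cmod (a n + b n)) F
        \<le> L2_set (\<lambda>n. jbracket n powr r * cmod (a n) + jbracket n powr r * cmod (b n)) F"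
      by (intro L2_set_mono) (simp_all add: distrib_left[symmetric] norm_triangle_ineq mult_left_mono)
    also have "\<dots> \<le> ?S"
      by (rule order_trans[OF L2_set_triangle_ineq]) (intro add_mono finite_sum_le_sobolev_norm assms F)
    finally have "(L2_set (\<lambda>n. jbracket n powr r * cmod (a n + b n)) F)\<^sup>2 \<le> ?S\<^sup>2"
      by (intro power_mono) auto
    moreover have "(L2_set (\<lambda>n. jbracket n powr r * cmod (a n + b n)) F)\<^sup>2 =
       (\<Sum>n\<in>F. jbracket n powr (2 * r) * (cmod (a n + b n))\<^sup>2)"
      unfolding L2_set_def by (subst real_sqrt_pow2)
        (auto intro!: sum_nonneg sum.cong simp: power_mult_distrib jbracket_powr_power2)
    ultimately show "(\<Sum>n\<in>F. jbracket n powr (2 * r) * (cmod (a n + b n))\<^sup>2) \<le> ?S\<^sup>2" by simp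
  qed
  then have "sobolev_norm r (\<lambda>n. a n + b n) \<le> sqrt (?S\<^sup>2)"
    unfolding sobolev_norm_def[of r "\<lambda>n. a n + b n"] by (rule real_sqrt_le_mono)
  then show ?thesis by (simp add: sobolev_norm_nonneg)
qed

lemma sobolev_norm_triangle_diff:
  assumes "a \<in> sobolev r" "b \<in> sobolev r" "c \<in> sobolev r"
  shows "sobolev_norm r (\<lambda>n. a n - c n) \<le> sobolev_norm r (\<lambda>n. a n - b n) + sobolev_norm r (\<lambda>n. b n - c n)"
  using sobolev_norm_triangle[of "\<lambda>n. a n - b n" r "\<lambda>n. b n - c n"] assms by (simp add: sobolev_diff)

lemma coeff_le_sobolev_norm:
  assumes "c \<in> sobolev r" shows "cmod (c n) \<le> jbracket n powr - r * sobolev_norm r c"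
proof -
  have "jbracket n powr r * cmod (c n) \<le> sobolev_norm r c"
    using finite_sum_le_sobolev_norm[OF assms, of "{n}"] by simp
  then have "jbracket n powr - r * (jbracket n powr r * cmod (c n)) \<le> jbracket n powr - r * sobolev_norm r c"
    by (intro mult_left_mono) auto
  then show ?thesis using jbracket_pos[of n] by (simp add: mult.assoc[symmetric] powr_add[symmetric])
qed

lemma sobolev_norm_eq_0:
  assumes "c \<in> sobolev r" "sobolev_norm r c = 0" shows "c n = 0"
  using coeff_le_sobolev_norm[OF assms(1), of n] assms(2) by simp

lemma norm_coeff_mult_le: "ennreal (cmod (coeff_mult a b n)) \<le> zsum (\<lambda>m. ennreal (cmod (a m * b (n - m))))"
  unfolding coeff_mult_def by (rule norm_infsum_le_zsum)

lemma coeff_mult_commute: "coeff_mult a b n = coeff_mult b a n"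
  unfolding coeff_mult_def
  by (rule infsum_reindex_bij_witness[of _ "\<lambda>m. n - m" "\<lambda>m. n - m"]) (auto simp: mult.commute)

text \<open>
  Cauchy--Schwarz puts the full \<open>H^s\<close> norm of \<open>b\<close> outside, and the remaining double sum is
  controlled by the convolution of the weights with exponents \<open>2 - 2 s\<close> and \<open>2 s\<close>.
\<close>
lemma bilinear_estimate_zsum:
  assumes "0 \<le> \<sigma>" "\<sigma> \<le> s" "\<sigma> \<le> 1 - s" "\<sigma> < 1 / 2"
  shows "\<exists>C\<ge>0. \<forall>a b. zsum (\<lambda>n. ennreal (jbracket n powr (2 * s - 2)) * (zsum (\<lambda>m. ennreal (cmod (a m * b (n - m)))))\<^sup>2)
           \<le> ennreal C * (esob (- \<sigma>) a * esob s b)"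
proof -
  obtain C where C: "C \<ge> 0"
    "\<And>m. zsum (\<lambda>n. ennreal (jbracket n powr - (2 - 2 * s) * jbracket (m - n) powr - (2 * s))) \<le> ennreal (C * jbracket m powr - (2 * \<sigma>))"
    using weight_convolution[of "2 * \<sigma>" "2 - 2 * s" "2 * s"] assms by auto
  have "zsum (\<lambda>n. ennreal (jbracket n powr (2 * s - 2)) * (zsum (\<lambda>m. ennreal (cmod (a m * b (n - m)))))\<^sup>2)
           \<le> ennreal C * (esob (- \<sigma>) a * esob s b)" for a b
  proof -
    have cs: "(zsum (\<lambda>m. ennreal (cmod (a m * b (n - m)))))\<^sup>2 \<le>
       zsum (\<lambda>m. ennreal (jbracket (m - n) powr - (2 * s) * (cmod (a m))\<^sup>2)) * esob s b" for n
    proof -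
      have "zsum (\<lambda>m. ennreal (cmod (a m * b (n - m)))) =
        zsum (\<lambda>m. ennreal (jbracket (m - n) powr - s * cmod (a m)) * ennreal (jbracket (n - m) powr s * cmod (b (n - m))))"
      proof (intro nn_integral_cong)
        fix m
        have "jbracket (m - n) powr - s * jbracket (n - m) powr s = 1"
          using jbracket_pos[of "n - m"] by (simp add: jbracket_commute[of m n] powr_add[symmetric])
        then have "cmod (a m * b (n - m)) = (jbracket (m - n) powr - s * cmod (a m)) * (jbracket (n - m) powr s * cmod (b (n - m)))"
          by (metis (no_types, lifting) mult.assoc mult.commute mult_1 norm_mult)
        then show "ennreal (cmod (a m * b (n - m))) = ennreal (jbracket (m - n) powr - s * cmod (a m)) * ennreal (jbracket (n - m) powr s * cmod (b (n - m)))"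
          by (simp add: ennreal_mult[symmetric])
      qed
      then have "(zsum (\<lambda>m. ennreal (cmod (a m * b (n - m)))))\<^sup>2 \<le>
         zsum (\<lambda>m. (ennreal (jbracket (m - n) powr - s * cmod (a m)))\<^sup>2) * zsum (\<lambda>m. (ennreal (jbracket (n - m) powr s * cmod (b (n - m))))\<^sup>2)"
        by (simp only:) (rule Cauchy_Schwarz_nn_integral, auto)
      also have "zsum (\<lambda>m. (ennreal (jbracket (m - n) powr - s * cmod (a m)))\<^sup>2) = zsum (\<lambda>m. ennreal (jbracket (m - n) powr - (2 * s) * (cmod (a m))\<^sup>2))"
        by (intro nn_integral_cong) (simp add: ennreal_power power_mult_distrib jbracket_powr_power2)
      also have "zsum (\<lambda>m. (ennreal (jbracket (n - m) powr s * cmod (b (n - m))))\<^sup>2) = zsum (\<lambda>m. (ennreal (jbracket m powr s * cmod (b m)))\<^sup>2)"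
        by (rule zsum_reflect[where f="\<lambda>m. (ennreal (jbracket m powr s * cmod (b m)))\<^sup>2"])
      also have "\<dots> = esob s b"
        unfolding esob_def by (intro nn_integral_cong) (simp add: ennreal_power power_mult_distrib jbracket_powr_power2)
      finally show ?thesis .
    qed
    have "zsum (\<lambda>n. ennreal (jbracket n powr (2 * s - 2)) * (zsum (\<lambda>m. ennreal (cmod (a m * b (n - m)))))\<^sup>2)
      \<le> zsum (\<lambda>n. ennreal (jbracket n powr (2 * s - 2)) * (zsum (\<lambda>m. ennreal (jbracket (m - n) powr - (2 * s) * (cmod (a m))\<^sup>2)) * esob s b))"
      by (intro nn_integral_mono mult_left_mono cs) auto
    also have "\<dots> = zsum (\<lambda>n. zsum (\<lambda>m. ennreal (jbracket n powr (2 * s - 2)) * ennreal (jbracket (m - n) powr - (2 * s) * (cmod (a m))\<^sup>2))) * esob s b"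
      by (subst nn_integral_multc[symmetric], simp, intro nn_integral_cong, subst nn_integral_cmult) (simp_all add: mult.assoc)
    also have "zsum (\<lambda>n. zsum (\<lambda>m. ennreal (jbracket n powr (2 * s - 2)) * ennreal (jbracket (m - n) powr - (2 * s) * (cmod (a m))\<^sup>2)))
        = zsum (\<lambda>m. zsum (\<lambda>n. ennreal (jbracket n powr (2 * s - 2)) * ennreal (jbracket (m - n) powr - (2 * s) * (cmod (a m))\<^sup>2)))"
      by (rule zsum_swap)
    also have "\<dots> = zsum (\<lambda>m. zsum (\<lambda>n. ennreal (jbracket n powr - (2 - 2 * s) * jbracket (m - n) powr - (2 * s))) * ennreal ((cmod (a m))\<^sup>2))"
    proof (intro nn_integral_cong)
      fix m
      have "ennreal (jbracket n powr (2 * s - 2)) * ennreal (jbracket (m - n) powr - (2 * s) * (cmod (a m))\<^sup>2)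
        = ennreal (jbracket n powr - (2 - 2 * s) * jbracket (m - n) powr - (2 * s)) * ennreal ((cmod (a m))\<^sup>2)" for n
        by (simp add: ennreal_mult mult.assoc)
      then show "zsum (\<lambda>n. ennreal (jbracket n powr (2 * s - 2)) * ennreal (jbracket (m - n) powr - (2 * s) * (cmod (a m))\<^sup>2))
        = zsum (\<lambda>n. ennreal (jbracket n powr - (2 - 2 * s) * jbracket (m - n) powr - (2 * s))) * ennreal ((cmod (a m))\<^sup>2)"
        by (simp only: nn_integral_multc borel_measurable_count_space)
    qed
    also have "\<dots> \<le> zsum (\<lambda>m. ennreal (C * jbracket m powr - (2 * \<sigma>)) * ennreal ((cmod (a m))\<^sup>2))"
      by (intro nn_integral_mono mult_right_mono C(2)) auto
    also have "\<dots> = ennreal C * esob (- \<sigma>) a"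
    proof -
      have "ennreal (C * jbracket m powr - (2 * \<sigma>)) * ennreal ((cmod (a m))\<^sup>2)
        = ennreal C * ennreal (jbracket m powr (2 * - \<sigma>) * (cmod (a m))\<^sup>2)" for m
        using C(1) by (simp add: ennreal_mult mult.assoc)
      then show ?thesis
        unfolding esob_def by (simp only: nn_integral_cmult borel_measurable_count_space)
    qed
    finally have "zsum (\<lambda>n. ennreal (jbracket n powr (2 * s - 2)) * (zsum (\<lambda>m. ennreal (cmod (a m * b (n - m)))))\<^sup>2)
        \<le> (ennreal C * esob (- \<sigma>) a) * esob s b"
      by this (rule mult_right_mono, simp_all)
    then show ?thesis by (simp only: mult.assoc)
  qed
  with C(1) show ?thesis by blast
qed

lemma cmod_bbm_nonlinearity_le: "(cmod (bbm_nonlinearity w n))\<^sup>2 \<le> jbracket n powr (- 2) * (cmod (w n))\<^sup>2"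
  using bbm_symbol_bound[of n]
  by (auto simp: bbm_nonlinearity_def norm_mult power_mult_distrib intro!: mult_right_mono)

text \<open>
  The symbol is bounded by the inverse bracket, which is the gain of one derivative; it vanishes at
  frequency zero, so nothing has to be known there.
\<close>
lemma esob_bbm_le:
  assumes "\<And>n. n \<noteq> 0 \<Longrightarrow> ennreal ((cmod (d n))\<^sup>2) \<le> f n"
  shows "esob s (bbm_nonlinearity d) \<le> zsum (\<lambda>n. if n = 0 then 0 else ennreal (jbracket n powr (2 * s - 2)) * f n)"
  unfolding esob_def
proof (intro nn_integral_mono)
  fix n
  show "ennreal (jbracket n powr (2 * s) * (cmod (bbm_nonlinearity d n))\<^sup>2)
     \<le> (if n = 0 then 0 else ennreal (jbracket n powr (2 * s - 2)) * f n)"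
  proof (cases "n = 0")
    case False
    have "jbracket n powr (2 * s) * (cmod (bbm_nonlinearity d n))\<^sup>2 \<le> jbracket n powr (2 * s) * (jbracket n powr (- 2) * (cmod (d n))\<^sup>2)"
      by (intro mult_left_mono cmod_bbm_nonlinearity_le) auto
    also have "\<dots> = jbracket n powr (2 * s - 2) * (cmod (d n))\<^sup>2"
      by (simp add: powr_add[symmetric] mult.assoc[symmetric])
    finally have "ennreal (jbracket n powr (2 * s) * (cmod (bbm_nonlinearity d n))\<^sup>2) \<le> ennreal (jbracket n powr (2 * s - 2)) * ennreal ((cmod (d n))\<^sup>2)"
      by (simp add: ennreal_mult[symmetric] ennreal_leI)
    also have "\<dots> \<le> ennreal (jbracket n powr (2 * s - 2)) * f n"
      using assms[OF False] by (intro mult_left_mono) auto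
    finally show ?thesis using False by simp
  qed (simp add: bbm_nonlinearity_def)
qed

lemma bilinear_estimate:
  assumes "0 \<le> \<sigma>" "\<sigma> \<le> s" "\<sigma> \<le> 1 - s" "\<sigma> < 1 / 2"
  shows "\<exists>C\<ge>0. \<forall>a b. esob s (bbm_nonlinearity (coeff_mult a b)) \<le> ennreal C * (esob (- \<sigma>) a * esob s b)"
proof -
  obtain C where C: "C \<ge> 0" "\<And>a b. zsum (\<lambda>n. ennreal (jbracket n powr (2 * s - 2)) * (zsum (\<lambda>m. ennreal (cmod (a m * b (n - m)))))\<^sup>2)
           \<le> ennreal C * (esob (- \<sigma>) a * esob s b)"
    using bilinear_estimate_zsum[OF assms] by blast
  have "esob s (bbm_nonlinearity (coeff_mult a b)) \<le> zsum (\<lambda>n. ennreal (jbracket n powr (2 * s - 2)) * (zsum (\<lambda>m. ennreal (cmod (a m * b (n - m)))))\<^sup>2)" for a b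
  proof -
    have "ennreal ((cmod (coeff_mult a b n))\<^sup>2) \<le> (zsum (\<lambda>m. ennreal (cmod (a m * b (n - m)))))\<^sup>2" for n
      using power_mono[OF norm_coeff_mult_le[of a b n], of 2] by (simp add: ennreal_power)
    from esob_bbm_le[OF this] show ?thesis
      by (rule order_trans) (auto intro!: nn_integral_mono)
  qed
  with C show ?thesis by (meson order_trans)
qed

text \<open>
  The bilinear estimate already bounds the sum of the absolute values, so each coefficient of the
  product converges absolutely.
\<close>
lemma product_summable:
  assumes "0 \<le> \<sigma>" "\<sigma> \<le> s" "\<sigma> \<le> 1 - s" "\<sigma> < 1 / 2"
    and ab: "a \<in> sobolev (- \<sigma>)" "b \<in> sobolev s"
  shows "(\<lambda>m. norm (a m * b (n - m))) summable_on UNIV"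
proof -
  let ?X = "zsum (\<lambda>m. ennreal (cmod (a m * b (n - m))))"
  obtain C where C: "zsum (\<lambda>n. ennreal (jbracket n powr (2 * s - 2)) * (zsum (\<lambda>m. ennreal (cmod (a m * b (n - m)))))\<^sup>2)
           \<le> ennreal C * (esob (- \<sigma>) a * esob s b)"
    using bilinear_estimate_zsum[OF assms(1-4)] by blast
  have "ennreal (jbracket n powr (2 * s - 2)) * ?X\<^sup>2 \<le> ennreal C * (esob (- \<sigma>) a * esob s b)"
    by (rule order_trans[OF _ C]) (rule zsum_ge_term[of "\<lambda>n. ennreal (jbracket n powr (2 * s - 2)) * (zsum (\<lambda>m. ennreal (cmod (a m * b (n - m)))))\<^sup>2"])
  also have "\<dots> < \<infinity>" using ab by (simp add: sobolev_iff_esob ennreal_mult_less_top)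
  finally have fin: "ennreal (jbracket n powr (2 * s - 2)) * ?X\<^sup>2 < \<infinity>" .
  have "?X \<noteq> \<infinity>"
  proof
    assume "?X = \<infinity>"
    then have "ennreal (jbracket n powr (2 * s - 2)) * ?X\<^sup>2 = \<infinity>"
      using jbracket_pos[of n] by (simp only: power2_eq_square) (simp add: ennreal_mult_top)
    with fin show False by simp
  qed
  then have "?X < \<infinity>" by (simp add: less_top)
  then show ?thesis unfolding summable_on_iff_zsum .

qed

lemma coeff_mult_add_left:
  assumes "(\<lambda>m. norm (a m * b (n - m))) summable_on UNIV" "(\<lambda>m. norm (a' m * b (n - m))) summable_on UNIV"
  shows "coeff_mult (\<lambda>m. a m + a' m) b n = coeff_mult a b n + coeff_mult a' b n"
  unfolding coeff_mult_def distrib_right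
  by (rule infsum_add; rule abs_summable_summable, rule assms)

lemma coeff_mult_scale_left: "coeff_mult (\<lambda>m. x * a m) b n = x * coeff_mult a b n"
  unfolding coeff_mult_def mult.assoc by (rule infsum_cmult_right')

section \<open>Mollification as a Fourier multiplier\<close>

definition mol_symbol :: "(real \<Rightarrow> real) \<Rightarrow> nat \<Rightarrow> int \<Rightarrow> complex" where
  "mol_symbol \<rho> k n = (LBINT x:{- pi..pi}. of_real (real k * \<rho> (real k * x)) * osc (of_int n * x))"

lemma mollify_eq: "mollify \<rho> k c n = mol_symbol \<rho> k n * c n"
  by (simp add: mollify_def mol_symbol_def)

lemma norm_exp_i_diff_le: "norm (exp (- (\<i> * of_real a)) - exp (- (\<i> * of_real b))) \<le> \<bar>a - b\<bar>"
proof -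
  have "norm (exp (\<i> * of_real (b - a)) - 1) = 2 * \<bar>sin ((b - a) / 2)\<bar>"
    using dist_exp_i_1[of "b - a"] by (simp add: dist_norm)
  also have "\<dots> \<le> \<bar>a - b\<bar>"
    using abs_sin_le_one[of "(b-a)/2"] abs_sin_x_le_abs_x[of "(b - a) / 2"] by simp
  finally have 1: "norm (exp (\<i> * of_real (b - a)) - 1) \<le> \<bar>a - b\<bar>" .
  have "exp (- (\<i> * of_real a)) - exp (- (\<i> * of_real b)) = exp (- (\<i> * of_real b)) * (exp (\<i> * of_real (b - a)) - 1)"
    by (simp add: algebra_simps exp_add[symmetric])
  then show ?thesis using 1 by (simp add: norm_mult)
qed

context
  fixes \<rho> :: "real \<Rightarrow> real"
  assumes \<rho>: "mollifier_kernel \<rho>"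
begin

lemma kernel_deriv: "((deriv ^^ j) \<rho> has_field_derivative (deriv ^^ Suc j) \<rho> x) (at x)"
  using \<rho> unfolding mollifier_kernel_def by (simp add: field_differentiable_derivI)

lemma kernel_deriv_cont: "continuous_on S ((deriv ^^ j) \<rho>)"
  by (meson DERIV_isCont continuous_at_imp_continuous_on kernel_deriv)

lemma kernel_deriv_outside: "1 / 2 < \<bar>x\<bar> \<Longrightarrow> (deriv ^^ j) \<rho> x = 0"
proof (induction j arbitrary: x)
  case 0
  then show ?case using \<rho> unfolding mollifier_kernel_def by fastforce
next
  case (Suc j)
  have "open {x::real. 1 / 2 < \<bar>x\<bar>}" by (intro open_Collect_less continuous_intros)
  moreover have "x \<in> {x::real. 1 / 2 < \<bar>x\<bar>}" using Suc.prems by simp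
  ultimately have "((deriv ^^ j) \<rho> has_field_derivative 0) (at x)"
    by (rule has_field_derivative_transform_within_open[OF DERIV_const[of 0]]) (use Suc.IH in auto)
  then show ?case using kernel_deriv[of j x] DERIV_unique by blast
qed

lemma kernel_deriv_bounded: "\<exists>B\<ge>0. \<forall>x. \<bar>(deriv ^^ j) \<rho> x\<bar> \<le> B"
proof -
  have "compact ((deriv ^^ j) \<rho> ` {-1..1})"
    by (intro compact_continuous_image kernel_deriv_cont) auto
  then obtain B where B: "B > 0" "\<And>x. x \<in> {-1..1} \<Longrightarrow> \<bar>(deriv ^^ j) \<rho> x\<bar> \<le> B"
    using compact_imp_bounded bounded_pos by (metis image_eqI real_norm_def)
  have "\<bar>(deriv ^^ j) \<rho> x\<bar> \<le> B" for x
    using B kernel_deriv_outside[of x j] by (cases "x \<in> {-1..1}") auto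
  then show ?thesis using B(1) by (intro exI[of _ B]) auto
qed

lemma kernel_nonneg: "0 \<le> \<rho> x" and kernel_outside: "1 / 2 < \<bar>x\<bar> \<Longrightarrow> \<rho> x = 0"
  and kernel_integrable: "integrable lborel \<rho>" and kernel_integral: "(LBINT x. \<rho> x) = 1"
  using \<rho> kernel_deriv_outside[of x 0] unfolding mollifier_kernel_def
  by (auto simp: has_bochner_integral_iff)

lemma kernel_measurable: "\<rho> \<in> borel_measurable borel"
  using kernel_integrable by simp

lemma kernel_exp_integrable: "integrable lborel (\<lambda>y. of_real (\<rho> y) * osc (a * y))"
  by (rule Bochner_Integration.integrable_bound[OF kernel_integrable])
    (use kernel_measurable in \<open>auto simp: norm_mult\<close>)

text \<open>
  For \<open>k \<ge> 1\<close> the rescaled kernel lives on an interval inside one period, so the integral over the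
  period may be taken over the whole line.
\<close>
lemma mol_symbol_unscaled:
  assumes "k \<ge> 1"
  shows "mol_symbol \<rho> k n = (LBINT x. of_real (real k * \<rho> (real k * x)) * osc (of_int n * x))"
proof -
  have "\<rho> (real k * x) = 0" if "x \<notin> {-pi..pi}" for x
  proof (rule kernel_outside)
    have "1 < \<bar>x\<bar>" using that pi_gt3 by auto
    also have "\<bar>x\<bar> \<le> real k * \<bar>x\<bar>" using assms by (simp add: mult_le_cancel_right1)
    finally show "1 / 2 < \<bar>real k * x\<bar>" by (simp add: abs_mult)
  qed
  then show ?thesis
    unfolding mol_symbol_def set_lebesgue_integral_def
    by (intro Bochner_Integration.integral_cong) (auto simp: indicator_def)
qed

lemma mol_symbol_scaled:
  assumes "k \<ge> 1"
  shows "mol_symbol \<rho> k n = (LBINT y. of_real (\<rho> y) * osc (of_int n / real k * y))"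
proof -
  have "mol_symbol \<rho> k n = \<bar>1 / real k\<bar> *\<^sub>R (LBINT y. of_real (real k * \<rho> (real k * (0 + 1 / real k * y))) * osc (of_int n * (0 + 1 / real k * y)))"
    unfolding mol_symbol_unscaled[OF assms]
    by (rule lborel_integral_real_affine) (use assms in auto)
  also have "\<dots> = (LBINT y. (1 / real k) *\<^sub>R (of_real (real k * \<rho> (real k * (0 + 1 / real k * y))) * osc (of_int n * (0 + 1 / real k * y))))"
    by simp
  also have "\<dots> = (LBINT y. of_real (\<rho> y) * osc (of_int n / real k * y))"
    using assms by (intro Bochner_Integration.integral_cong refl) (simp add: scaleR_conv_of_real)
  finally show ?thesis .
qed

lemma norm_kernel_integral_le:
  assumes f: "integrable lborel (\<lambda>y. of_real (\<rho> y) * f y)"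
    and le: "\<And>y. \<bar>y\<bar> \<le> 1 / 2 \<Longrightarrow> cmod (f y) \<le> B"
  shows "cmod (LBINT y. of_real (\<rho> y) * f y) \<le> B"
proof -
  have "cmod (LBINT y. of_real (\<rho> y) * f y) \<le> (LBINT y. cmod (of_real (\<rho> y) * f y))"
    by (rule integral_norm_bound)
  also have "\<dots> \<le> (LBINT y. \<rho> y * B)"
  proof (rule integral_mono)
    show "integrable lborel (\<lambda>y. cmod (of_real (\<rho> y) * f y))" using f by (rule integrable_norm)
    show "integrable lborel (\<lambda>y. \<rho> y * B)" using kernel_integrable by simp
    show "cmod (of_real (\<rho> y) * f y) \<le> \<rho> y * B" for y
      using le[of y] kernel_nonneg[of y] kernel_outside[of y]
      by (cases "\<bar>y\<bar> \<le> 1 / 2") (auto simp: norm_mult intro!: mult_left_mono)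
  qed
  also have "\<dots> = B" using kernel_integral by simp
  finally show ?thesis .
qed

lemma norm_mol_symbol_le_1:
  assumes "k \<ge> 1" shows "cmod (mol_symbol \<rho> k n) \<le> 1"
  unfolding mol_symbol_scaled[OF assms]
  by (rule norm_kernel_integral_le[OF kernel_exp_integrable]) simp

text \<open>
  The Fourier transform of the kernel is Lipschitz with constant \<open>1\<close>, because the kernel is a
  probability density supported in the unit interval around zero.
\<close>
lemma kernel_exp_integral_diff:
  "cmod ((LBINT y. of_real (\<rho> y) * osc (a * y)) - (LBINT y. of_real (\<rho> y) * osc (b * y)))
    \<le> \<bar>a - b\<bar>"
proof -
  have "cmod (LBINT y. of_real (\<rho> y) * (osc (a * y) - osc (b * y))) \<le> \<bar>a - b\<bar>"
  proof (rule norm_kernel_integral_le)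
    show "integrable lborel (\<lambda>y. of_real (\<rho> y) * (osc (a * y) - osc (b * y)))"
      unfolding right_diff_distrib by (intro Bochner_Integration.integrable_diff kernel_exp_integrable)
    fix y :: real assume "\<bar>y\<bar> \<le> 1 / 2"
    have "cmod (osc (a * y) - osc (b * y)) \<le> \<bar>a * y - b * y\<bar>"
      by (rule norm_exp_i_diff_le)
    also have "\<dots> = \<bar>a - b\<bar> * \<bar>y\<bar>" by (simp add: abs_mult[symmetric] left_diff_distrib)
    also have "\<dots> \<le> \<bar>a - b\<bar> * 1" using \<open>\<bar>y\<bar> \<le> 1 / 2\<close> by (intro mult_left_mono) auto
    finally show "cmod (osc (a * y) - osc (b * y)) \<le> \<bar>a - b\<bar>" by simp
  qed
  then show ?thesis
    unfolding right_diff_distrib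
    by (subst (asm) Bochner_Integration.integral_diff) (intro kernel_exp_integrable)+
qed

lemma mol_symbol_near_1:
  assumes "k \<ge> 1" shows "cmod (mol_symbol \<rho> k n - 1) \<le> \<bar>of_int n\<bar> / real k"
proof -
  have "(LBINT y. complex_of_real (\<rho> y) * osc (0 * y)) = of_real 1"
    using integral_complex_of_real[of lborel \<rho>] kernel_integral by simp
  then show ?thesis
    using kernel_exp_integral_diff[of "of_int n / real k" 0] by (simp add: mol_symbol_scaled[OF assms])
qed

lemma mol_symbol_increment_low:
  assumes "k \<ge> 1" shows "cmod (mol_symbol \<rho> (Suc k) n - mol_symbol \<rho> k n) \<le> \<bar>of_int n\<bar> / (real k)\<^sup>2"
proof -
  have k: "real k > 0" using assms by simp
  have "cmod (mol_symbol \<rho> (Suc k) n - mol_symbol \<rho> k n) \<le> \<bar>of_int n / real (Suc k) - of_int n / real k\<bar>"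
    unfolding mol_symbol_scaled[OF assms] mol_symbol_scaled[of "Suc k", OF le_SucI[OF assms]]
    by (rule kernel_exp_integral_diff)
  also have "\<dots> = \<bar>of_int n\<bar> * (1 / (real k * real (Suc k)))"
    using k by (simp add: abs_mult[symmetric] abs_divide[symmetric] field_simps)
  also have "\<dots> \<le> \<bar>of_int n\<bar> * (1 / (real k)\<^sup>2)"
    using k unfolding power2_eq_square by (intro mult_left_mono divide_left_mono) auto
  finally show ?thesis by simp
qed

text \<open>
  The increments are also of size \<open>1 / k\<close> uniformly in the frequency: the kernels at scales
  \<open>k\<close> and \<open>k + 1\<close> differ by \<open>O(1)\<close> on an interval of length \<open>1 / k\<close>.
\<close>
lemma mol_symbol_increment_high:
  "\<exists>C\<ge>0. \<forall>k\<ge>1. \<forall>n. cmod (mol_symbol \<rho> (Suc k) n - mol_symbol \<rho> k n) \<le> C / real k"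
proof -
  obtain B0 where B0: "B0 \<ge> 0" "\<And>x. \<bar>\<rho> x\<bar> \<le> B0" using kernel_deriv_bounded[of 0] by auto
  obtain B1 where B1: "B1 \<ge> 0" "\<And>x. \<bar>deriv \<rho> x\<bar> \<le> B1" using kernel_deriv_bounded[of 1] by auto
  have lip: "\<bar>\<rho> x - \<rho> y\<bar> \<le> B1 * \<bar>x - y\<bar>" for x y
    using field_differentiable_bound[of UNIV \<rho> "deriv \<rho>" B1 x y] kernel_deriv[of 0] B1(2) by simp
  have "cmod (mol_symbol \<rho> (Suc k) n - mol_symbol \<rho> k n) \<le> (B0 + B1) / real k" if k: "k \<ge> 1" for k n
  proof -
    define f where "f = (\<lambda>k x. real k * \<rho> (real k * x))"
    define I where "I = {- 1 / (2 * real k) .. 1 / (2 * real k)}"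
    have k0: "real k > 0" using k by simp
    have int: "integrable lborel (\<lambda>x. of_real (f k x) * osc (of_int n * x))" if "k \<ge> 1" for k
    proof -
      have "integrable lborel (\<lambda>x. \<rho> (0 + real k * x))"
        using kernel_integrable that by (intro lborel_integrable_real_affine) auto
      then have "integrable lborel (f k)" by (simp add: f_def)
      then show ?thesis
        by (rule Bochner_Integration.integrable_bound) (use kernel_measurable in \<open>auto simp: norm_mult f_def\<close>)
    qed
    \<comment> \<open>Writing (k + 1) = 1 + k separates the change of amplitude from the change of argument.\<close>
    have pt: "\<bar>f (Suc k) x - f k x\<bar> \<le> (B0 + B1) * indicator I x" for x
    proof (cases "x \<in> I")
      case True
      then have x: "real k * \<bar>x\<bar> \<le> 1" using k0 by (auto simp: I_def abs_le_iff field_simps)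
      have "f (Suc k) x - f k x = \<rho> (real (Suc k) * x) + real k * (\<rho> (real (Suc k) * x) - \<rho> (real k * x))"
        by (simp add: f_def algebra_simps)
      also have "\<bar>\<dots>\<bar> \<le> B0 + real k * (B1 * \<bar>x\<bar>)"
      proof -
        have "\<bar>\<rho> (real (Suc k) * x) - \<rho> (real k * x)\<bar> \<le> B1 * \<bar>x\<bar>"
          using lip[of "real (Suc k) * x" "real k * x"] by (simp add: algebra_simps)
        then have "\<bar>real k * (\<rho> (real (Suc k) * x) - \<rho> (real k * x))\<bar> \<le> real k * (B1 * \<bar>x\<bar>)"
          using k0 by (simp add: abs_mult)
        then show ?thesis using B0(2)[of "real (Suc k) * x"] by linarith
      qed
      also have "real k * (B1 * \<bar>x\<bar>) \<le> B1 * 1"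
        using mult_left_mono[OF x B1(1)] by (simp add: ac_simps)
      finally show ?thesis using True by simp
    next
      case False
      then have x: "1 / (2 * real k) < \<bar>x\<bar>" by (auto simp: I_def)
      then have "1 / 2 < \<bar>real k * x\<bar>" using k0 by (simp add: abs_mult field_simps)
      moreover have "\<bar>real k * x\<bar> \<le> \<bar>real (Suc k) * x\<bar>" by (simp add: abs_mult mult_right_mono)
      ultimately have "f k x = 0" "f (Suc k) x = 0" using kernel_outside unfolding f_def by auto
      then show ?thesis using False by simp
    qed
    have "mol_symbol \<rho> (Suc k) n - mol_symbol \<rho> k n =
       (LBINT x. of_real (f (Suc k) x) * osc (of_int n * x) - of_real (f k x) * osc (of_int n * x))"
      using int[OF k] int[of "Suc k"] k
      by (subst Bochner_Integration.integral_diff) (auto simp: mol_symbol_unscaled f_def)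
    also have "cmod \<dots> \<le> (LBINT x. cmod (of_real (f (Suc k) x) * osc (of_int n * x) - of_real (f k x) * osc (of_int n * x)))"
      by (rule integral_norm_bound)
    also have "\<dots> \<le> (LBINT x. (B0 + B1) * indicator I x)"
    proof (rule integral_mono)
      show "integrable lborel (\<lambda>x. cmod (of_real (f (Suc k) x) * osc (of_int n * x) - of_real (f k x) * osc (of_int n * x)))"
        using int[OF k] int[of "Suc k"] by (intro integrable_norm Bochner_Integration.integrable_diff) auto
      show "integrable lborel (\<lambda>x. (B0 + B1) * indicator I x)"
        by (simp add: I_def)
      show "cmod (of_real (f (Suc k) x) * osc (of_int n * x) - of_real (f k x) * osc (of_int n * x)) \<le> (B0 + B1) * indicator I x" for x
        using pt[of x] unfolding left_diff_distrib[symmetric] of_real_diff[symmetric] norm_mult norm_of_real by simp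
    qed
    also have "\<dots> = (B0 + B1) / real k"
      using k0 by (simp add: I_def measure_lborel_Icc field_simps)
    finally show ?thesis .
  qed
  then show ?thesis using B0(1) B1(1) by (intro exI[of _ "B0 + B1"]) auto
qed

text \<open>Repeated integration by parts on \<open>[-1, 1]\<close>, where the boundary terms vanish.\<close>
lemma kernel_fourier_decay:
  "\<exists>C. \<forall>a::real. \<bar>a\<bar> ^ j * cmod (LBINT y. of_real (\<rho> y) * osc (a * y)) \<le> C"
proof -
  define F where "F = (\<lambda>j a. integral {-1..1} (\<lambda>y. complex_of_real ((deriv ^^ j) \<rho> y) * osc (a * y)))"
  have integrable: "(\<lambda>y. complex_of_real ((deriv ^^ j) \<rho> y) * osc (a * y)) integrable_on {-1..1}" for j and a :: real
    by (intro integrable_continuous_real continuous_intros kernel_deriv_cont)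
  have F0: "(LBINT y. of_real (\<rho> y) * osc (a * y)) = F 0 a" for a
  proof -
    have "(LBINT y. of_real (\<rho> y) * osc (a * y)) = (LBINT y:{-1..1}. of_real (\<rho> y) * osc (a * y))"
      unfolding set_lebesgue_integral_def using kernel_outside
      by (intro Bochner_Integration.integral_cong) (auto simp: indicator_def)
    also have "\<dots> = F 0 a"
      unfolding F_def
      by (subst set_borel_integral_eq_integral(2))
        (auto simp: set_integrable_def intro!: integrable_mult_indicator kernel_exp_integrable simp del: of_real_mult)
    finally show ?thesis .
  qed
  have step: "F (Suc j) a = \<i> * of_real a * F j a" for j a
  proof -
    let ?f = "\<lambda>j y. complex_of_real ((deriv ^^ j) \<rho> y) * osc (a * y)"
    have "((\<lambda>y. ?f (Suc j) y - \<i> * of_real a * ?f j y) has_integral (?f j 1 - ?f j (-1))) {-1..1}"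
    proof (rule fundamental_theorem_of_calculus)
      fix x :: real assume "x \<in> {-1..1}"
      have 1: "((\<lambda>y. complex_of_real ((deriv ^^ j) \<rho> y)) has_vector_derivative complex_of_real ((deriv ^^ Suc j) \<rho> x)) (at x within {-1..1})"
        using kernel_deriv[of j x] by (intro has_vector_derivative_of_real has_vector_derivative_at_within)
          (simp add: has_real_derivative_iff_has_vector_derivative)
      have 2: "((\<lambda>y. osc (a * y)) has_vector_derivative (- (\<i> * of_real a)) * osc (a * x)) (at x within {-1..1})"
        proof -
          have "((\<lambda>z. exp (- (\<i> * (of_real a * z)))) has_field_derivative (- (\<i> * of_real a)) * exp (- (\<i> * (of_real a * of_real x)))) (at (of_real x))"
            by (auto intro!: derivative_eq_intros)
          from has_vector_derivative_real_field[OF this] show ?thesis by simp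
        qed
      show "(?f j has_vector_derivative ?f (Suc j) x - \<i> * of_real a * ?f j x) (at x within {-1..1})"
        using has_vector_derivative_mult[OF 1 2] by (simp add: algebra_simps)
    qed simp
    then have zero: "((\<lambda>y. ?f (Suc j) y - \<i> * of_real a * ?f j y) has_integral 0) {-1..1}"
      by (simp add: kernel_deriv_outside)
    have "((\<lambda>y. ?f (Suc j) y - \<i> * of_real a * ?f j y) has_integral (F (Suc j) a - \<i> * of_real a * F j a)) {-1..1}"
      unfolding F_def by (intro has_integral_diff has_integral_mult_right integrable_integral integrable)
    from has_integral_unique[OF this zero] show ?thesis by simp
  qed
  have pow: "F j a = (\<i> * of_real a) ^ j * F 0 a" for j a
    by (induction j) (auto simp: step)
  obtain B where B: "B \<ge> 0" "\<And>x. \<bar>(deriv ^^ j) \<rho> x\<bar> \<le> B" using kernel_deriv_bounded[of j] by auto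
  have "\<bar>a\<bar> ^ j * cmod (F 0 a) \<le> 2 * B" for a
  proof -
    have "\<bar>a\<bar> ^ j * cmod (F 0 a) = cmod (F j a)" by (simp add: pow[of j] norm_mult norm_power)
    also have "\<dots> \<le> B * measure lborel (cbox (-1) (1::real))"
    proof (rule has_integral_bound)
      show "((\<lambda>y. complex_of_real ((deriv ^^ j) \<rho> y) * osc (a * y)) has_integral F j a) (cbox (-1) 1)"
        unfolding F_def box_real by (intro integrable_integral integrable)
      show "cmod (complex_of_real ((deriv ^^ j) \<rho> y) * osc (a * y)) \<le> B" for y
        using B(2)[of y] by (simp add: norm_mult)
    qed fact
    finally show ?thesis by simp
  qed
  then show ?thesis unfolding F0 by blast
qed

lemma mol_symbol_decay:
  assumes k: "k \<ge> 1" shows "\<exists>C\<ge>0. \<forall>n. jbracket n powr r * cmod (mol_symbol \<rho> k n) \<le> C"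
proof -
  obtain j :: nat where j: "r \<le> real j" using real_arch_simple by blast
  obtain C where C: "\<And>a::real. \<bar>a\<bar> ^ j * cmod (LBINT y. of_real (\<rho> y) * osc (a * y)) \<le> C"
    using kernel_fourier_decay[of j] by blast
  have "jbracket n powr r * cmod (mol_symbol \<rho> k n) \<le> 2 ^ j * (1 + real k ^ j * C)" for n
  proof -
    have "jbracket n \<le> 1 + \<bar>of_int n\<bar>"
      unfolding jbracket_def by (rule real_le_lsqrt) (auto simp: power2_sum)
    also have "\<dots> \<le> 2 * max 1 \<bar>of_int n\<bar>" by simp
    finally have "jbracket n ^ j \<le> (2 * max 1 \<bar>of_int n\<bar>) ^ j"
      using jbracket_pos[of n] by (intro power_mono) auto
    also have "\<dots> = 2 ^ j * max 1 \<bar>of_int n\<bar> ^ j" by (simp add: power_mult_distrib)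
    also have "\<dots> \<le> 2 ^ j * (1 + \<bar>of_int n\<bar> ^ j)"
      by (intro mult_left_mono) (auto simp: max_def)
    finally have 1: "jbracket n ^ j \<le> 2 ^ j * (1 + \<bar>of_int n\<bar> ^ j)" .
    have "jbracket n powr r \<le> jbracket n powr real j" using j by (rule jbracket_powr_mono)
    also have "\<dots> = jbracket n ^ j" using jbracket_pos[of n] by (simp add: powr_realpow)
    finally have "jbracket n powr r * cmod (mol_symbol \<rho> k n) \<le> 2 ^ j * (1 + \<bar>of_int n\<bar> ^ j) * cmod (mol_symbol \<rho> k n)"
      using 1 by (intro mult_right_mono) auto
    also have "\<dots> = 2 ^ j * (cmod (mol_symbol \<rho> k n) + real k ^ j * (\<bar>of_int n / real k\<bar> ^ j * cmod (mol_symbol \<rho> k n)))"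
      using k by (simp add: power_divide abs_divide field_simps)
    also have "\<dots> \<le> 2 ^ j * (1 + real k ^ j * C)"
      using C[of "of_int n / real k"] norm_mol_symbol_le_1[OF k, of n]
      by (intro mult_left_mono add_mono) (auto simp: mol_symbol_scaled[OF k])
    finally show ?thesis .
  qed
  moreover from this[of 0] have "2 ^ j * (1 + real k ^ j * C) \<ge> 0"
    by (rule order_trans[rotated]) simp
  ultimately show ?thesis by blast
qed

end

section \<open>Quadratic forms in the Gaussian coefficients\<close>

lemma lborel_reflect: "distr lborel borel (\<lambda>x. - x) = (lborel :: 'a :: euclidean_space measure)"
proof -
  have "(\<lambda>_::'a. \<bar>- 1::real\<bar> ^ DIM('a)) = (\<lambda>_. 1)" by simp
  then have "(lborel :: 'a measure) = density (distr lborel borel (\<lambda>x. 0 + (- 1) *\<^sub>R x)) (\<lambda>_. 1)"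
    using lborel_affine[of "- 1" "0::'a"] by simp
  then show ?thesis by (simp add: density_1)
qed

text \<open>
  Reflection invariance of Lebesgue measure; this is how the Gaussians are seen to be centred.
\<close>
lemma integral_lborel_odd:
  fixes f :: "'a :: euclidean_space \<Rightarrow> real"
  assumes [measurable]: "f \<in> borel_measurable borel" and "\<And>x. f (- x) = - f x"
  shows "(LINT x|lborel. f x) = 0"
proof -
  have "(LINT x|lborel. f x) = (LINT x|distr lborel borel (\<lambda>x. - x). f x)"
    by (simp only: lborel_reflect)
  also have "\<dots> = (LINT x|lborel. f (- x))" by (rule integral_distr) auto
  also have "\<dots> = - (LINT x|lborel. f x)" by (simp add: assms)
  finally show ?thesis by simp
qed

lemma le_1_plus_pow4: "x \<le> 1 + x ^ 4" "x ^ 2 \<le> 1 + x ^ 4" for x :: real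
proof -
  have 1: "2 * x\<^sup>2 \<le> 1 + x ^ 4" using sum_squares_bound[of 1 "x\<^sup>2"] by simp
  have 2: "2 * x \<le> 1 + x\<^sup>2" using sum_squares_bound[of 1 x] by simp
  have 3: "0 \<le> x ^ 4" by simp
  from 1 3 show "x ^ 2 \<le> 1 + x ^ 4" by linarith
  from 1 2 3 show "x \<le> 1 + x ^ 4" by linarith
qed

context prob_space
begin

context
  fixes g :: "int \<Rightarrow> 'a \<Rightarrow> complex"
  assumes g: "gaussian_family M g"
begin

lemma gaussian_indep: "indep_vars (\<lambda>_. borel) g {0..}"
  and gaussian_cnj: "\<omega> \<in> space M \<Longrightarrow> g (- n) \<omega> = cnj (g n \<omega>)"
  and gaussian_distributed: "n \<ge> 1 \<Longrightarrow> distributed M lborel (g n) (\<lambda>x. ennreal (exp (- (cmod x)\<^sup>2) / pi))"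
  using g by (auto simp: gaussian_family_def)

lemma gaussian_measurable [measurable]: "g n \<in> borel_measurable M"
proof (cases "n \<ge> 0")
  case True
  then show ?thesis using gaussian_indep unfolding indep_vars_def by auto
next
  case False
  then have "g (- n) \<in> borel_measurable M" using gaussian_indep unfolding indep_vars_def by auto
  then have "(\<lambda>\<omega>. cnj (g (- n) \<omega>)) \<in> borel_measurable M"
    by (rule measurable_compose) (intro borel_measurable_continuous_onI continuous_intros)
  also have "?this \<longleftrightarrow> g n \<in> borel_measurable M"
    using gaussian_cnj[of _ n] by (intro measurable_cong) auto
  finally show ?thesis .
qed

text \<open>
  The fourth power is absorbed by half of the exponent, and the remaining Gaussian integral is
  reduced by scaling to the total mass of the density, which is one because it is the density of a
  random variable.
\<close>
lemma complex_gaussian_4th_moment: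
  "(\<integral>\<^sup>+x. ennreal ((cmod x) ^ 4) * ennreal (exp (- (cmod x)\<^sup>2) / pi) \<partial>lborel) < \<infinity>"
proof -
  have total: "(\<integral>\<^sup>+x. ennreal (exp (- (cmod x)\<^sup>2) / pi) \<partial>lborel) = 1"
    using distributed_nn_integral[OF gaussian_distributed[of 1], of "\<lambda>_. 1"] by (simp add: emeasure_space_1)
  have "(\<integral>\<^sup>+x. ennreal (exp (- (cmod x)\<^sup>2)) \<partial>lborel) = (\<integral>\<^sup>+x. ennreal pi * ennreal (exp (- (cmod x)\<^sup>2) / pi) \<partial>lborel)"
    by (intro nn_integral_cong) (simp add: ennreal_mult[symmetric])
  then have fin: "(\<integral>\<^sup>+x. ennreal (exp (- (cmod x)\<^sup>2)) \<partial>lborel) < \<infinity>"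
    by (simp add: nn_integral_cmult total)
  have "(\<integral>\<^sup>+x. ennreal (exp (- ((cmod x)\<^sup>2 / 2))) \<partial>lborel)
     = (\<integral>\<^sup>+x. ennreal (exp (- ((cmod x)\<^sup>2 / 2))) \<partial>density (distr lborel borel (\<lambda>x::complex. 0 + sqrt 2 *\<^sub>R x)) (\<lambda>_. \<bar>sqrt 2\<bar>^DIM(complex)))"
    by (subst lborel_affine[of "sqrt 2" 0]) auto
  also have "\<dots> = ennreal (\<bar>sqrt 2\<bar>^DIM(complex)) * (\<integral>\<^sup>+x. ennreal (exp (- ((cmod (0 + sqrt 2 *\<^sub>R x))\<^sup>2 / 2))) \<partial>lborel)"
    by (subst nn_integral_density) (auto simp: nn_integral_cmult nn_integral_distr)
  also have "(\<integral>\<^sup>+x. ennreal (exp (- ((cmod (0 + sqrt 2 *\<^sub>R x))\<^sup>2 / 2))) \<partial>lborel) = (\<integral>\<^sup>+x. ennreal (exp (- (cmod x)\<^sup>2)) \<partial>lborel)"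
    by (simp add: power_mult_distrib)
  finally have fin2: "(\<integral>\<^sup>+x. ennreal (exp (- ((cmod x)\<^sup>2 / 2))) \<partial>lborel) < \<infinity>"
    using fin by (simp add: ennreal_mult_less_top)
  have pt: "(cmod x) ^ 4 * (exp (- (cmod x)\<^sup>2) / pi) \<le> 8 / pi * exp (- ((cmod x)\<^sup>2 / 2))" for x
  proof -
    define u where "u = (cmod x)\<^sup>2 / 2"
    have u: "u \<ge> 0" "(cmod x)\<^sup>2 = 2 * u" by (auto simp: u_def)
    have "(cmod x) ^ 4 = ((cmod x)\<^sup>2)\<^sup>2" by simp
    also have "\<dots> = 4 * u\<^sup>2" by (simp add: u power_mult_distrib)
    \<comment> \<open>By the quadratic Taylor bound, exp u is at least u^2 / 2.\<close>
    also have "\<dots> \<le> 8 * exp u" using exp_lower_Taylor_quadratic[OF u(1)] u(1) by simp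
    finally have "(cmod x) ^ 4 * (exp (- (2 * u)) / pi) \<le> 8 * exp u * (exp (- (2 * u)) / pi)"
      by (intro mult_right_mono) auto
    also have "\<dots> = 8 / pi * exp (- u)"
      by (simp add: exp_add[symmetric])
    finally show ?thesis by (simp add: u)
  qed
  have "(\<integral>\<^sup>+x. ennreal ((cmod x) ^ 4) * ennreal (exp (- (cmod x)\<^sup>2) / pi) \<partial>lborel)
     \<le> (\<integral>\<^sup>+x. ennreal (8 / pi) * ennreal (exp (- ((cmod x)\<^sup>2 / 2))) \<partial>lborel)"
    using pt by (intro nn_integral_mono) (simp add: ennreal_mult[symmetric] del: times_divide_eq_right)
  also have "\<dots> < \<infinity>" using fin2 by (simp add: nn_integral_cmult ennreal_mult_less_top)
  finally show ?thesis .
qed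

lemma gaussian_4th_moment: "\<exists>K\<ge>1. \<forall>n. (\<integral>\<^sup>+\<omega>. ennreal (cmod (g n \<omega>) ^ 4) \<partial>M) \<le> ennreal K"
proof -
  define I where "I = (\<integral>\<^sup>+x. ennreal ((cmod x) ^ 4) * ennreal (exp (- (cmod x)\<^sup>2) / pi) \<partial>lborel)"
  have I: "I < \<infinity>" unfolding I_def by (rule complex_gaussian_4th_moment)
  have pos: "(\<integral>\<^sup>+\<omega>. ennreal (cmod (g n \<omega>) ^ 4) \<partial>M) = I" if "n \<ge> 1" for n
    using distributed_nn_integral[OF gaussian_distributed[OF that], of "\<lambda>x. ennreal (cmod x ^ 4)"]
    by (simp add: I_def mult.commute)
  have neg: "(\<integral>\<^sup>+\<omega>. ennreal (cmod (g n \<omega>) ^ 4) \<partial>M) = I" if "n \<le> -1" for n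
    using pos[of "- n"] that gaussian_cnj[of _ n] by (simp cong: nn_integral_cong)
  have zero: "(\<integral>\<^sup>+\<omega>. ennreal (cmod (g 0 \<omega>) ^ 4) \<partial>M) \<le> ennreal 3"
  proof -
    have D: "distributed M lborel (\<lambda>\<omega>. Re (g 0 \<omega>)) (\<lambda>x. ennreal (std_normal_density x))"
      and real: "\<And>\<omega>. \<omega> \<in> space M \<Longrightarrow> g 0 \<omega> \<in> \<real>"
      using g by (auto simp: gaussian_family_def)
    have "(\<integral>\<^sup>+\<omega>. ennreal (cmod (g 0 \<omega>) ^ 4) \<partial>M) = (\<integral>\<^sup>+\<omega>. ennreal (Re (g 0 \<omega>) ^ 4) \<partial>M)"
    proof (intro nn_integral_cong)
      fix \<omega> assume "\<omega> \<in> space M"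
      then obtain r where "g 0 \<omega> = of_real r" using real by (auto elim: Reals_cases)
      then show "ennreal (cmod (g 0 \<omega>) ^ 4) = ennreal (Re (g 0 \<omega>) ^ 4)" by simp
    qed
    also have "\<dots> = (\<integral>\<^sup>+x. ennreal (std_normal_density x) * ennreal (x ^ 4) \<partial>lborel)"
      by (rule distributed_nn_integral[OF D, symmetric]) simp
    also have "\<dots> = (\<integral>\<^sup>+x. ennreal (std_normal_density x * x ^ (2 * 2)) \<partial>lborel)"
      by (intro nn_integral_cong) (simp add: ennreal_mult)
    also have "\<dots> = ennreal 3"
      using std_normal_moment_even[of 2]
      by (subst nn_integral_eq_integral) (auto simp: has_bochner_integral_iff fact_numeral)
    finally show ?thesis by simp
  qed
  show ?thesis
  proof (intro exI[of _ "3 + enn2real I"] conjI allI)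
    fix n
    have "I = ennreal (enn2real I)" using I by simp
    also have "\<dots> \<le> ennreal (3 + enn2real I)" by (intro ennreal_leI) simp
    finally have "I \<le> ennreal (3 + enn2real I)" .
    moreover have "ennreal 3 \<le> ennreal (3 + enn2real I)" by (intro ennreal_leI) simp
    ultimately show "(\<integral>\<^sup>+\<omega>. ennreal (cmod (g n \<omega>) ^ 4) \<partial>M) \<le> ennreal (3 + enn2real I)"
      using pos[of n] neg[of n] order_trans[OF zero]
      by (cases "n \<ge> 1"; cases "n \<le> -1"; cases "n = 0") (auto simp del: ennreal_plus)
  qed simp
qed

lemma gaussian_4th_integrable: "integrable M (\<lambda>\<omega>. cmod (g n \<omega>) ^ 4)"
proof -
  obtain K where "(\<integral>\<^sup>+\<omega>. ennreal (cmod (g n \<omega>) ^ 4) \<partial>M) \<le> ennreal K" using gaussian_4th_moment by blast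
  then show ?thesis unfolding integrable_iff_bounded by (simp add: le_less_trans)
qed

lemma gaussian_2nd_moment: "\<exists>K\<ge>1. \<forall>n. (\<integral>\<^sup>+\<omega>. ennreal (cmod (g n \<omega>) ^ 2) \<partial>M) \<le> ennreal K"
proof -
  obtain K where K: "K \<ge> 1" "\<And>n. (\<integral>\<^sup>+\<omega>. ennreal (cmod (g n \<omega>) ^ 4) \<partial>M) \<le> ennreal K" using gaussian_4th_moment by blast
  have "(\<integral>\<^sup>+\<omega>. ennreal (cmod (g n \<omega>) ^ 2) \<partial>M) \<le> ennreal (1 + K)" for n
  proof -
    have "(\<integral>\<^sup>+\<omega>. ennreal (cmod (g n \<omega>) ^ 2) \<partial>M) \<le> (\<integral>\<^sup>+\<omega>. 1 + ennreal (cmod (g n \<omega>) ^ 4) \<partial>M)"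
      using le_1_plus_pow4(2)[of "cmod (g n _)"]
      by (intro nn_integral_mono) (simp add: ennreal_plus[symmetric] ennreal_1[symmetric] del: ennreal_plus ennreal_1)
    also have "\<dots> = 1 + (\<integral>\<^sup>+\<omega>. ennreal (cmod (g n \<omega>) ^ 4) \<partial>M)"
      by (subst nn_integral_add) (auto simp: emeasure_space_1)
    also have "\<dots> \<le> 1 + ennreal K" by (intro add_left_mono K)
    also have "\<dots> = ennreal (1 + K)" using K(1) by (subst ennreal_plus) auto
    finally show ?thesis .
  qed
  with K(1) show ?thesis by (intro exI[of _ "1 + K"]) auto
qed

lemma gaussian_integrable: "integrable M (g n)"
proof (rule Bochner_Integration.integrable_bound)
  show "integrable M (\<lambda>\<omega>. 1 + cmod (g n \<omega>) ^ 4)" using gaussian_4th_integrable by simp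
  show "AE \<omega> in M. norm (g n \<omega>) \<le> norm (1 + cmod (g n \<omega>) ^ 4)"
    using le_1_plus_pow4(1)[of "cmod (g n _)"] by (auto simp: abs_of_nonneg add_nonneg_nonneg)
qed simp

lemma gaussian_mean_zero:
  assumes "n \<noteq> 0" shows "(LINT \<omega>|M. g n \<omega>) = 0"
proof -
  have pos: "(LINT \<omega>|M. g n \<omega>) = 0" if "n \<ge> 1" for n
  proof (rule complex_eqI)
    have "(LINT \<omega>|M. Re (g n \<omega>)) = (LINT x|lborel. exp (- (cmod x)\<^sup>2) / pi * Re x)"
      by (rule distributed_integral[OF gaussian_distributed[OF that], symmetric]) auto
    also have "\<dots> = 0" by (rule integral_lborel_odd) auto
    finally show "Re (LINT \<omega>|M. g n \<omega>) = Re 0" using gaussian_integrable[of n] by simp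
    have "(LINT \<omega>|M. Im (g n \<omega>)) = (LINT x|lborel. exp (- (cmod x)\<^sup>2) / pi * Im x)"
      by (rule distributed_integral[OF gaussian_distributed[OF that], symmetric]) auto
    also have "\<dots> = 0" by (rule integral_lborel_odd) auto
    finally show "Im (LINT \<omega>|M. g n \<omega>) = Im 0" using gaussian_integrable[of n] by simp
  qed
  show ?thesis
  proof (cases "n \<ge> 1")
    case False
    then have "(LINT \<omega>|M. g (- n) \<omega>) = 0" using assms pos[of "- n"] by simp
    then have "(LINT \<omega>|M. cnj (g n \<omega>)) = 0"
      using gaussian_cnj[of _ n] by (simp cong: Bochner_Integration.integral_cong)
    then show ?thesis by simp
  qed (rule pos)
qed

lemma gaussian_product4_integrable: "integrable M (\<lambda>\<omega>. g a \<omega> * g b \<omega> * cnj (g c \<omega>) * cnj (g d \<omega>))"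
proof (rule Bochner_Integration.integrable_bound)
  show "integrable M (\<lambda>\<omega>. cmod (g a \<omega>) ^ 4 + cmod (g b \<omega>) ^ 4 + cmod (g c \<omega>) ^ 4 + cmod (g d \<omega>) ^ 4)"
    using gaussian_4th_integrable by simp
  have "x * y * z * w \<le> x ^ 4 + y ^ 4 + z ^ 4 + w ^ 4" if "0 \<le> x" "0 \<le> y" "0 \<le> z" "0 \<le> w" for x y z w :: real
  proof -
    have "2 * (x * y * z * w) \<le> (x * y)\<^sup>2 + (z * w)\<^sup>2" using sum_squares_bound[of "x * y" "z * w"] by (simp add: ac_simps)
    moreover have "2 * (x * y)\<^sup>2 \<le> x ^ 4 + y ^ 4" using sum_squares_bound[of "x\<^sup>2" "y\<^sup>2"] by (simp add: power_mult_distrib)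
    moreover have "2 * (z * w)\<^sup>2 \<le> z ^ 4 + w ^ 4" using sum_squares_bound[of "z\<^sup>2" "w\<^sup>2"] by (simp add: power_mult_distrib)
    moreover have "0 \<le> x ^ 4" "0 \<le> y ^ 4" "0 \<le> z ^ 4" "0 \<le> w ^ 4" by simp_all
    ultimately show ?thesis by linarith
  qed
  then show "AE \<omega> in M. norm (g a \<omega> * g b \<omega> * cnj (g c \<omega>) * cnj (g d \<omega>)) \<le>
     norm (cmod (g a \<omega>) ^ 4 + cmod (g b \<omega>) ^ 4 + cmod (g c \<omega>) ^ 4 + cmod (g d \<omega>) ^ 4)"
    by (auto simp: norm_mult abs_of_nonneg add_nonneg_nonneg)
qed (auto intro!: borel_measurable_times measurable_compose[OF gaussian_measurable borel_measurable_continuous_onI] continuous_intros)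

lemma gaussian_product3_integrable: "integrable M (\<lambda>\<omega>. g a \<omega> * cnj (g b \<omega>) * cnj (g c \<omega>))"
proof (rule Bochner_Integration.integrable_bound)
  show "integrable M (\<lambda>\<omega>. cmod (g a \<omega>) ^ 4 + cmod (g b \<omega>) ^ 4 + cmod (g c \<omega>) ^ 4 + 1)"
    using gaussian_4th_integrable by simp
  have "x * y * z \<le> x ^ 4 + y ^ 4 + z ^ 4 + 1" if "0 \<le> x" "0 \<le> y" "0 \<le> z" for x y z :: real
  proof -
    have "2 * (x * y * z) \<le> (x * y)\<^sup>2 + z\<^sup>2" using sum_squares_bound[of "x * y" "z"] by (simp add: ac_simps)
    moreover have "2 * (x * y)\<^sup>2 \<le> x ^ 4 + y ^ 4" using sum_squares_bound[of "x\<^sup>2" "y\<^sup>2"] by (simp add: power_mult_distrib)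
    moreover have "z\<^sup>2 \<le> 1 + z ^ 4" by (rule le_1_plus_pow4)
    moreover have "0 \<le> x ^ 4" "0 \<le> y ^ 4" "0 \<le> z ^ 4" by simp_all
    ultimately show ?thesis by linarith
  qed
  then show "AE \<omega> in M. norm (g a \<omega> * cnj (g b \<omega>) * cnj (g c \<omega>)) \<le>
     norm (cmod (g a \<omega>) ^ 4 + cmod (g b \<omega>) ^ 4 + cmod (g c \<omega>) ^ 4 + 1)"
    by (auto simp: norm_mult abs_of_nonneg add_nonneg_nonneg)
qed (auto intro!: borel_measurable_times measurable_compose[OF gaussian_measurable borel_measurable_continuous_onI] continuous_intros)

text \<open>
  A coefficient of modulus \<open>\<bar>m\<bar>\<close> strictly larger than the moduli of the other three frequencies is
  centred and independent of them. Independence is only given for nonnegative frequencies, so both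
  factors are written as functions of the coefficients with index \<open>\<bar>m\<bar>\<close> and with index below \<open>\<bar>m\<bar>\<close>.
\<close>
lemma gaussian_highest_mode:
  assumes "\<bar>a\<bar> < \<bar>m\<bar>" "\<bar>b\<bar> < \<bar>m\<bar>" "\<bar>c\<bar> < \<bar>m\<bar>"
  shows "(LINT \<omega>|M. g m \<omega> * (g a \<omega> * cnj (g b \<omega>) * cnj (g c \<omega>))) = 0"
proof -
  \<comment> \<open>The coefficient at a possibly negative frequency, read off from the nonnegative ones.\<close>
  define \<gamma> where "\<gamma> = (\<lambda>(j::int) (f :: int \<Rightarrow> complex). if j \<ge> 0 then f j else cnj (f (- j)))"
  have \<gamma>_g: "\<gamma> j (restrict (\<lambda>i. g i \<omega>) A) = g j \<omega>" if "\<omega> \<in> space M" "\<bar>j\<bar> \<in> A" for j \<omega> A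
    using gaussian_cnj[OF that(1), of "- j"] that(2) by (auto simp: \<gamma>_def)
  have \<gamma>_m: "\<gamma> j \<in> borel_measurable (PiM A (\<lambda>_. borel))" if "\<bar>j\<bar> \<in> A" for j A
  proof -
    have 1: "(\<lambda>f. f \<bar>j\<bar>) \<in> borel_measurable (PiM A (\<lambda>_. borel :: complex measure))"
      by (rule measurable_component_singleton) fact
    have "cnj \<in> borel_measurable borel" by (intro borel_measurable_continuous_onI continuous_intros)
    from measurable_compose[OF 1 this] 1 show ?thesis by (cases "j \<ge> 0") (auto simp: \<gamma>_def)
  qed
  let ?A = "{\<bar>m\<bar>}" and ?B = "{0..<\<bar>m\<bar>}"
  define \<psi> where "\<psi> = (\<lambda>f. \<gamma> a f * cnj (\<gamma> b f) * cnj (\<gamma> c f))"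
  have \<psi>_m: "\<psi> \<in> borel_measurable (PiM ?B (\<lambda>_. borel))"
  proof -
    have "cnj \<in> borel_measurable borel" by (intro borel_measurable_continuous_onI continuous_intros)
    with \<gamma>_m[of _ ?B] assms show ?thesis
      unfolding \<psi>_def by (intro borel_measurable_times) (auto intro: measurable_compose)
  qed
  have "indep_var (PiM ?A (\<lambda>_. borel)) (\<lambda>\<omega>. restrict (\<lambda>i. g i \<omega>) ?A) (PiM ?B (\<lambda>_. borel)) (\<lambda>\<omega>. restrict (\<lambda>i. g i \<omega>) ?B)"
    by (rule indep_var_restrict[OF gaussian_indep]) auto
  from indep_var_compose[OF this \<gamma>_m \<psi>_m, of m]
  have indep: "indep_var borel (\<gamma> m \<circ> (\<lambda>\<omega>. restrict (\<lambda>i. g i \<omega>) ?A)) borel (\<psi> \<circ> (\<lambda>\<omega>. restrict (\<lambda>i. g i \<omega>) ?B))"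
    by simp
  let ?X = "\<gamma> m \<circ> (\<lambda>\<omega>. restrict (\<lambda>i. g i \<omega>) ?A)" and ?Y = "\<psi> \<circ> (\<lambda>\<omega>. restrict (\<lambda>i. g i \<omega>) ?B)"
  have X: "?X \<omega> = g m \<omega>" and Y: "?Y \<omega> = g a \<omega> * cnj (g b \<omega>) * cnj (g c \<omega>)" if "\<omega> \<in> space M" for \<omega>
    using that assms by (simp_all add: \<psi>_def \<gamma>_g)
  have intX: "integrable M ?X"
    using gaussian_integrable[of m] X by (simp cong: Bochner_Integration.integrable_cong)
  have intY: "integrable M ?Y"
    using gaussian_product3_integrable[of a b c] Y by (simp cong: Bochner_Integration.integrable_cong)
  have "(LINT \<omega>|M. g m \<omega> * (g a \<omega> * cnj (g b \<omega>) * cnj (g c \<omega>))) = (LINT \<omega>|M. ?X \<omega> * ?Y \<omega>)"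
    using X Y by (intro Bochner_Integration.integral_cong) auto
  also have "\<dots> = (LINT \<omega>|M. ?X \<omega>) * (LINT \<omega>|M. ?Y \<omega>)"
    by (rule indep_var_lebesgue_integral[OF indep intX intY])
  also have "(LINT \<omega>|M. ?X \<omega>) = (LINT \<omega>|M. g m \<omega>)"
    using X by (intro Bochner_Integration.integral_cong) auto
  also have "\<dots> = 0" using assms by (intro gaussian_mean_zero) auto
  finally show ?thesis by simp
qed

text \<open>
  For \<open>n \<noteq> 0\<close> the products \<open>g m * g (n - m)\<close> in which \<open>m\<close> is the dominant frequency are pairwise
  orthogonal: the larger of two dominant frequencies strictly exceeds the other three frequencies
  in modulus, so the corresponding coefficient is centred and independent of the rest.
\<close>
lemma gaussian_products_orthogonal:
  assumes "n \<noteq> 0" "m \<noteq> m'" "\<bar>n - m\<bar> \<le> \<bar>m\<bar>" "\<bar>n - m'\<bar> \<le> \<bar>m'\<bar>"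
  shows "(LINT \<omega>|M. (g m \<omega> * g (n - m) \<omega>) * cnj (g m' \<omega> * g (n - m') \<omega>)) = 0"
proof -
  have *: "(LINT \<omega>|M. (g m \<omega> * g (n - m) \<omega>) * cnj (g m' \<omega> * g (n - m') \<omega>)) = 0"
    if "\<bar>m'\<bar> < \<bar>m\<bar>" "\<bar>n - m\<bar> \<le> \<bar>m\<bar>" "\<bar>n - m'\<bar> \<le> \<bar>m'\<bar>" for m m'
  proof -
    have "\<bar>n - m\<bar> < \<bar>m\<bar>" "\<bar>m'\<bar> < \<bar>m\<bar>" "\<bar>n - m'\<bar> < \<bar>m\<bar>" using that assms(1) by linarith+
    from gaussian_highest_mode[OF this] show ?thesis by (simp add: mult.assoc)
  qed
  show ?thesis
  proof (cases "\<bar>m'\<bar> < \<bar>m\<bar>")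
    case True
    then show ?thesis using * assms by blast
  next
    case False
    then have lt: "\<bar>m\<bar> < \<bar>m'\<bar>" using assms by linarith
    have "(LINT \<omega>|M. (g m \<omega> * g (n - m) \<omega>) * cnj (g m' \<omega> * g (n - m') \<omega>)) =
        (LINT \<omega>|M. cnj ((g m' \<omega> * g (n - m') \<omega>) * cnj (g m \<omega> * g (n - m) \<omega>)))"
      by (intro Bochner_Integration.integral_cong refl) (simp add: mult.commute)
    also have "\<dots> = cnj (LINT \<omega>|M. (g m' \<omega> * g (n - m') \<omega>) * cnj (g m \<omega> * g (n - m) \<omega>))"
      by (rule Bochner_Integration.integral_cnj)
    finally have "(LINT \<omega>|M. (g m \<omega> * g (n - m) \<omega>) * cnj (g m' \<omega> * g (n - m') \<omega>)) =
        cnj (LINT \<omega>|M. (g m' \<omega> * g (n - m') \<omega>) * cnj (g m \<omega> * g (n - m) \<omega>))" .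
    then show ?thesis using *[OF lt assms(4,3)] by simp
  qed
qed

lemma gaussian_product_2nd_moment:
  assumes K: "\<And>n. (\<integral>\<^sup>+\<omega>. ennreal (cmod (g n \<omega>) ^ 4) \<partial>M) \<le> ennreal K" "K \<ge> 1"
  shows "(LINT \<omega>|M. (cmod (g a \<omega> * g b \<omega>))\<^sup>2) \<le> K"
proof -
  have L: "(LINT \<omega>|M. cmod (g n \<omega>) ^ 4) \<le> K" for n
    using K(1)[of n] K(2) nn_integral_eq_integral[OF gaussian_4th_integrable[of n]] by (simp add: ennreal_le_iff)
  have "(cmod (x * y))\<^sup>2 \<le> (cmod x ^ 4 + cmod y ^ 4) / 2" for x y
    using sum_squares_bound[of "(cmod x)\<^sup>2" "(cmod y)\<^sup>2"] by (simp add: norm_mult power_mult_distrib)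
  then have "(LINT \<omega>|M. (cmod (g a \<omega> * g b \<omega>))\<^sup>2) \<le> (LINT \<omega>|M. (cmod (g a \<omega>) ^ 4 + cmod (g b \<omega>) ^ 4) / 2)"
    using gaussian_4th_integrable by (intro integral_mono') auto
  also have "\<dots> = ((LINT \<omega>|M. cmod (g a \<omega>) ^ 4) + (LINT \<omega>|M. cmod (g b \<omega>) ^ 4)) / 2"
    using gaussian_4th_integrable by simp
  also have "\<dots> \<le> K" using L[of a] L[of b] by simp
  finally show ?thesis .
qed

text \<open>
  Expanding the square, only the diagonal terms survive by orthogonality, and these are controlled
  by the fourth moments.
\<close>
lemma gaussian_form_dominant:
  assumes K: "\<And>n. (\<integral>\<^sup>+\<omega>. ennreal (cmod (g n \<omega>) ^ 4) \<partial>M) \<le> ennreal K" "K \<ge> 1"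
    and n: "n \<noteq> 0" and A: "finite A" "\<And>m. m \<in> A \<Longrightarrow> \<bar>n - m\<bar> \<le> \<bar>m\<bar>"
  shows "mean_square M (\<lambda>\<omega>. \<Sum>m\<in>A. a m * (g m \<omega> * g (n - m) \<omega>)) \<le> ennreal (K * (\<Sum>m\<in>A. (cmod (a m))\<^sup>2))"
proof -
  define X where "X = (\<lambda>m \<omega>. g m \<omega> * g (n - m) \<omega>)"
  have int: "integrable M (\<lambda>\<omega>. X m \<omega> * cnj (X m' \<omega>))" for m m'
    using gaussian_product4_integrable[of m "n - m" m' "n - m'"] by (simp add: X_def mult.assoc)
  have orth: "(LINT \<omega>|M. X m \<omega> * cnj (X m' \<omega>)) = 0" if "m \<in> A" "m' \<in> A" "m \<noteq> m'" for m m'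
    unfolding X_def using that A n by (intro gaussian_products_orthogonal) auto
  have diag: "(LINT \<omega>|M. X m \<omega> * cnj (X m \<omega>)) = of_real (LINT \<omega>|M. (cmod (X m \<omega>))\<^sup>2)" for m
    unfolding complex_norm_square[symmetric] by (rule integral_complex_of_real)
  have sq: "of_real ((cmod (\<Sum>m\<in>A. a m * X m \<omega>))\<^sup>2) = (\<Sum>m\<in>A. \<Sum>m'\<in>A. (a m * cnj (a m')) * (X m \<omega> * cnj (X m' \<omega>)))" for \<omega>
    unfolding complex_norm_square cnj_sum sum_product by (simp add: ac_simps)
  have intS: "integrable M (\<lambda>\<omega>. complex_of_real ((cmod (\<Sum>m\<in>A. a m * X m \<omega>))\<^sup>2))"
    unfolding sq by (intro Bochner_Integration.integrable_sum integrable_mult_right int)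
  have "complex_of_real (LINT \<omega>|M. (cmod (\<Sum>m\<in>A. a m * X m \<omega>))\<^sup>2) = (LINT \<omega>|M. complex_of_real ((cmod (\<Sum>m\<in>A. a m * X m \<omega>))\<^sup>2))"
    by (rule integral_complex_of_real[symmetric])
  also have "\<dots> = (\<Sum>m\<in>A. \<Sum>m'\<in>A. (a m * cnj (a m')) * (LINT \<omega>|M. X m \<omega> * cnj (X m' \<omega>)))"
    unfolding sq
    by (subst Bochner_Integration.integral_sum, intro Bochner_Integration.integrable_sum integrable_mult_right int,
        subst Bochner_Integration.integral_sum, intro integrable_mult_right int) (simp add: int)
  also have "\<dots> = (\<Sum>m\<in>A. (a m * cnj (a m)) * (LINT \<omega>|M. X m \<omega> * cnj (X m \<omega>)))"
  proof (intro sum.cong refl)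
    fix m assume m: "m \<in> A"
    have "(\<Sum>m'\<in>A. (a m * cnj (a m')) * (LINT \<omega>|M. X m \<omega> * cnj (X m' \<omega>))) =
       (\<Sum>m'\<in>A. if m' = m then (a m * cnj (a m)) * (LINT \<omega>|M. X m \<omega> * cnj (X m \<omega>)) else 0)"
      using orth m by (intro sum.cong) auto
    then show "(\<Sum>m'\<in>A. (a m * cnj (a m')) * (LINT \<omega>|M. X m \<omega> * cnj (X m' \<omega>))) = (a m * cnj (a m)) * (LINT \<omega>|M. X m \<omega> * cnj (X m \<omega>))"
      using m A(1) by simp
  qed
  also have "\<dots> = of_real (\<Sum>m\<in>A. (cmod (a m))\<^sup>2 * (LINT \<omega>|M. (cmod (X m \<omega>))\<^sup>2))"
    by (simp only: diag complex_norm_square[symmetric] of_real_sum of_real_mult integral_complex_of_real)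
  finally have eq: "(LINT \<omega>|M. (cmod (\<Sum>m\<in>A. a m * X m \<omega>))\<^sup>2) = (\<Sum>m\<in>A. (cmod (a m))\<^sup>2 * (LINT \<omega>|M. (cmod (X m \<omega>))\<^sup>2))"
    by (simp only: of_real_eq_iff)
  also have "\<dots> \<le> (\<Sum>m\<in>A. (cmod (a m))\<^sup>2 * K)"
    unfolding X_def by (intro sum_mono mult_left_mono gaussian_product_2nd_moment K) auto
  also have "\<dots> = K * (\<Sum>m\<in>A. (cmod (a m))\<^sup>2)" by (simp add: sum_distrib_left mult.commute)
  finally have "(LINT \<omega>|M. (cmod (\<Sum>m\<in>A. a m * X m \<omega>))\<^sup>2) \<le> K * (\<Sum>m\<in>A. (cmod (a m))\<^sup>2)" .
  moreover have "integrable M (\<lambda>\<omega>. (cmod (\<Sum>m\<in>A. a m * X m \<omega>))\<^sup>2)"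
    using intS by (simp only: complex_of_real_integrable_eq)
  ultimately have "mean_square M (\<lambda>\<omega>. \<Sum>m\<in>A. a m * X m \<omega>) \<le> ennreal (K * (\<Sum>m\<in>A. (cmod (a m))\<^sup>2))"
    by (subst nn_integral_eq_integral) (auto intro: ennreal_leI)
  then show ?thesis by (simp add: X_def)
qed

text \<open>
  The reflection \<open>m \<mapsto> n - m\<close> leaves the product \<open>g m * g (n - m)\<close> unchanged and exchanges the two
  frequencies, so the terms whose dominant frequency is \<open>n - m\<close> are moved to the case in which \<open>m\<close>
  dominates; each product then occurs at most twice.
\<close>
lemma gaussian_form_bound:
  "\<exists>K\<ge>0. \<forall>n A a. n \<noteq> 0 \<longrightarrow> finite A \<longrightarrow>
     mean_square M (\<lambda>\<omega>. \<Sum>m\<in>A. a m * (g m \<omega> * g (n - m) \<omega>)) \<le> ennreal (K * (\<Sum>m\<in>A. (cmod (a m))\<^sup>2))"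
proof -
  obtain K where K: "K \<ge> 1" "\<And>n. (\<integral>\<^sup>+\<omega>. ennreal (cmod (g n \<omega>) ^ 4) \<partial>M) \<le> ennreal K" using gaussian_4th_moment by blast
  have "mean_square M (\<lambda>\<omega>. \<Sum>m\<in>A. a m * (g m \<omega> * g (n - m) \<omega>)) \<le> ennreal (2 * K * (\<Sum>m\<in>A. (cmod (a m))\<^sup>2))"
    if n: "n \<noteq> 0" and A: "finite A" for n A a
  proof -
    define P where "P = {m \<in> A. \<bar>n - m\<bar> \<le> \<bar>m\<bar>}"
    define Q where "Q = {m \<in> A. \<not> \<bar>n - m\<bar> \<le> \<bar>m\<bar>}"
    define R where "R = (\<lambda>m. n - m) ` Q"
    have fin: "finite P" "finite Q" "finite R" using A by (auto simp: P_def Q_def R_def)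
    have split: "(\<Sum>m\<in>A. f m) = (\<Sum>m\<in>P. f m) + (\<Sum>m\<in>Q. f m)" for f :: "int \<Rightarrow> 'b :: comm_monoid_add"
      unfolding P_def Q_def using A by (subst sum.union_disjoint[symmetric]) (auto intro!: sum.cong)
    have R_sum: "(\<Sum>m\<in>Q. f m) = (\<Sum>m\<in>R. f (n - m))" for f :: "int \<Rightarrow> 'b :: comm_monoid_add"
      unfolding R_def by (subst sum.reindex) (auto simp: inj_on_def)
    let ?S = "\<lambda>A a \<omega>. \<Sum>m\<in>A. a m * (g m \<omega> * g (n - m) \<omega>)"
    have m: "?S B b \<in> borel_measurable M" for B b by measurable
    have S: "?S A a \<omega> = ?S P a \<omega> + ?S R (\<lambda>m. a (n - m)) \<omega>" for \<omega>
      by (simp add: split R_sum mult.commute)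
    have "mean_square M (\<lambda>\<omega>. ?S A a \<omega>) \<le>
      (\<integral>\<^sup>+\<omega>. 2 * ennreal ((cmod (?S P a \<omega>))\<^sup>2) + 2 * ennreal ((cmod (?S R (\<lambda>m. a (n - m)) \<omega>))\<^sup>2) \<partial>M)"
      unfolding S by (rule nn_integral_mono) (rule ennreal_cmod_add_squared_le)
    also have "\<dots> = 2 * mean_square M (\<lambda>\<omega>. ?S P a \<omega>) + 2 * mean_square M (\<lambda>\<omega>. ?S R (\<lambda>m. a (n - m)) \<omega>)"
      by (simp add: nn_integral_add nn_integral_cmult)
    also have "\<dots> \<le> 2 * ennreal (K * (\<Sum>m\<in>P. (cmod (a m))\<^sup>2)) + 2 * ennreal (K * (\<Sum>m\<in>R. (cmod (a (n - m)))\<^sup>2))"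
      using K n fin
      by (intro add_mono mult_left_mono gaussian_form_dominant) (auto simp: P_def R_def Q_def)
    also have "\<dots> = ennreal (2 * (K * (\<Sum>m\<in>P. (cmod (a m))\<^sup>2)) + 2 * (K * (\<Sum>m\<in>R. (cmod (a (n - m)))\<^sup>2)))"
      using K(1) by (simp add: ennreal_mult sum_nonneg)
    also have "\<dots> = ennreal (2 * K * (\<Sum>m\<in>A. (cmod (a m))\<^sup>2))"
      unfolding split[of "\<lambda>m. (cmod (a m))\<^sup>2"] R_sum[of "\<lambda>m. (cmod (a m))\<^sup>2"] by (simp add: algebra_simps)
    finally show ?thesis .
  qed
  with K(1) show ?thesis by (intro exI[of _ "2 * K"]) auto
qed

end

end

section \<open>Truncated squares and approximations of the identity\<close>

text \<open>
  An enumeration of the integers turns the sum into a series.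
\<close>
lemma zsum_measurable [measurable]:
  fixes f :: "'a \<Rightarrow> int \<Rightarrow> ennreal"
  assumes [measurable]: "\<And>n. (\<lambda>x. f x n) \<in> borel_measurable M"
  shows "(\<lambda>x. zsum (f x)) \<in> borel_measurable M"
proof -
  have "zsum (f x) = (\<Sum>k. f x (int_decode k))" for x
    by (subst nn_integral_bij_count_space[OF bij_int_decode, symmetric]) (rule nn_integral_count_space_nat)
  then show ?thesis by simp
qed

lemma measurable_pair_lborel:
  "f \<in> borel_measurable (M \<Otimes>\<^sub>M borel) \<Longrightarrow> f \<in> borel_measurable (M \<Otimes>\<^sub>M (lborel :: real measure))"
  by (subst measurable_cong_sets[OF sets_pair_measure_cong[OF refl sets_lborel] refl])

lemma esob_measurable:
  assumes [measurable]: "\<And>n. (\<lambda>x. c x n) \<in> borel_measurable M"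
  shows "(\<lambda>x. esob r (c x)) \<in> borel_measurable M"
  unfolding esob_def by measurable

lemma cmod_bbm_group [simp]: "cmod (bbm_group t c n) = cmod (c n)"
  unfolding bbm_group_def norm_mult by (simp add: norm_exp_eq_Re)

lemma esob_bbm_group [simp]: "esob r (bbm_group t c) = esob r c"
  by (simp add: esob_def)

lemma sobolev_bbm_group [simp]: "bbm_group t c \<in> sobolev r \<longleftrightarrow> c \<in> sobolev r"
  by (simp add: sobolev_iff_esob)

definition trunc_set :: "nat \<Rightarrow> int \<Rightarrow> int set" where
  "trunc_set N n = {m. \<bar>m\<bar> \<le> int N \<and> \<bar>n - m\<bar> \<le> int N}"

lemma finite_trunc_set [simp]: "finite (trunc_set N n)"
  by (rule finite_subset[of _ "{- int N..int N}"]) (auto simp: trunc_set_def)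

lemma truncated_square_eq: "truncated_square N c n = (\<Sum>m\<in>trunc_set N n. c m * c (n - m))"
  unfolding truncated_square_def trunc_set_def
  by (rule sum.reindex_bij_witness[of _ "\<lambda>m. (m, n - m)" fst]) auto

lemma truncated_square_tendsto:
  assumes "(\<lambda>m. norm (c m * c (n - m))) summable_on UNIV"
  shows "(\<lambda>N. truncated_square N c n) \<longlonglongrightarrow> coeff_mult c c n"
proof -
  have "((\<lambda>m. c m * c (n - m)) has_sum coeff_mult c c n) UNIV"
    unfolding coeff_mult_def using abs_summable_summable[OF assms] by simp
  then have lim: "(sum (\<lambda>m. c m * c (n - m)) \<longlongrightarrow> coeff_mult c c n) (finite_subsets_at_top UNIV)"
    by (simp add: has_sum_def)
  have "filterlim (\<lambda>N. trunc_set N n) (finite_subsets_at_top UNIV) sequentially"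
    unfolding filterlim_finite_subsets_at_top
  proof (intro allI impI, elim conjE)
    fix X :: "int set" assume X: "finite X"
    define B where "B = (\<Sum>m\<in>X. nat \<bar>m\<bar> + nat \<bar>n - m\<bar>)"
    have "X \<subseteq> trunc_set N n" if "N \<ge> B" for N
    proof
      fix m assume "m \<in> X"
      then have "nat \<bar>m\<bar> + nat \<bar>n - m\<bar> \<le> B" unfolding B_def using X by (intro member_le_sum) auto
      then show "m \<in> trunc_set N n" using that by (auto simp: trunc_set_def)
    qed
    then show "\<forall>\<^sub>F N in sequentially. finite (trunc_set N n) \<and> X \<subseteq> trunc_set N n \<and> trunc_set N n \<subseteq> UNIV"
      by (intro eventually_sequentiallyI[of B]) auto
  qed
  from filterlim_compose[OF lim this] show ?thesis by (simp add: truncated_square_eq)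
qed

text \<open>
  Fatou's lemma in the form used throughout: bounds on second moments pass to almost sure limits.
  The bounds may vary with \<open>N\<close>, which leaves room for an error that vanishes in the limit.
\<close>
lemma fatou_mean_square:
  fixes f :: "nat \<Rightarrow> 'a \<Rightarrow> complex"
  assumes [measurable]: "\<And>N. f N \<in> borel_measurable M"
    and lim: "AE x in M. (\<lambda>N. f N x) \<longlonglongrightarrow> h x"
    and le: "\<And>N. mean_square M (\<lambda>x. f N x) \<le> b N" and b: "b \<longlonglongrightarrow> B"
  shows "mean_square M (\<lambda>x. h x) \<le> B"
proof -
  have "mean_square M (\<lambda>x. h x) \<le> (\<integral>\<^sup>+x. liminf (\<lambda>N. ennreal ((cmod (f N x))\<^sup>2)) \<partial>M)"
  proof (rule nn_integral_mono_AE)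
    show "AE x in M. ennreal ((cmod (h x))\<^sup>2) \<le> liminf (\<lambda>N. ennreal ((cmod (f N x))\<^sup>2))"
      using lim
    proof eventually_elim
      case (elim x)
      then have "(\<lambda>N. ennreal ((cmod (f N x))\<^sup>2)) \<longlonglongrightarrow> ennreal ((cmod (h x))\<^sup>2)"
        by (intro tendsto_ennrealI tendsto_intros)
      from lim_imp_Liminf[OF trivial_limit_sequentially this] show ?case by simp
    qed
  qed
  also have "\<dots> \<le> liminf (\<lambda>N. \<integral>\<^sup>+x. ennreal ((cmod (f N x))\<^sup>2) \<partial>M)"
    by (rule nn_integral_liminf) measurable
  also have "\<dots> \<le> liminf b" by (intro Liminf_mono always_eventually allI le)
  also have "\<dots> = B" using b by (simp add: lim_imp_Liminf)
  finally show ?thesis .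
qed

lemma min_1_le_powr: "0 < y \<Longrightarrow> 0 \<le> \<delta> \<Longrightarrow> \<delta> \<le> 1 \<Longrightarrow> min 1 y \<le> y powr \<delta>" for y :: real
proof (cases "y \<le> 1")
  case True
  assume "0 < y" "0 \<le> \<delta>" "\<delta> \<le> 1"
  then show ?thesis using powr_mono'[of \<delta> 1 y] True by simp
next
  case False
  assume "0 < y" "0 \<le> \<delta>" "\<delta> \<le> 1"
  then show ?thesis using False ge_one_powr_ge_zero[of y \<delta>] by simp
qed

lemma cmod_diff_mult_le: "cmod (a * b - c * d) \<le> cmod (a - c) * cmod b + cmod c * cmod (b - d)"
proof -
  have "a * b - c * d = (a - c) * b + c * (b - d)" by (simp add: algebra_simps)
  then show ?thesis by (metis norm_mult norm_triangle_ineq)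
qed

text \<open>
  What is used of a mollifier: bounded symbols that tend to one at low frequencies, with increments
  in \<open>k\<close> that are small of relative order \<open>1 / k\<close>, uniformly in the frequency as well as with an
  additional gain at low frequencies.
\<close>
definition approximates_identity :: "(nat \<Rightarrow> int \<Rightarrow> complex) \<Rightarrow> bool" where
  "approximates_identity m \<longleftrightarrow> (\<forall>k\<ge>1. \<forall>n. cmod (m k n) \<le> 1 \<and> cmod (m k n - 1) \<le> \<bar>of_int n\<bar> / real k) \<and>
    (\<exists>C\<ge>0. \<forall>k\<ge>1. \<forall>n. cmod (m (Suc k) n - m k n) \<le> C / real k \<and>
       cmod (m (Suc k) n - m k n) \<le> \<bar>of_int n\<bar> / (real k)\<^sup>2)"

lemma approximates_identity_mol_symbol:
  "mollifier_kernel \<rho> \<Longrightarrow> approximates_identity (mol_symbol \<rho>)"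
  unfolding approximates_identity_def
  using norm_mol_symbol_le_1 mol_symbol_near_1 mol_symbol_increment_high mol_symbol_increment_low by meson

text \<open>
  A bound by \<open>min 1 y\<close> with \<open>y = jbracket n / k\<close> is weakened to a bound by \<open>y powr \<delta>\<close>.
\<close>
lemma approximates_identity_interpolate:
  assumes m: "approximates_identity m" and \<delta>: "0 \<le> \<delta>" "\<delta> \<le> 1"
  shows "\<exists>D\<ge>0. \<forall>k\<ge>1. \<forall>n. cmod (m k n - 1) \<le> D * real k powr - \<delta> * jbracket n powr \<delta> \<and>
     cmod (m (Suc k) n - m k n) \<le> D * real k powr (- 1 - \<delta>) * jbracket n powr \<delta>"
proof -
  obtain C where C: "C \<ge> 0" "\<And>k n. k \<ge> 1 \<Longrightarrow> cmod (m (Suc k) n - m k n) \<le> C / real k"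
     "\<And>k n. k \<ge> 1 \<Longrightarrow> cmod (m (Suc k) n - m k n) \<le> \<bar>of_int n\<bar> / (real k)\<^sup>2"
    and m1: "\<And>k n. k \<ge> 1 \<Longrightarrow> cmod (m k n) \<le> 1" "\<And>k n. k \<ge> 1 \<Longrightarrow> cmod (m k n - 1) \<le> \<bar>of_int n\<bar> / real k"
    using m unfolding approximates_identity_def by metis
  have "cmod (m k n - 1) \<le> (C + 2) * real k powr - \<delta> * jbracket n powr \<delta> \<and>
     cmod (m (Suc k) n - m k n) \<le> (C + 2) * real k powr (- 1 - \<delta>) * jbracket n powr \<delta>" if k: "k \<ge> 1" for k n
  proof -
    define y where "y = jbracket n / real k"
    have k0: "real k > 0" using k by simp
    have y: "y > 0" unfolding y_def using k0 jbracket_pos[of n] by simp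
    have ny: "\<bar>of_int n\<bar> / real k \<le> y" unfolding y_def by (intro divide_right_mono abs_le_jbracket) simp
    have yd: "min 1 y \<le> real k powr - \<delta> * jbracket n powr \<delta>"
      using min_1_le_powr[OF y \<delta>] jbracket_pos[of n] k0
      by (simp add: y_def powr_divide powr_minus field_simps)
    have "cmod (m k n - 1) \<le> 2" using norm_triangle_ineq4[of "m k n" 1] m1(1)[OF k, of n] by simp
    then have "cmod (m k n - 1) \<le> 2 * min 1 y" using m1(2)[OF k, of n] ny y by (auto simp: min_def)
    also have "\<dots> \<le> (C + 2) * (real k powr - \<delta> * jbracket n powr \<delta>)"
      using C(1) y yd by (intro mult_mono) auto
    finally have 1: "cmod (m k n - 1) \<le> (C + 2) * (real k powr - \<delta> * jbracket n powr \<delta>)" .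
    have "\<bar>of_int n\<bar> / (real k)\<^sup>2 = (\<bar>of_int n\<bar> / real k) / real k" by (simp add: power2_eq_square)
    also have "\<dots> \<le> y / real k" using ny k0 by (intro divide_right_mono) auto
    finally have "cmod (m (Suc k) n - m k n) \<le> y / real k" using C(3)[OF k, of n] by simp
    then have "cmod (m (Suc k) n - m k n) \<le> min C y / real k" using C(2)[OF k, of n] by (auto simp: min_def)
    also have "min C y \<le> (C + 2) * min 1 y" using C(1) y by (auto simp: min_def algebra_simps add_increasing)
    also have "(C + 2) * min 1 y \<le> (C + 2) * (real k powr - \<delta> * jbracket n powr \<delta>)"
      using C(1) yd by (intro mult_left_mono) auto
    finally have "cmod (m (Suc k) n - m k n) \<le> (C + 2) * (real k powr - \<delta> * jbracket n powr \<delta>) / real k"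
      using k0 by (auto simp: divide_right_mono)
    moreover have "real k powr (- 1 - \<delta>) = real k powr - \<delta> / real k"
      using k0 powr_diff[of "real k" "- \<delta>" 1] by (simp add: minus_diff_commute)
    ultimately show ?thesis using 1 by (simp add: mult.assoc)
  qed
  then show ?thesis using C(1) by (intro exI[of _ "C + 2"]) auto
qed

text \<open>
  The mode \<open>(l, j)\<close> of a square is multiplied by \<open>m k l * m k j\<close>. As the symbols are bounded by one the
  errors of the two factors add up, and a sum of two weights that are at least one is at most twice
  their product.
\<close>
lemma approximates_identity_pair:
  assumes m: "approximates_identity m" and \<delta>: "0 \<le> \<delta>" "\<delta> \<le> 1"
  shows "\<exists>D\<ge>0. \<forall>k\<ge>1. \<forall>l j. cmod (m k l * m k j - 1) \<le> D * real k powr - \<delta> * (jbracket l powr \<delta> * jbracket j powr \<delta>) \<and>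
     cmod (m (Suc k) l * m (Suc k) j - m k l * m k j) \<le> D * real k powr (- 1 - \<delta>) * (jbracket l powr \<delta> * jbracket j powr \<delta>)"
proof -
  obtain D where D: "D \<ge> 0" "\<And>k n. k \<ge> 1 \<Longrightarrow> cmod (m k n - 1) \<le> D * real k powr - \<delta> * jbracket n powr \<delta>"
     "\<And>k n. k \<ge> 1 \<Longrightarrow> cmod (m (Suc k) n - m k n) \<le> D * real k powr (- 1 - \<delta>) * jbracket n powr \<delta>"
    using approximates_identity_interpolate[OF assms] by metis
  have m1: "\<And>k n. k \<ge> 1 \<Longrightarrow> cmod (m k n) \<le> 1" using m unfolding approximates_identity_def by auto
  have sum: "jbracket l powr \<delta> + jbracket j powr \<delta> \<le> 2 * (jbracket l powr \<delta> * jbracket j powr \<delta>)" for l j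
  proof -
    have "1 \<le> jbracket l powr \<delta>" "1 \<le> jbracket j powr \<delta>" using ge_one_powr_ge_zero jbracket_ge_1 \<delta> by auto
    then have "jbracket l powr \<delta> * 1 \<le> jbracket l powr \<delta> * jbracket j powr \<delta>" "1 * jbracket j powr \<delta> \<le> jbracket l powr \<delta> * jbracket j powr \<delta>"
      by (intro mult_mono; simp)+
    then show ?thesis by simp
  qed
  have gen: "cmod (a * b - c * d) \<le> 2 * D * x * (jbracket l powr \<delta> * jbracket j powr \<delta>)"
    if "cmod (a - c) \<le> D * x * jbracket l powr \<delta>" "cmod (b - d) \<le> D * x * jbracket j powr \<delta>" "cmod b \<le> 1" "cmod c \<le> 1" "x \<ge> 0"
    for a b c d x l j
  proof -
    have "cmod (a * b - c * d) \<le> cmod (a - c) * cmod b + cmod c * cmod (b - d)" by (rule cmod_diff_mult_le)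
    also have "\<dots> \<le> cmod (a - c) * 1 + 1 * cmod (b - d)"
      using that by (intro add_mono mult_left_mono mult_right_mono) auto
    also have "\<dots> \<le> D * x * (jbracket l powr \<delta> + jbracket j powr \<delta>)" using that by (simp add: distrib_left)
    also have "\<dots> \<le> D * x * (2 * (jbracket l powr \<delta> * jbracket j powr \<delta>))"
      using that D(1) by (intro mult_left_mono sum) auto
    finally show ?thesis by (simp add: ac_simps)
  qed
  have "cmod (m k l * m k j - 1) \<le> 2 * D * real k powr - \<delta> * (jbracket l powr \<delta> * jbracket j powr \<delta>) \<and>
     cmod (m (Suc k) l * m (Suc k) j - m k l * m k j) \<le> 2 * D * real k powr (- 1 - \<delta>) * (jbracket l powr \<delta> * jbracket j powr \<delta>)"
    if k: "k \<ge> 1" for k l j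
    using gen[of "m k l" 1 "real k powr - \<delta>" l "m k j" 1 j] gen[of "m (Suc k) l" "m k l" "real k powr (- 1 - \<delta>)" l "m (Suc k) j" "m k j" j]
      D(2,3)[OF k] m1[OF k] m1[of "Suc k"] by simp
  then show ?thesis using D(1) by (intro exI[of _ "2 * D"]) auto
qed

section \<open>The square of the linear evolution and weighted telescoping\<close>

text \<open>
  The coefficients of the square of the linear evolution as a limit of truncated sums rather than as
  an infinite sum, so that joint measurability in the sample point and in time is evident. On
  \<open>H^(1/2)\<close> both definitions agree.
\<close>
definition evolution_square :: "(int \<Rightarrow> complex) \<Rightarrow> real \<Rightarrow> int \<Rightarrow> complex" where
  "evolution_square c t n = lim (\<lambda>N. truncated_square N (bbm_group t c) n)"

lemma evolution_square_limit:
  assumes "c \<in> sobolev (1 / 2)"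
  shows "evolution_square c t = coeff_mult (bbm_group t c) (bbm_group t c)"
    and "(\<lambda>N. truncated_square N (bbm_group t c) n) \<longlonglongrightarrow> evolution_square c t n"
proof -
  have "bbm_group t c \<in> sobolev (1 / 2)" "bbm_group t c \<in> sobolev (- 0)"
    using assms sobolev_mono[of 0 "1 / 2" c] by auto
  then have "(\<lambda>l. norm (bbm_group t c l * bbm_group t c (n - l))) summable_on UNIV" for n
    by (intro product_summable[of 0 "1 / 2"]) auto
  note lim = truncated_square_tendsto[OF this]
  then show eq: "evolution_square c t = coeff_mult (bbm_group t c) (bbm_group t c)"
    unfolding evolution_square_def by (intro ext limI)
  show "(\<lambda>N. truncated_square N (bbm_group t c) n) \<longlonglongrightarrow> evolution_square c t n"
    unfolding eq by (rule lim)
qed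

lemma truncated_square_multiplier:
  "truncated_square N (bbm_group t (\<lambda>l. m l * c l)) n =
     (\<Sum>l\<in>trunc_set N n. (m l * m (n - l)) * (bbm_group t c l * bbm_group t c (n - l)))"
  unfolding truncated_square_eq by (intro sum.cong) (auto simp: bbm_group_def ac_simps)

lemma bbm_nonlinearity_measurable:
  assumes "\<And>n. n \<noteq> 0 \<Longrightarrow> (\<lambda>x. d x n) \<in> borel_measurable M"
  shows "(\<lambda>x. bbm_nonlinearity (d x) n) \<in> borel_measurable M"
  using assms[of n] by (cases "n = 0") (auto simp: bbm_nonlinearity_def)

lemma bbm_nonlinearity_diff: "bbm_nonlinearity (\<lambda>n. a n - b n) = (\<lambda>n. bbm_nonlinearity a n - bbm_nonlinearity b n)"
  and bbm_nonlinearity_sum: "bbm_nonlinearity (\<lambda>n. \<Sum>i\<in>I. x i n) = (\<lambda>n. \<Sum>i\<in>I. bbm_nonlinearity (x i) n)"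
  by (auto simp: bbm_nonlinearity_def fun_eq_iff algebra_simps sum_distrib_left)

text \<open>
  Cauchy--Schwarz with weights \<open>w\<close>; it takes the place of the triangle inequality for squared norms.
\<close>
lemma esob_sum_weighted:
  assumes I: "finite I" and w: "\<And>i. i \<in> I \<Longrightarrow> w i > 0" and Z: "(\<Sum>i\<in>I. 1 / w i) \<le> Z"
  shows "esob r (\<lambda>n. \<Sum>i\<in>I. x i n) \<le> ennreal Z * (\<Sum>i\<in>I. ennreal (w i) * esob r (x i))"
proof -
  have pt: "(cmod (\<Sum>i\<in>I. x i n))\<^sup>2 \<le> Z * (\<Sum>i\<in>I. w i * (cmod (x i n))\<^sup>2)" for n
  proof -
    have "(cmod (\<Sum>i\<in>I. x i n))\<^sup>2 \<le> (\<Sum>i\<in>I. cmod (x i n))\<^sup>2"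
      by (intro power_mono norm_sum) auto
    also have "(\<Sum>i\<in>I. cmod (x i n)) = (\<Sum>i\<in>I. sqrt (1 / w i) * (sqrt (w i) * cmod (x i n)))"
      using w by (intro sum.cong) (auto simp: real_sqrt_divide less_imp_neq[symmetric])
    also have "(\<dots>)\<^sup>2 \<le> (\<Sum>i\<in>I. (sqrt (1 / w i))\<^sup>2) * (\<Sum>i\<in>I. (sqrt (w i) * cmod (x i n))\<^sup>2)"
      by (rule Cauchy_Schwarz_ineq_sum)
    also have "\<dots> = (\<Sum>i\<in>I. 1 / w i) * (\<Sum>i\<in>I. w i * (cmod (x i n))\<^sup>2)"
      using w by (simp add: power_mult_distrib less_imp_le cong: sum.cong)
    also have "\<dots> \<le> Z * (\<Sum>i\<in>I. w i * (cmod (x i n))\<^sup>2)"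
      using w by (intro mult_right_mono Z sum_nonneg) (simp add: less_imp_le)
    finally show ?thesis .
  qed
  have "0 \<le> (\<Sum>i\<in>I. 1 / w i)" using w by (intro sum_nonneg) (simp add: less_imp_le)
  with Z have Z0: "Z \<ge> 0" by linarith
  have "esob r (\<lambda>n. \<Sum>i\<in>I. x i n) \<le> zsum (\<lambda>n. ennreal Z * (\<Sum>i\<in>I. ennreal (w i) * ennreal (jbracket n powr (2 * r) * (cmod (x i n))\<^sup>2)))"
    unfolding esob_def
  proof (intro nn_integral_mono)
    fix n
    have "jbracket n powr (2 * r) * (cmod (\<Sum>i\<in>I. x i n))\<^sup>2 \<le> jbracket n powr (2 * r) * (Z * (\<Sum>i\<in>I. w i * (cmod (x i n))\<^sup>2))"
      by (intro mult_left_mono pt) auto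
    also have "\<dots> = Z * (\<Sum>i\<in>I. w i * (jbracket n powr (2 * r) * (cmod (x i n))\<^sup>2))"
      by (simp add: sum_distrib_left ac_simps)
    finally have "ennreal (jbracket n powr (2 * r) * (cmod (\<Sum>i\<in>I. x i n))\<^sup>2) \<le> ennreal (Z * (\<Sum>i\<in>I. w i * (jbracket n powr (2 * r) * (cmod (x i n))\<^sup>2)))"
      by (rule ennreal_leI)
    also have "\<dots> = ennreal Z * ennreal (\<Sum>i\<in>I. w i * (jbracket n powr (2 * r) * (cmod (x i n))\<^sup>2))"
      using Z0 w by (intro ennreal_mult sum_nonneg) (simp_all add: less_imp_le)
    also have "ennreal (\<Sum>i\<in>I. w i * (jbracket n powr (2 * r) * (cmod (x i n))\<^sup>2)) = (\<Sum>i\<in>I. ennreal (w i * (jbracket n powr (2 * r) * (cmod (x i n))\<^sup>2)))"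
      using w by (intro sum_ennreal[symmetric]) (simp add: less_imp_le)
    also have "\<dots> = (\<Sum>i\<in>I. ennreal (w i) * ennreal (jbracket n powr (2 * r) * (cmod (x i n))\<^sup>2))"
      using w by (intro sum.cong refl ennreal_mult) (simp_all add: less_imp_le)
    finally show "ennreal (jbracket n powr (2 * r) * (cmod (\<Sum>i\<in>I. x i n))\<^sup>2) \<le> ennreal Z * (\<Sum>i\<in>I. ennreal (w i) * ennreal (jbracket n powr (2 * r) * (cmod (x i n))\<^sup>2))" .
  qed
  also have "\<dots> = ennreal Z * (\<Sum>i\<in>I. ennreal (w i) * esob r (x i))"
    unfolding esob_def by (simp add: nn_integral_cmult nn_integral_sum)
  finally show ?thesis .
qed

lemma sum_powr_bounded:
  assumes "0 < \<delta>" shows "\<exists>Z\<ge>0. \<forall>k l. (\<Sum>i\<in>{k..<l}. 1 / real i powr (1 + \<delta>)) \<le> Z"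
proof -
  have s: "summable (\<lambda>i. real i powr - (1 + \<delta>))" using assms by (simp add: summable_real_powr_iff)
  have "(\<Sum>i\<in>{k..<l}. 1 / real i powr (1 + \<delta>)) \<le> (\<Sum>i. real i powr - (1 + \<delta>))" for k l
    unfolding powr_minus_divide[symmetric] by (intro sum_le_suminf s) auto
  then show ?thesis using suminf_nonneg[OF s] by auto
qed

text \<open>
  The hypothesis says that \<open>h k\<close> is controlled by \<open>h l\<close> at any later index up to a part of the tail
  of a convergent series. Letting \<open>l\<close> run along a sequence realising the lower limit removes \<open>h l\<close>, so
  vanishing of the lower limit is enough for convergence of the full sequence.
\<close>
lemma ennreal_liminf_tail:
  fixes h :: "nat \<Rightarrow> ennreal" and c :: "nat \<Rightarrow> ennreal"
  assumes le: "\<And>k l. 1 \<le> k \<Longrightarrow> k \<le> l \<Longrightarrow> h k \<le> 2 * h l + Z * (\<Sum>i\<in>{k..<l}. c i)"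
    and c: "(\<Sum>i. c i) < \<infinity>" and Z: "Z < \<infinity>" and liminf: "liminf (\<lambda>l. 2 * h l) = 0"
  shows "h \<longlonglongrightarrow> 0"
proof -
  define S where "S = (\<Sum>i. c i)"
  define R where "R = (\<lambda>k. Z * (S - (\<Sum>i<k. c i)))"
  have "(\<lambda>k. \<Sum>i<k. c i) \<longlonglongrightarrow> S" unfolding S_def by (intro summable_LIMSEQ summableI)
  then have "(\<lambda>k. S - (\<Sum>i<k. c i)) \<longlonglongrightarrow> S - S"
    using c by (intro tendsto_diff_ennreal tendsto_const) (auto simp: S_def)
  then have R: "R \<longlonglongrightarrow> 0"
    unfolding R_def using c Z ennreal_tendsto_cmult[of Z] by (fastforce simp: S_def)
  have Rfin: "R k < \<infinity>" for k
    using c Z by (auto simp: R_def S_def ennreal_mult_less_top intro: le_less_trans[OF diff_le_self_ennreal])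
  have "h k \<le> R k" if k: "1 \<le> k" for k
  proof -
    have "h k - R k \<le> 2 * h l" if l: "k \<le> l" for l
    proof -
      have "(\<Sum>i<k. c i) + (\<Sum>i\<in>{k..<l}. c i) = (\<Sum>i<l. c i)"
        using l by (subst sum.union_disjoint[symmetric]) (auto intro!: sum.cong)
      also have "\<dots> \<le> S" unfolding S_def by (intro sum_le_suminf summableI) auto
      finally have "(\<Sum>i\<in>{k..<l}. c i) \<le> S - (\<Sum>i<k. c i)"
        using c by (subst ennreal_le_minus_iff) (auto simp: S_def add.commute)
      then have "h k \<le> 2 * h l + R k"
        unfolding R_def by (intro order_trans[OF le[OF k l]] add_left_mono mult_left_mono) auto
      then show ?thesis using Rfin[of k] by (auto simp: ennreal_minus_le_iff add.commute)
    qed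
    then have "h k - R k \<le> liminf (\<lambda>l. 2 * h l)"
      by (intro Liminf_bounded eventually_sequentiallyI[of k])
    then have "h k - R k = 0" using liminf by simp
    then show ?thesis using Rfin[of k] by (simp add: diff_eq_0_iff_ennreal)
  qed
  then show ?thesis
    by (intro tendsto_sandwich[OF _ _ tendsto_const R] always_eventually eventually_sequentiallyI[of 1]) auto
qed

section \<open>Almost sure convergence of the squares of the linear evolutions\<close>

context prob_space
begin

context
  fixes g :: "int \<Rightarrow> 'a \<Rightarrow> complex"
  assumes g: "gaussian_family M g"
begin

lemma random_data_measurable: "(\<lambda>\<omega>. random_data \<alpha> g \<omega> n) \<in> borel_measurable M"
  using gaussian_measurable[OF g] unfolding random_data_def by measurable

text \<open>
  The expected squared norm is at most a constant times the sum of \<open>jbracket n powr - (2 * \<sigma> + 2 * \<alpha>)\<close>,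
  whose exponent exceeds one in modulus.
\<close>
lemma random_data_sobolev:
  assumes "\<sigma> > 1 / 2 - \<alpha>" shows "AE \<omega> in M. random_data \<alpha> g \<omega> \<in> sobolev (- \<sigma>)"
proof -
  note [measurable] = gaussian_measurable[OF g]
  obtain K where K: "\<And>n. (\<integral>\<^sup>+\<omega>. ennreal (cmod (g n \<omega>) ^ 2) \<partial>M) \<le> ennreal K"
    using gaussian_2nd_moment[OF g] by blast
  have eq: "ennreal (jbracket n powr (2 * - \<sigma>) * (cmod (random_data \<alpha> g \<omega> n))\<^sup>2) = ennreal (jbracket n powr - (2 * \<sigma> + 2 * \<alpha>)) * ennreal (cmod (g n \<omega>) ^ 2)" for n \<omega>
  proof -
    have "(cmod (random_data \<alpha> g \<omega> n))\<^sup>2 = jbracket n powr - (2 * \<alpha>) * cmod (g n \<omega>) ^ 2"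
      by (simp add: random_data_def norm_divide power_divide jbracket_powr_power2 powr_minus_divide)
    then show ?thesis by (simp add: ennreal_mult[symmetric] mult.assoc[symmetric] powr_add[symmetric])
  qed
  have "(\<integral>\<^sup>+\<omega>. esob (- \<sigma>) (random_data \<alpha> g \<omega>) \<partial>M) = zsum (\<lambda>n. \<integral>\<^sup>+\<omega>. ennreal (jbracket n powr - (2 * \<sigma> + 2 * \<alpha>)) * ennreal (cmod (g n \<omega>) ^ 2) \<partial>M)"
    unfolding esob_def eq by (rule nn_integral_count_space_nn_integral) auto
  also have "\<dots> = zsum (\<lambda>n. ennreal (jbracket n powr - (2 * \<sigma> + 2 * \<alpha>)) * (\<integral>\<^sup>+\<omega>. ennreal (cmod (g n \<omega>) ^ 2) \<partial>M))"
    by (intro nn_integral_cong nn_integral_cmult) measurable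
  also have "\<dots> \<le> zsum (\<lambda>n. ennreal (jbracket n powr - (2 * \<sigma> + 2 * \<alpha>)) * ennreal K)"
    by (intro nn_integral_mono mult_left_mono K) auto
  also have "\<dots> = zsum (\<lambda>n. ennreal (jbracket n powr - (2 * \<sigma> + 2 * \<alpha>))) * ennreal K"
    by (rule nn_integral_multc) simp
  also have "\<dots> < \<infinity>"
    using zsum_jbracket_finite[of "2 * \<sigma> + 2 * \<alpha>"] assms by (simp add: ennreal_mult_less_top)
  finally have "(\<integral>\<^sup>+\<omega>. esob (- \<sigma>) (random_data \<alpha> g \<omega>) \<partial>M) \<noteq> \<infinity>" by simp
  moreover have "(\<lambda>\<omega>. esob (- \<sigma>) (random_data \<alpha> g \<omega>)) \<in> borel_measurable M"
    by (intro esob_measurable random_data_measurable)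
  ultimately have "AE \<omega> in M. esob (- \<sigma>) (random_data \<alpha> g \<omega>) \<noteq> \<infinity>"
    by (intro nn_integral_PInf_AE) auto
  then show ?thesis by eventually_elim (simp add: sobolev_iff_esob less_top)
qed

text \<open>
  The unimodular factors of the linear group and the decay of the data are absorbed in the
  coefficients of the quadratic form; what remains is a convolution of two weights of exponent
  \<open>2 * (\<alpha> - \<delta>)\<close>. The loss of \<open>\<delta>\<close> pays for the rate in \<open>k\<close>.
\<close>
lemma random_form_mean_square:
  assumes "0 \<le> \<mu>" "\<mu> \<le> 2 * (\<alpha> - \<delta>)" "4 * (\<alpha> - \<delta>) - \<mu> > 1"
  shows "\<exists>K\<ge>0. \<forall>D w n N t. n \<noteq> 0 \<longrightarrow> D \<ge> 0 \<longrightarrow> (\<forall>l. cmod (w l) \<le> D * (jbracket l powr \<delta> * jbracket (n - l) powr \<delta>)) \<longrightarrow>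
    mean_square M (\<lambda>\<omega>. \<Sum>l\<in>trunc_set N n. w l * (bbm_group t (random_data \<alpha> g \<omega>) l * bbm_group t (random_data \<alpha> g \<omega>) (n - l)))
      \<le> ennreal (K * D\<^sup>2 * jbracket n powr - \<mu>)"
proof -
  define \<beta> where "\<beta> = \<alpha> - \<delta>"
  obtain K where K: "K \<ge> 0" "\<And>n A a. n \<noteq> 0 \<Longrightarrow> finite A \<Longrightarrow>
     mean_square M (\<lambda>\<omega>. \<Sum>m\<in>A. a m * (g m \<omega> * g (n - m) \<omega>)) \<le> ennreal (K * (\<Sum>m\<in>A. (cmod (a m))\<^sup>2))"
    using gaussian_form_bound[OF g] by blast
  obtain C where C: "C \<ge> 0" "\<And>m. zsum (\<lambda>n. ennreal (jbracket n powr - (2 * \<beta>) * jbracket (m - n) powr - (2 * \<beta>))) \<le> ennreal (C * jbracket m powr - \<mu>)"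
    using weight_convolution[of \<mu> "2 * \<beta>" "2 * \<beta>"] assms unfolding \<beta>_def by auto
  have "mean_square M (\<lambda>\<omega>. \<Sum>l\<in>trunc_set N n. w l * (bbm_group t (random_data \<alpha> g \<omega>) l * bbm_group t (random_data \<alpha> g \<omega>) (n - l)))
      \<le> ennreal (K * C * D\<^sup>2 * jbracket n powr - \<mu>)"
    if n: "n \<noteq> 0" and D: "D \<ge> 0" and w: "\<And>l. cmod (w l) \<le> D * (jbracket l powr \<delta> * jbracket (n - l) powr \<delta>)" for D w n N t
  proof -
    define a where "a = (\<lambda>l. w l * (bbm_group t (\<lambda>l. 1) l * bbm_group t (\<lambda>l. 1) (n - l)) / of_real (jbracket l powr \<alpha> * jbracket (n - l) powr \<alpha>))"
    have eq: "w l * (bbm_group t (random_data \<alpha> g \<omega>) l * bbm_group t (random_data \<alpha> g \<omega>) (n - l)) = a l * (g l \<omega> * g (n - l) \<omega>)" for l \<omega>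
      by (simp add: a_def bbm_group_def random_data_def)
    have pt: "(cmod (a l))\<^sup>2 \<le> D\<^sup>2 * (jbracket l powr - (2 * \<beta>) * jbracket (n - l) powr - (2 * \<beta>))" for l
    proof -
      have "cmod (a l) = cmod (w l) / (jbracket l powr \<alpha> * jbracket (n - l) powr \<alpha>)"
        by (simp add: a_def norm_divide norm_mult)
      also have "\<dots> \<le> D * (jbracket l powr \<delta> * jbracket (n - l) powr \<delta>) / (jbracket l powr \<alpha> * jbracket (n - l) powr \<alpha>)"
        by (intro divide_right_mono w) auto
      also have "\<dots> = D * (jbracket l powr - \<beta> * jbracket (n - l) powr - \<beta>)"
        by (simp add: \<beta>_def powr_diff)
      finally have "(cmod (a l))\<^sup>2 \<le> (D * (jbracket l powr - \<beta> * jbracket (n - l) powr - \<beta>))\<^sup>2"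
        by (intro power_mono) auto
      then show ?thesis by (simp add: power_mult_distrib jbracket_powr_power2)
    qed
    have "(\<Sum>l\<in>trunc_set N n. jbracket l powr - (2 * \<beta>) * jbracket (n - l) powr - (2 * \<beta>)) \<le> C * jbracket n powr - \<mu>"
    proof -
      have "ennreal (\<Sum>l\<in>trunc_set N n. jbracket l powr - (2 * \<beta>) * jbracket (n - l) powr - (2 * \<beta>)) =
         (\<Sum>l\<in>trunc_set N n. ennreal (jbracket l powr - (2 * \<beta>) * jbracket (n - l) powr - (2 * \<beta>)))"
        by (intro sum_ennreal[symmetric]) simp
      also have "\<dots> \<le> zsum (\<lambda>l. ennreal (jbracket l powr - (2 * \<beta>) * jbracket (n - l) powr - (2 * \<beta>)))"
        by (rule sum_le_zsum) simp
      also have "\<dots> \<le> ennreal (C * jbracket n powr - \<mu>)" by (rule C(2))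
      finally show ?thesis using C(1) by (subst (asm) ennreal_le_iff) auto
    qed
    then have "(\<Sum>l\<in>trunc_set N n. (cmod (a l))\<^sup>2) \<le> D\<^sup>2 * (C * jbracket n powr - \<mu>)"
      using sum_mono[of "trunc_set N n" "\<lambda>l. (cmod (a l))\<^sup>2", OF pt]
      by (simp only: sum_distrib_left[symmetric]) (meson mult_left_mono order_trans zero_le_power2)
    then have "K * (\<Sum>l\<in>trunc_set N n. (cmod (a l))\<^sup>2) \<le> K * (D\<^sup>2 * (C * jbracket n powr - \<mu>))"
      using K(1) by (rule mult_left_mono)
    with K(2)[OF n finite_trunc_set, of a N n] show ?thesis
      unfolding eq by (elim order_trans) (auto intro!: ennreal_leI simp: ac_simps)
  qed
  then show ?thesis using K(1) C(1) by (intro exI[of _ "K * C"]) auto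
qed

lemma joint_bbm_group_measurable [measurable]:
  "(\<lambda>x. bbm_group (snd x) (\<lambda>l. m l * random_data \<alpha> g (fst x) l) n) \<in> borel_measurable (M \<Otimes>\<^sub>M borel)"
proof -
  have [measurable]: "(\<lambda>x. random_data \<alpha> g (fst x) n) \<in> borel_measurable (M \<Otimes>\<^sub>M borel)"
    using random_data_measurable by (rule measurable_compose[OF measurable_fst])
  have "(\<lambda>t. osc (t * bbm_symbol n)) \<in> borel_measurable borel"
    by (intro borel_measurable_continuous_onI continuous_intros)
  then have [measurable]: "(\<lambda>x. osc (snd x * bbm_symbol n)) \<in> borel_measurable (M \<Otimes>\<^sub>M borel)"
    by (rule measurable_compose[OF measurable_snd])
  show ?thesis unfolding bbm_group_def by measurable
qed

lemma joint_truncated_square_measurable [measurable]: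
  "(\<lambda>x. truncated_square N (bbm_group (snd x) (\<lambda>l. m l * random_data \<alpha> g (fst x) l)) n) \<in> borel_measurable (M \<Otimes>\<^sub>M borel)"
  unfolding truncated_square_eq by measurable

lemma joint_evolution_square_measurable [measurable]:
  "(\<lambda>x. evolution_square (\<lambda>l. m l * random_data \<alpha> g (fst x) l) (snd x) n) \<in> borel_measurable (M \<Otimes>\<^sub>M borel)"
  unfolding evolution_square_def by measurable

end

lemma section_measurable:
  assumes "(\<lambda>x. f (fst x) (snd x)) \<in> borel_measurable (M \<Otimes>\<^sub>M borel)"
  shows "(\<lambda>\<omega>. f \<omega> t) \<in> borel_measurable M" "\<omega> \<in> space M \<Longrightarrow> (\<lambda>t. f \<omega> t) \<in> borel_measurable borel"
proof -
  have "(\<lambda>\<omega>. (\<omega>, t)) \<in> M \<rightarrow>\<^sub>M M \<Otimes>\<^sub>M borel" by measurable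
  from measurable_compose[OF this assms] show "(\<lambda>\<omega>. f \<omega> t) \<in> borel_measurable M" by simp
  assume "\<omega> \<in> space M"
  then have "(\<lambda>t. (\<omega>, t)) \<in> borel \<rightarrow>\<^sub>M M \<Otimes>\<^sub>M borel" by measurable
  from measurable_compose[OF this assms] show "(\<lambda>t. f \<omega> t) \<in> borel_measurable borel" by simp
qed

text \<open>
  Tonelli's theorem; \<open>jbracket n powr (2 * s - 2)\<close> is the \<open>H^s\<close> weight after the gain of one derivative.
\<close>
lemma expectation_esob_bbm:
  assumes meas: "\<And>n. n \<noteq> 0 \<Longrightarrow> (\<lambda>\<omega>. d \<omega> n) \<in> borel_measurable M"
    and le: "\<And>n. n \<noteq> 0 \<Longrightarrow> mean_square M (\<lambda>\<omega>. d \<omega> n) \<le> ennreal (B * jbracket n powr - \<mu>)" and B: "B \<ge> 0"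
  shows "(\<integral>\<^sup>+\<omega>. esob s (bbm_nonlinearity (d \<omega>)) \<partial>M) \<le> ennreal B * zsum (\<lambda>n. ennreal (jbracket n powr - (2 + \<mu> - 2 * s)))"
proof -
  let ?f = "\<lambda>n \<omega>. if n = 0 then 0 else ennreal (jbracket n powr (2 * s - 2)) * ennreal ((cmod (d \<omega> n))\<^sup>2)"
  have m: "?f n \<in> borel_measurable M" for n using meas[of n] by (cases "n = 0") auto
  have "(\<integral>\<^sup>+\<omega>. esob s (bbm_nonlinearity (d \<omega>)) \<partial>M) \<le> (\<integral>\<^sup>+\<omega>. zsum (\<lambda>n. ?f n \<omega>) \<partial>M)"
  proof (rule nn_integral_mono)
    fix \<omega>
    show "esob s (bbm_nonlinearity (d \<omega>)) \<le> zsum (\<lambda>n. ?f n \<omega>)"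
      by (rule esob_bbm_le[where f="\<lambda>n. ennreal ((cmod (d \<omega> n))\<^sup>2)"]) (rule order_refl)
  qed
  also have "\<dots> = zsum (\<lambda>n. \<integral>\<^sup>+\<omega>. ?f n \<omega> \<partial>M)"
    by (rule nn_integral_count_space_nn_integral[OF _ m]) simp
  also have "\<dots> \<le> zsum (\<lambda>n. ennreal B * ennreal (jbracket n powr - (2 + \<mu> - 2 * s)))"
  proof (intro nn_integral_mono)
    fix n
    show "(\<integral>\<^sup>+\<omega>. ?f n \<omega> \<partial>M) \<le> ennreal B * ennreal (jbracket n powr - (2 + \<mu> - 2 * s))"
    proof (cases "n = 0")
      case False
      note [measurable] = meas[OF False]
      have "(\<integral>\<^sup>+\<omega>. ?f n \<omega> \<partial>M) = ennreal (jbracket n powr (2 * s - 2)) * mean_square M (\<lambda>\<omega>. d \<omega> n)"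
        using False by (simp add: nn_integral_cmult)
      also have "\<dots> \<le> ennreal (jbracket n powr (2 * s - 2)) * ennreal (B * jbracket n powr - \<mu>)"
        by (intro mult_left_mono le False) simp
      also have "\<dots> = ennreal (B * (jbracket n powr (2 * s - 2) * jbracket n powr - \<mu>))"
        using B by (simp add: ennreal_mult[symmetric] mult.left_commute)
      also have "jbracket n powr (2 * s - 2) * jbracket n powr - \<mu> = jbracket n powr - (2 + \<mu> - 2 * s)"
        by (simp add: powr_add[symmetric] algebra_simps)
      finally show ?thesis using B by (simp add: ennreal_mult)
    qed simp
  qed
  also have "\<dots> = ennreal B * zsum (\<lambda>n. ennreal (jbracket n powr - (2 + \<mu> - 2 * s)))"
    by (rule nn_integral_cmult) simp
  finally show ?thesis .
qed

text \<open>
  Both bounds are first obtained for truncated sums, where the quadratic form is finite, and then pass to the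
  limit by Fatou's lemma. In the second one the truncated squares of the mollified and of the
  original evolution are compared at the same truncation, and the distance of the latter to \<open>q\<close>
  vanishes by the definition of \<open>q\<close>.
\<close>
lemma evolution_square_mean_square:
  fixes g :: "int \<Rightarrow> 'a \<Rightarrow> complex"
  assumes g: "gaussian_family M g"
    and q: "linear_square_version M (random_data \<alpha> g) q"
    and m: "approximates_identity m"
    and smooth: "AE \<omega> in M. \<forall>k\<ge>1. (\<lambda>l. m k l * random_data \<alpha> g \<omega> l) \<in> sobolev (1 / 2)"
    and par: "0 < \<delta>" "\<delta> \<le> 1" "0 \<le> \<mu>" "\<mu> \<le> 2 * (\<alpha> - \<delta>)" "4 * (\<alpha> - \<delta>) - \<mu> > 1"
  defines "X \<equiv> (\<lambda>k \<omega>. evolution_square (\<lambda>l. m k l * random_data \<alpha> g \<omega> l))"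
  shows "\<exists>K\<ge>0. \<forall>k\<ge>1. \<forall>n t. n \<noteq> 0 \<longrightarrow>
    mean_square M (\<lambda>\<omega>. X (Suc k) \<omega> t n - X k \<omega> t n) \<le> ennreal (K * real k powr (- 2 - 2 * \<delta>) * jbracket n powr - \<mu>) \<and>
    mean_square M (\<lambda>\<omega>. X k \<omega> t n - q \<omega> t n) \<le> ennreal (K * real k powr (- 2 * \<delta>) * jbracket n powr - \<mu>)"
proof -
  let ?u = "random_data \<alpha> g"
  let ?TS = "\<lambda>N k \<omega> t n. truncated_square N (bbm_group t (\<lambda>l. m k l * ?u \<omega> l)) n"
  let ?T = "\<lambda>N \<omega> t n. truncated_square N (bbm_group t (?u \<omega>)) n"
  obtain K where K: "K \<ge> 0" "\<And>D w n N t. n \<noteq> 0 \<Longrightarrow> D \<ge> 0 \<Longrightarrow> (\<And>l. cmod (w l) \<le> D * (jbracket l powr \<delta> * jbracket (n - l) powr \<delta>)) \<Longrightarrow>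
    mean_square M (\<lambda>\<omega>. \<Sum>l\<in>trunc_set N n. w l * (bbm_group t (?u \<omega>) l * bbm_group t (?u \<omega>) (n - l)))
      \<le> ennreal (K * D\<^sup>2 * jbracket n powr - \<mu>)"
    using random_form_mean_square[OF g par(3-5)] by meson
  obtain D where D: "D \<ge> 0"
    "\<And>k l j. k \<ge> 1 \<Longrightarrow> cmod (m k l * m k j - 1) \<le> D * real k powr - \<delta> * (jbracket l powr \<delta> * jbracket j powr \<delta>)"
    "\<And>k l j. k \<ge> 1 \<Longrightarrow> cmod (m (Suc k) l * m (Suc k) j - m k l * m k j) \<le> D * real k powr (- 1 - \<delta>) * (jbracket l powr \<delta> * jbracket j powr \<delta>)"
    using approximates_identity_pair[OF m, of \<delta>] par by auto
  have TS_meas [measurable]: "(\<lambda>\<omega>. ?TS N k \<omega> t n) \<in> borel_measurable M" for N k t n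
    using section_measurable(1)[OF joint_truncated_square_measurable[OF g]] .
  have T_meas [measurable]: "(\<lambda>\<omega>. ?T N \<omega> t n) \<in> borel_measurable M" for N t n
    using section_measurable(1)[OF joint_truncated_square_measurable[OF g, of N "\<lambda>_. 1" \<alpha>]] by simp
  have q_meas: "(\<lambda>\<omega>. q \<omega> t n) \<in> borel_measurable M" if "n \<noteq> 0" for t n
    using q that section_measurable(1)[of "\<lambda>\<omega> t. q \<omega> t n" t] unfolding linear_square_version_def by (simp add: case_prod_beta')
  have lim: "AE \<omega> in M. \<forall>k\<ge>1. \<forall>t n. (\<lambda>N. ?TS N k \<omega> t n) \<longlonglongrightarrow> X k \<omega> t n"
    using smooth by eventually_elim (auto simp: X_def intro: evolution_square_limit(2))
  have inc: "mean_square M (\<lambda>\<omega>. X (Suc k) \<omega> t n - X k \<omega> t n) \<le> ennreal (K * (D * real k powr (- 1 - \<delta>))\<^sup>2 * jbracket n powr - \<mu>)"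
    if k: "k \<ge> 1" and n: "n \<noteq> 0" for k n t
  proof (rule fatou_mean_square)
    show "(\<lambda>\<omega>. ?TS N (Suc k) \<omega> t n - ?TS N k \<omega> t n) \<in> borel_measurable M" for N by measurable
    show "AE \<omega> in M. (\<lambda>N. ?TS N (Suc k) \<omega> t n - ?TS N k \<omega> t n) \<longlonglongrightarrow> X (Suc k) \<omega> t n - X k \<omega> t n"
      using lim by eventually_elim (use k in \<open>auto intro!: tendsto_diff\<close>)
    show "mean_square M (\<lambda>\<omega>. ?TS N (Suc k) \<omega> t n - ?TS N k \<omega> t n) \<le> ennreal (K * (D * real k powr (- 1 - \<delta>))\<^sup>2 * jbracket n powr - \<mu>)" for N
      unfolding truncated_square_multiplier sum_subtractf[symmetric] left_diff_distrib[symmetric]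
      by (rule K(2)[OF n]) (use D k in auto)
  qed (rule tendsto_const)
  have app: "mean_square M (\<lambda>\<omega>. X k \<omega> t n - q \<omega> t n) \<le> 2 * ennreal (K * (D * real k powr - \<delta>)\<^sup>2 * jbracket n powr - \<mu>)"
    if k: "k \<ge> 1" and n: "n \<noteq> 0" for k n t
  proof (rule fatou_mean_square)
    note [measurable] = q_meas[OF n]
    let ?B = "ennreal (K * (D * real k powr - \<delta>)\<^sup>2 * jbracket n powr - \<mu>)"
    let ?e = "\<lambda>N. \<integral>\<^sup>+\<omega>. ennreal ((cmod (?T N \<omega> t n - q \<omega> t n))\<^sup>2) \<partial>M"
    show "(\<lambda>\<omega>. ?TS N k \<omega> t n - q \<omega> t n) \<in> borel_measurable M" for N by measurable
    show "AE \<omega> in M. (\<lambda>N. ?TS N k \<omega> t n - q \<omega> t n) \<longlonglongrightarrow> X k \<omega> t n - q \<omega> t n"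
      using lim by eventually_elim (use k in \<open>auto intro!: tendsto_diff\<close>)
    show "mean_square M (\<lambda>\<omega>. ?TS N k \<omega> t n - q \<omega> t n) \<le> 2 * ?B + 2 * ?e N" for N
    proof -
      have pt: "ennreal ((cmod (x - z))\<^sup>2) \<le> 2 * ennreal ((cmod (x - y))\<^sup>2) + 2 * ennreal ((cmod (y - z))\<^sup>2)" for x y z
        using ennreal_cmod_add_squared_le[of "x - y" "y - z"] by simp
      have "mean_square M (\<lambda>\<omega>. ?TS N k \<omega> t n - q \<omega> t n) \<le>
         (\<integral>\<^sup>+\<omega>. 2 * ennreal ((cmod (?TS N k \<omega> t n - ?T N \<omega> t n))\<^sup>2) + 2 * ennreal ((cmod (?T N \<omega> t n - q \<omega> t n))\<^sup>2) \<partial>M)"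
        by (rule nn_integral_mono) (rule pt)
      also have "\<dots> = 2 * mean_square M (\<lambda>\<omega>. ?TS N k \<omega> t n - ?T N \<omega> t n) + 2 * ?e N"
        by (simp add: nn_integral_add nn_integral_cmult)
      also have "mean_square M (\<lambda>\<omega>. ?TS N k \<omega> t n - ?T N \<omega> t n) \<le> ?B"
      proof -
        have "?T N \<omega> t n = (\<Sum>l\<in>trunc_set N n. 1 * (bbm_group t (?u \<omega>) l * bbm_group t (?u \<omega>) (n - l)))" for \<omega>
          by (simp add: truncated_square_eq)
        then show ?thesis
          unfolding truncated_square_multiplier sum_subtractf[symmetric] left_diff_distrib[symmetric]
          by (simp only: truncated_square_multiplier sum_subtractf[symmetric] left_diff_distrib[symmetric])
             (rule K(2)[OF n], use D k in auto)
      qed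
      finally show ?thesis by (simp add: mult_left_mono add_right_mono)
    qed
    have "?e \<longlonglongrightarrow> 0" using q n unfolding linear_square_version_def by blast
    then have "(\<lambda>N. 2 * ?B + 2 * ?e N) \<longlonglongrightarrow> 2 * ?B + 2 * 0"
      by (intro tendsto_add tendsto_const ennreal_tendsto_cmult) auto
    then show "(\<lambda>N. 2 * ?B + 2 * ?e N) \<longlonglongrightarrow> 2 * ?B" by simp
  qed
  show ?thesis
  proof (intro exI[of _ "2 * K * D\<^sup>2"] conjI allI impI)
    show "0 \<le> 2 * K * D\<^sup>2" using K(1) by simp
    fix k n t assume k: "1 \<le> (k::nat)" and n: "n \<noteq> (0::int)"
    have p1: "(real k powr (- 1 - \<delta>))\<^sup>2 = real k powr (- 2 - 2 * \<delta>)" and p2: "(real k powr - \<delta>)\<^sup>2 = real k powr (- 2 * \<delta>)"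
      by (simp_all add: power2_eq_square powr_add[symmetric])
    show "mean_square M (\<lambda>\<omega>. X (Suc k) \<omega> t n - X k \<omega> t n) \<le> ennreal (2 * K * D\<^sup>2 * real k powr (- 2 - 2 * \<delta>) * jbracket n powr - \<mu>)"
    proof (rule order_trans[OF inc[OF k n]], rule ennreal_leI)
      have "0 \<le> K * (D\<^sup>2 * (real k powr (- 2 - 2 * \<delta>) * jbracket n powr - \<mu>))" using K(1) by simp
      then show "K * (D * real k powr (- 1 - \<delta>))\<^sup>2 * jbracket n powr - \<mu> \<le> 2 * K * D\<^sup>2 * real k powr (- 2 - 2 * \<delta>) * jbracket n powr - \<mu>"
        unfolding power_mult_distrib p1 mult.assoc by linarith
    qed
    have "2 * ennreal (K * (D * real k powr - \<delta>)\<^sup>2 * jbracket n powr - \<mu>) = ennreal (2 * K * D\<^sup>2 * real k powr (- 2 * \<delta>) * jbracket n powr - \<mu>)"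
    proof -
      have "2 * ennreal (K * (D * real k powr - \<delta>)\<^sup>2 * jbracket n powr - \<mu>) = ennreal (2 * (K * (D * real k powr - \<delta>)\<^sup>2 * jbracket n powr - \<mu>))"
        using K(1) by (subst ennreal_mult) auto
      then show ?thesis unfolding power_mult_distrib p2 mult.assoc .
    qed
    with app[OF k n] show "mean_square M (\<lambda>\<omega>. X k \<omega> t n - q \<omega> t n) \<le> ennreal (2 * K * D\<^sup>2 * real k powr (- 2 * \<delta>) * jbracket n powr - \<mu>)"
      by simp
  qed
qed

text \<open>
  The integrated distances \<open>I (H k)\<close> to \<open>q\<close> have expectation tending to zero, so their lower limit
  vanishes almost surely by Fatou's lemma. The integrated increments \<open>I (V i)\<close>, weighted by
  \<open>i powr (1 + \<delta>)\<close>, have summable expectations. Telescoping with these weights connects the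
  distances at two indices, and \<open>ennreal_liminf_tail\<close> applies.
\<close>
lemma evolution_squares_converge:
  fixes g :: "int \<Rightarrow> 'a \<Rightarrow> complex"
  assumes g: "gaussian_family M g"
    and q: "linear_square_version M (random_data \<alpha> g) q"
    and m: "approximates_identity m"
    and smooth: "AE \<omega> in M. \<forall>k\<ge>1. (\<lambda>l. m k l * random_data \<alpha> g \<omega> l) \<in> sobolev (1 / 2)"
    and par: "0 < \<delta>" "\<delta> \<le> 1" "0 \<le> \<mu>" "\<mu> \<le> 2 * (\<alpha> - \<delta>)" "4 * (\<alpha> - \<delta>) - \<mu> > 1" and s: "2 + \<mu> - 2 * s > 1"
  defines "X \<equiv> (\<lambda>k \<omega>. evolution_square (\<lambda>l. m k l * random_data \<alpha> g \<omega> l))"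
  shows "AE \<omega> in M. (\<lambda>k. \<integral>\<^sup>+t. esob s (bbm_nonlinearity (\<lambda>n. X k \<omega> t n - q \<omega> t n)) * indicator {0..L} t \<partial>lborel) \<longlonglongrightarrow> 0"
proof -
  let ?V = "\<lambda>k n t. \<integral>\<^sup>+\<omega>. ennreal ((cmod (X (Suc k) \<omega> t n - X k \<omega> t n))\<^sup>2) \<partial>M"
  let ?H = "\<lambda>k n t. \<integral>\<^sup>+\<omega>. ennreal ((cmod (X k \<omega> t n - q \<omega> t n))\<^sup>2) \<partial>M"
  have "\<exists>K\<ge>0. \<forall>k\<ge>1. \<forall>n t. n \<noteq> 0 \<longrightarrow> ?V k n t \<le> ennreal (K * real k powr (- 2 - 2 * \<delta>) * jbracket n powr - \<mu>) \<and>
      ?H k n t \<le> ennreal (K * real k powr (- 2 * \<delta>) * jbracket n powr - \<mu>)"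
    using evolution_square_mean_square[OF g q m smooth par] unfolding X_def .
  then obtain K where K0: "K \<ge> 0" and "\<forall>k\<ge>1. \<forall>n t. n \<noteq> 0 \<longrightarrow> ?V k n t \<le> ennreal (K * real k powr (- 2 - 2 * \<delta>) * jbracket n powr - \<mu>) \<and>
      ?H k n t \<le> ennreal (K * real k powr (- 2 * \<delta>) * jbracket n powr - \<mu>)"
    by (elim exE conjE)
  then have "\<And>k n t. k \<ge> 1 \<Longrightarrow> n \<noteq> 0 \<Longrightarrow> ?V k n t \<le> ennreal (K * real k powr (- 2 - 2 * \<delta>) * jbracket n powr - \<mu>)"
    "\<And>k n t. k \<ge> 1 \<Longrightarrow> n \<noteq> 0 \<Longrightarrow> ?H k n t \<le> ennreal (K * real k powr (- 2 * \<delta>) * jbracket n powr - \<mu>)"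
    by simp_all
  note K = K0 this
  define Z where "Z = zsum (\<lambda>n. ennreal (jbracket n powr - (2 + \<mu> - 2 * s)))"
  have Z: "Z < \<infinity>" unfolding Z_def using s by (rule zsum_jbracket_finite)
  interpret P: pair_sigma_finite M "lborel :: real measure" by unfold_locales

  have jX: "(\<lambda>x. X k (fst x) (snd x) n) \<in> borel_measurable (M \<Otimes>\<^sub>M borel)" for k n
    unfolding X_def by (rule joint_evolution_square_measurable[OF g])
  have jq: "(\<lambda>x. q (fst x) (snd x) n) \<in> borel_measurable (M \<Otimes>\<^sub>M borel)" if "n \<noteq> 0" for n
    using q that unfolding linear_square_version_def by (simp add: case_prod_beta')
  define V where "V = (\<lambda>k \<omega> t. esob s (bbm_nonlinearity (\<lambda>n. X (Suc k) \<omega> t n - X k \<omega> t n)))"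
  define H where "H = (\<lambda>k \<omega> t. esob s (bbm_nonlinearity (\<lambda>n. X k \<omega> t n - q \<omega> t n)))"
  have jV [measurable]: "(\<lambda>x. V k (fst x) (snd x)) \<in> borel_measurable (M \<Otimes>\<^sub>M borel)" for k
    unfolding V_def by (intro esob_measurable bbm_nonlinearity_measurable borel_measurable_diff jX)
  have jH [measurable]: "(\<lambda>x. H k (fst x) (snd x)) \<in> borel_measurable (M \<Otimes>\<^sub>M borel)" for k
    unfolding H_def by (intro esob_measurable bbm_nonlinearity_measurable borel_measurable_diff jX jq)
  have EV: "(\<integral>\<^sup>+\<omega>. V k \<omega> t \<partial>M) \<le> ennreal (K * real k powr (- 2 - 2 * \<delta>)) * Z" if k: "k \<ge> 1" for k t
    unfolding V_def Z_def using K(1)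
    by (intro expectation_esob_bbm K(2) k borel_measurable_diff section_measurable(1)[OF jX]) auto
  have EH: "(\<integral>\<^sup>+\<omega>. H k \<omega> t \<partial>M) \<le> ennreal (K * real k powr (- 2 * \<delta>)) * Z" if k: "k \<ge> 1" for k t
    unfolding H_def Z_def using K(1)
    by (intro expectation_esob_bbm K(3) k borel_measurable_diff section_measurable(1)[OF jX] section_measurable(1)[OF jq]) auto

  define I where "I = (\<lambda>F :: real \<Rightarrow> ennreal. \<integral>\<^sup>+t. F t * indicator {0..L} t \<partial>lborel)"
  have time_integral: "(\<lambda>\<omega>. I (F \<omega>)) \<in> borel_measurable M"
    "(\<And>t. (\<integral>\<^sup>+\<omega>. F \<omega> t \<partial>M) \<le> B) \<Longrightarrow> (\<integral>\<^sup>+\<omega>. I (F \<omega>) \<partial>M) \<le> B * ennreal L"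
    if F: "(\<lambda>x. F (fst x) (snd x)) \<in> borel_measurable (M \<Otimes>\<^sub>M borel)" for F B
  proof -
    have "(\<lambda>x. F (fst x) (snd x) * indicator {0..L} (snd x)) \<in> borel_measurable (M \<Otimes>\<^sub>M borel)"
      using F by measurable
    note jm = measurable_pair_lborel[OF this]
    show "(\<lambda>\<omega>. I (F \<omega>)) \<in> borel_measurable M"
      unfolding I_def using jm by (intro lborel.borel_measurable_nn_integral) (simp add: case_prod_beta')
    assume le: "\<And>t. (\<integral>\<^sup>+\<omega>. F \<omega> t \<partial>M) \<le> B"
    have "(\<integral>\<^sup>+\<omega>. I (F \<omega>) \<partial>M) = (\<integral>\<^sup>+t. \<integral>\<^sup>+\<omega>. F \<omega> t * indicator {0..L} t \<partial>M \<partial>lborel)"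
      unfolding I_def using P.Fubini[OF jm] by simp
    also have "\<dots> = time_integral L (\<lambda>t. (\<integral>\<^sup>+\<omega>. F \<omega> t \<partial>M))"
      by (intro nn_integral_cong nn_integral_multc section_measurable(1)[OF F])
    also have "\<dots> \<le> time_integral L (\<lambda>t. B)"
      by (intro nn_integral_mono mult_right_mono le) simp
    also have "\<dots> \<le> B * ennreal L" by (cases "0 \<le> L") (simp_all add: nn_integral_cmult_indicator)
    finally show "(\<integral>\<^sup>+\<omega>. I (F \<omega>) \<partial>M) \<le> B * ennreal L" .
  qed
  note [measurable] = time_integral(1)[OF jV] time_integral(1)[OF jH]

  define c where "c = (\<lambda>i \<omega>. ennreal (real i powr (1 + \<delta>)) * I (V i \<omega>))"
  have c_sum: "AE \<omega> in M. (\<Sum>i. c i \<omega>) < \<infinity>"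
  proof -
    have Ec: "(\<integral>\<^sup>+\<omega>. c i \<omega> \<partial>M) \<le> ennreal (K * real i powr - (1 + \<delta>)) * (Z * ennreal L)" for i
    proof (cases "i = 0")
      case False
      then have i: "i \<ge> 1" by simp
      have "(\<integral>\<^sup>+\<omega>. c i \<omega> \<partial>M) = ennreal (real i powr (1 + \<delta>)) * (\<integral>\<^sup>+\<omega>. I (V i \<omega>) \<partial>M)"
        unfolding c_def by (rule nn_integral_cmult) measurable
      also have "\<dots> \<le> ennreal (real i powr (1 + \<delta>)) * (ennreal (K * real i powr (- 2 - 2 * \<delta>)) * Z * ennreal L)"
        by (intro mult_left_mono time_integral(2)[OF jV] EV i) simp
      also have "\<dots> = ennreal (real i powr (1 + \<delta>) * (K * real i powr (- 2 - 2 * \<delta>))) * (Z * ennreal L)"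
        using K(1) by (simp add: ennreal_mult mult.assoc)
      also have "real i powr (1 + \<delta>) * (K * real i powr (- 2 - 2 * \<delta>)) = K * real i powr - (1 + \<delta>)"
        by (simp add: mult.left_commute powr_add[symmetric])
      finally show ?thesis .
    qed (simp add: c_def)
    have "(\<integral>\<^sup>+\<omega>. (\<Sum>i. c i \<omega>) \<partial>M) = (\<Sum>i. \<integral>\<^sup>+\<omega>. c i \<omega> \<partial>M)"
      unfolding c_def by (rule nn_integral_suminf) measurable
    also have "\<dots> \<le> (\<Sum>i. ennreal (K * real i powr - (1 + \<delta>)) * (Z * ennreal L))"
      by (intro suminf_le Ec summableI)
    also have "\<dots> = (\<Sum>i. ennreal (K * real i powr - (1 + \<delta>))) * (Z * ennreal L)"
      by (rule ennreal_suminf_multc)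
    also have "\<dots> < \<infinity>"
    proof -
      have sm: "summable (\<lambda>i. K * real i powr - (1 + \<delta>))"
        using par(1) by (intro summable_mult) (simp add: summable_real_powr_iff)
      have "(\<Sum>i. ennreal (K * real i powr - (1 + \<delta>))) = ennreal (\<Sum>i. K * real i powr - (1 + \<delta>))"
        using K(1) by (intro suminf_ennreal2 sm) simp
      then show ?thesis using Z by (simp add: ennreal_mult_less_top)
    qed
    finally have "(\<integral>\<^sup>+\<omega>. (\<Sum>i. c i \<omega>) \<partial>M) \<noteq> \<infinity>" by simp
    then have "AE \<omega> in M. (\<Sum>i. c i \<omega>) \<noteq> \<infinity>"
      by (intro nn_integral_PInf_AE) (auto simp: c_def)
    then show ?thesis by eventually_elim (simp add: less_top)
  qed

  have liminf: "AE \<omega> in M. liminf (\<lambda>l. 2 * I (H l \<omega>)) = 0"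
  proof -
    have "(\<integral>\<^sup>+\<omega>. liminf (\<lambda>l. 2 * I (H l \<omega>)) \<partial>M) \<le> liminf (\<lambda>l. \<integral>\<^sup>+\<omega>. 2 * I (H l \<omega>) \<partial>M)"
      by (rule nn_integral_liminf) measurable
    also have "\<dots> \<le> liminf (\<lambda>l. 2 * (ennreal (K * real l powr (- 2 * \<delta>)) * Z * ennreal L))"
    proof (intro Liminf_mono eventually_sequentiallyI[of 1])
      fix l :: nat assume "1 \<le> l"
      then show "(\<integral>\<^sup>+\<omega>. 2 * I (H l \<omega>) \<partial>M) \<le> 2 * (ennreal (K * real l powr (- 2 * \<delta>)) * Z * ennreal L)"
        by (subst nn_integral_cmult, measurable) (intro mult_left_mono time_integral(2)[OF jH] EH, simp_all)
    qed
    also have "\<dots> = 0"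
    proof -
      have "((\<lambda>l. real l powr (- 2 * \<delta>)) \<longlongrightarrow> 0) sequentially"
        using par(1) by (intro tendsto_neg_powr filterlim_real_sequentially) simp
      then have "((\<lambda>l. ennreal (K * real l powr (- 2 * \<delta>))) \<longlongrightarrow> ennreal (K * 0)) sequentially"
        by (intro tendsto_ennrealI tendsto_mult tendsto_const)
      then have "((\<lambda>l. (2 * Z * ennreal L) * ennreal (K * real l powr (- 2 * \<delta>))) \<longlongrightarrow> (2 * Z * ennreal L) * 0) sequentially"
        using Z by (intro ennreal_tendsto_cmult) (simp_all add: ennreal_mult_less_top)
      then have "((\<lambda>l. 2 * (ennreal (K * real l powr (- 2 * \<delta>)) * Z * ennreal L)) \<longlongrightarrow> 0) sequentially"
        by (simp add: ac_simps)
      from lim_imp_Liminf[OF trivial_limit_sequentially this] show ?thesis .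
    qed
    finally have "(\<integral>\<^sup>+\<omega>. liminf (\<lambda>l. 2 * I (H l \<omega>)) \<partial>M) = 0" by simp
    then show ?thesis by (subst (asm) nn_integral_0_iff_AE) measurable
  qed

  obtain W where W: "W \<ge> 0" "\<And>k l. (\<Sum>i\<in>{k..<l}. 1 / real i powr (1 + \<delta>)) \<le> W"
    using sum_powr_bounded[OF par(1)] by blast
  have split: "H k \<omega> t \<le> 2 * H l \<omega> t + ennreal (2 * W) * (\<Sum>i\<in>{k..<l}. ennreal (real i powr (1 + \<delta>)) * V i \<omega> t)"
    if kl: "1 \<le> k" "k \<le> l" for k l \<omega> t
  proof -
    let ?d = "\<lambda>k n. X k \<omega> t n - q \<omega> t n"
    have tel: "(\<lambda>n. X l \<omega> t n - X k \<omega> t n) = (\<lambda>n. \<Sum>i\<in>{k..<l}. X (Suc i) \<omega> t n - X i \<omega> t n)"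
      by (rule ext) (rule sum_Suc_diff'[OF kl(2), of "\<lambda>i. X i \<omega> t _", symmetric])
    have "H k \<omega> t = esob s (\<lambda>n. bbm_nonlinearity (?d l) n - bbm_nonlinearity (\<lambda>n. X l \<omega> t n - X k \<omega> t n) n)"
      unfolding H_def bbm_nonlinearity_diff[symmetric] by simp
    also have "\<dots> \<le> 2 * H l \<omega> t + 2 * esob s (bbm_nonlinearity (\<lambda>n. X l \<omega> t n - X k \<omega> t n))"
      unfolding H_def by (rule esob_diff)
    also have "esob s (bbm_nonlinearity (\<lambda>n. X l \<omega> t n - X k \<omega> t n)) \<le> ennreal W * (\<Sum>i\<in>{k..<l}. ennreal (real i powr (1 + \<delta>)) * V i \<omega> t)"
      unfolding tel bbm_nonlinearity_sum V_def by (intro esob_sum_weighted W(2)) (use kl in auto)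
    finally show ?thesis using W(1) by (simp add: ennreal_mult mult.assoc mult_left_mono add_left_mono)
  qed
  have le: "I (H k \<omega>) \<le> 2 * I (H l \<omega>) + ennreal (2 * W) * (\<Sum>i\<in>{k..<l}. c i \<omega>)"
    if \<omega>: "\<omega> \<in> space M" and kl: "1 \<le> k" "k \<le> l" for k l \<omega>
  proof -
    note [measurable] = section_measurable(2)[OF jV \<omega>] section_measurable(2)[OF jH \<omega>]
    have "I (H k \<omega>) \<le> (\<integral>\<^sup>+t. 2 * (H l \<omega> t * indicator {0..L} t) + ennreal (2 * W) * (\<Sum>i\<in>{k..<l}. ennreal (real i powr (1 + \<delta>)) * (V i \<omega> t * indicator {0..L} t)) \<partial>lborel)"
      unfolding I_def
    proof (rule nn_integral_mono)
      fix t
      show "H k \<omega> t * indicator {0..L} t \<le> 2 * (H l \<omega> t * indicator {0..L} t) + ennreal (2 * W) * (\<Sum>i\<in>{k..<l}. ennreal (real i powr (1 + \<delta>)) * (V i \<omega> t * indicator {0..L} t))"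
        using split[OF kl, of \<omega> t] by (cases "t \<in> {0..L}") simp_all
    qed
    also have "\<dots> = 2 * I (H l \<omega>) + ennreal (2 * W) * (\<Sum>i\<in>{k..<l}. c i \<omega>)"
      unfolding I_def c_def by (simp add: nn_integral_add nn_integral_cmult nn_integral_sum)
    finally show ?thesis .
  qed
  have "AE \<omega> in M. (\<lambda>k. I (H k \<omega>)) \<longlonglongrightarrow> 0"
    using c_sum liminf AE_space
  proof eventually_elim
    case (elim \<omega>)
    show ?case
      by (rule ennreal_liminf_tail[where c="\<lambda>i. c i \<omega>" and Z="ennreal (2 * W)"])
         (use elim le in auto)
  qed
  then show ?thesis unfolding I_def H_def .
qed

end

section \<open>Curves in Sobolev spaces\<close>

lemma cont_sobolevD:
  assumes "w \<in> cont_sobolev T r" "t \<in> {0..T}"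
  shows "w t \<in> sobolev r" "((\<lambda>t'. sobolev_norm r (\<lambda>n. w t' n - w t n)) \<longlongrightarrow> 0) (at t within {0..T})"
  using assms unfolding cont_sobolev_def by auto

lemma cont_sobolev_add:
  assumes "a \<in> cont_sobolev T r" "b \<in> cont_sobolev T r"
  shows "(\<lambda>t n. a t n + b t n) \<in> cont_sobolev T r"
  unfolding cont_sobolev_def
proof (intro CollectI ballI conjI)
  fix t assume t: "t \<in> {0..T}"
  show "(\<lambda>n. a t n + b t n) \<in> sobolev r" using cont_sobolevD(1) assms t by (intro sobolev_add) auto
  have lim: "((\<lambda>t'. sobolev_norm r (\<lambda>n. a t' n - a t n) + sobolev_norm r (\<lambda>n. b t' n - b t n)) \<longlongrightarrow> 0) (at t within {0..T})"
    using tendsto_add[OF cont_sobolevD(2)[OF assms(1) t] cont_sobolevD(2)[OF assms(2) t]] by simp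
  show "((\<lambda>t'. sobolev_norm r (\<lambda>n. a t' n + b t' n - (a t n + b t n))) \<longlongrightarrow> 0) (at t within {0..T})"
  proof (rule tendsto_sandwich[OF _ _ tendsto_const lim])
    show "\<forall>\<^sub>F t' in at t within {0..T}. sobolev_norm r (\<lambda>n. a t' n + b t' n - (a t n + b t n))
        \<le> sobolev_norm r (\<lambda>n. a t' n - a t n) + sobolev_norm r (\<lambda>n. b t' n - b t n)"
      unfolding eventually_at_filter
    proof (intro always_eventually allI impI)
      fix t' assume t': "t' \<in> {0..T}"
      have "(\<lambda>n. a t' n + b t' n - (a t n + b t n)) = (\<lambda>n. (a t' n - a t n) + (b t' n - b t n))" by auto
      then show "sobolev_norm r (\<lambda>n. a t' n + b t' n - (a t n + b t n))
        \<le> sobolev_norm r (\<lambda>n. a t' n - a t n) + sobolev_norm r (\<lambda>n. b t' n - b t n)"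
        using assms t t' cont_sobolevD(1) by (simp only:) (intro sobolev_norm_triangle sobolev_diff; blast)
    qed
  qed (simp add: sobolev_norm_nonneg)
qed

lemma cont_sobolev_uminus:
  assumes "a \<in> cont_sobolev T r" shows "(\<lambda>t n. - a t n) \<in> cont_sobolev T r"
proof -
  have "sobolev_norm r (\<lambda>n. - a t' n - - a t n) = sobolev_norm r (\<lambda>n. a t' n - a t n)" for t t'
    using sobolev_norm_minus_commute[of r "a t'" "a t"] by (simp add: algebra_simps)
  then show ?thesis using assms unfolding cont_sobolev_def by (auto intro: sobolev_uminus)
qed

lemma cont_sobolev_diff:
  assumes "a \<in> cont_sobolev T r" "b \<in> cont_sobolev T r"
  shows "(\<lambda>t n. a t n - b t n) \<in> cont_sobolev T r"
  using cont_sobolev_add[OF assms(1) cont_sobolev_uminus[OF assms(2)]] by simp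

lemma cont_sobolev_mono:
  assumes "r \<le> r'" "a \<in> cont_sobolev T r'" shows "a \<in> cont_sobolev T r"
  unfolding cont_sobolev_def
proof (intro CollectI ballI conjI)
  fix t assume t: "t \<in> {0..T}"
  show "a t \<in> sobolev r" using sobolev_mono[OF assms(1)] cont_sobolevD(1)[OF assms(2) t] by blast
  show "((\<lambda>t'. sobolev_norm r (\<lambda>n. a t' n - a t n)) \<longlongrightarrow> 0) (at t within {0..T})"
  proof (rule tendsto_sandwich[OF _ _ tendsto_const cont_sobolevD(2)[OF assms(2) t]])
    show "\<forall>\<^sub>F t' in at t within {0..T}. sobolev_norm r (\<lambda>n. a t' n - a t n) \<le> sobolev_norm r' (\<lambda>n. a t' n - a t n)"
      unfolding eventually_at_filter
      using assms t cont_sobolevD(1) by (intro always_eventually allI impI sobolev_norm_mono sobolev_diff) blast+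
  qed (simp add: sobolev_norm_nonneg)
qed

lemma cont_sobolev_cong:
  assumes "a \<in> cont_sobolev T r" "\<And>t. t \<in> {0..T} \<Longrightarrow> b t = a t" shows "b \<in> cont_sobolev T r"
  unfolding cont_sobolev_def
proof (intro CollectI ballI conjI)
  fix t assume t: "t \<in> {0..T}"
  show "b t \<in> sobolev r" using assms t cont_sobolevD(1) by simp
  have "\<forall>\<^sub>F t' in at t within {0..T}. sobolev_norm r (\<lambda>n. a t' n - a t n) = sobolev_norm r (\<lambda>n. b t' n - b t n)"
    unfolding eventually_at_filter using assms(2) t by (intro always_eventually) auto
  from Lim_transform_eventually[OF cont_sobolevD(2)[OF assms(1) t] this]
  show "((\<lambda>t'. sobolev_norm r (\<lambda>n. b t' n - b t n)) \<longlongrightarrow> 0) (at t within {0..T})" .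
qed

text \<open>
  The symbol of the linear equation is bounded, so its group is Lipschitz in time on every Sobolev
  space, without loss of derivatives.
\<close>
lemma bbm_group_Lipschitz:
  "cmod (bbm_group t' c n - bbm_group t c n) \<le> \<bar>t' - t\<bar> * cmod (c n)"
proof -
  have "cmod (bbm_group t' c n - bbm_group t c n) = cmod (osc (t' * bbm_symbol n) - osc (t * bbm_symbol n)) * cmod (c n)"
    unfolding bbm_group_def norm_mult[symmetric] by (simp only: left_diff_distrib)
  also have "\<dots> \<le> \<bar>t' * bbm_symbol n - t * bbm_symbol n\<bar> * cmod (c n)"
    by (intro mult_right_mono norm_exp_i_diff_le) simp
  also have "\<bar>t' * bbm_symbol n - t * bbm_symbol n\<bar> = \<bar>t' - t\<bar> * \<bar>bbm_symbol n\<bar>"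
    by (simp only: left_diff_distrib[symmetric] abs_mult)
  also have "\<dots> \<le> \<bar>t' - t\<bar> * 1" by (intro mult_left_mono abs_bbm_symbol_le_1) simp
  finally show ?thesis by (simp add: mult_right_mono)
qed

lemma cont_sobolev_bbm_group:
  assumes c: "c \<in> sobolev r" shows "(\<lambda>t. bbm_group t c) \<in> cont_sobolev T r"
  unfolding cont_sobolev_def
proof (intro CollectI ballI conjI)
  fix t assume t: "t \<in> {0..T}"
  show "bbm_group t c \<in> sobolev r" using c by simp
  have le: "sobolev_norm r (\<lambda>n. bbm_group t' c n - bbm_group t c n) \<le> \<bar>t' - t\<bar> * sobolev_norm r c" for t'
  proof (rule sobolev_norm_le(2))
    show "esob r (\<lambda>n. bbm_group t' c n - bbm_group t c n) \<le> ennreal ((\<bar>t' - t\<bar> * sobolev_norm r c)\<^sup>2)"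
      using esob_le_mult[of "\<lambda>n. bbm_group t' c n - bbm_group t c n" "\<bar>t' - t\<bar>" c r, OF bbm_group_Lipschitz]
      by (simp add: esob_eq_sobolev_norm[OF c] power_mult_distrib ennreal_mult)
  qed (simp add: sobolev_norm_nonneg)
  have "((\<lambda>t'. \<bar>t' - t\<bar> * sobolev_norm r c) \<longlongrightarrow> \<bar>t - t\<bar> * sobolev_norm r c) (at t within {0..T})"
    by (intro tendsto_intros)
  then have lim: "((\<lambda>t'. \<bar>t' - t\<bar> * sobolev_norm r c) \<longlongrightarrow> 0) (at t within {0..T})" by simp
  show "((\<lambda>t'. sobolev_norm r (\<lambda>n. bbm_group t' c n - bbm_group t c n)) \<longlongrightarrow> 0) (at t within {0..T})"
    by (rule tendsto_sandwich[OF _ _ tendsto_const lim]) (simp_all add: le sobolev_norm_nonneg)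
qed

lemma cont_sobolev_norm_continuous:
  assumes "w \<in> cont_sobolev T r" shows "continuous_on {0..T} (\<lambda>t. sobolev_norm r (w t))"
  unfolding continuous_on_def
proof
  fix t assume t: "t \<in> {0..T}"
  show "((\<lambda>t'. sobolev_norm r (w t')) \<longlongrightarrow> sobolev_norm r (w t)) (at t within {0..T})"
    unfolding tendsto_iff
  proof (intro allI impI)
    fix e :: real assume "e > 0"
    have tri: "dist (sobolev_norm r a) (sobolev_norm r b) \<le> sobolev_norm r (\<lambda>n. a n - b n)" if "a \<in> sobolev r" "b \<in> sobolev r" for a b
    proof -
      have "sobolev_norm r a \<le> sobolev_norm r (\<lambda>n. a n - b n) + sobolev_norm r b"
        using sobolev_norm_triangle[OF sobolev_diff[OF that] that(2)] by simp
      moreover have "sobolev_norm r b \<le> sobolev_norm r (\<lambda>n. a n - b n) + sobolev_norm r a"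
        using sobolev_norm_triangle[OF sobolev_diff[OF that(2,1)] that(1)] sobolev_norm_minus_commute[of r a b] by simp
      ultimately show ?thesis by (simp add: dist_real_def)
    qed
    have "\<forall>\<^sub>F t' in at t within {0..T}. dist (sobolev_norm r (\<lambda>n. w t' n - w t n)) 0 < e"
      using cont_sobolevD(2)[OF assms t] \<open>e > 0\<close> unfolding tendsto_iff by blast
    moreover have "\<forall>\<^sub>F t' in at t within {0..T}. t' \<in> {0..T}" unfolding eventually_at_filter by simp
    ultimately show "\<forall>\<^sub>F t' in at t within {0..T}. dist (sobolev_norm r (w t')) (sobolev_norm r (w t)) < e"
    proof eventually_elim
      case (elim t')
      have "dist (sobolev_norm r (w t')) (sobolev_norm r (w t)) \<le> sobolev_norm r (\<lambda>n. w t' n - w t n)"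
        using elim t cont_sobolevD(1)[OF assms] by (intro tri) auto
      with elim show ?case by simp
    qed
  qed
qed

lemma cont_sobolev_bounded:
  assumes "w \<in> cont_sobolev T r" shows "\<exists>B\<ge>0. \<forall>t\<in>{0..T}. sobolev_norm r (w t) \<le> B"
proof -
  have "compact ((\<lambda>t. sobolev_norm r (w t)) ` {0..T})"
    by (intro compact_continuous_image cont_sobolev_norm_continuous assms) simp
  then obtain B where "B > 0" "\<forall>x\<in>(\<lambda>t. sobolev_norm r (w t)) ` {0..T}. norm x \<le> B"
    using compact_imp_bounded bounded_pos by blast
  then show ?thesis by (intro exI[of _ B]) auto
qed

lemma sobolev_norm_le_cont:
  assumes "w \<in> cont_sobolev T r" "t \<in> {0..T}" shows "sobolev_norm r (w t) \<le> cont_sobolev_norm T r w"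
proof -
  obtain B where "\<forall>t\<in>{0..T}. sobolev_norm r (w t) \<le> B" using cont_sobolev_bounded[OF assms(1)] by blast
  then show ?thesis unfolding cont_sobolev_norm_def
    using assms(2) by (intro cSUP_upper bdd_aboveI2[where M=B]) auto
qed

lemma cont_sobolev_norm_le:
  assumes "0 \<le> T" "\<And>t. t \<in> {0..T} \<Longrightarrow> sobolev_norm r (w t) \<le> B"
  shows "cont_sobolev_norm T r w \<le> B"
  unfolding cont_sobolev_norm_def using assms by (intro cSUP_least) auto

lemma cont_sobolev_limit_unique:
  assumes T: "0 \<le> T" and w: "cont_sobolev_converges T r X w" and w': "cont_sobolev_converges T r X w'" and t: "t \<in> {0..T}"
  shows "w t = w' t"
proof -
  have c: "w \<in> cont_sobolev T r" "w' \<in> cont_sobolev T r" using w w' by (auto simp: cont_sobolev_converges_def)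
  have "(\<lambda>k. cont_sobolev_norm T r (\<lambda>t n. X k t n - w t n) + cont_sobolev_norm T r (\<lambda>t n. X k t n - w' t n)) \<longlonglongrightarrow> 0 + 0"
    using w w' unfolding cont_sobolev_converges_def by (intro tendsto_add) auto
  moreover have "\<forall>\<^sub>F k in sequentially. sobolev_norm r (\<lambda>n. w t n - w' t n) \<le>
      cont_sobolev_norm T r (\<lambda>t n. X k t n - w t n) + cont_sobolev_norm T r (\<lambda>t n. X k t n - w' t n)"
  proof -
    have "\<forall>\<^sub>F k in sequentially. X k \<in> cont_sobolev T r" using w by (simp add: cont_sobolev_converges_def)
    then show ?thesis
    proof eventually_elim
      case (elim k)
      have "sobolev_norm r (\<lambda>n. w t n - w' t n) \<le> sobolev_norm r (\<lambda>n. w t n - X k t n) + sobolev_norm r (\<lambda>n. X k t n - w' t n)"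
        using c elim t cont_sobolevD(1) by (intro sobolev_norm_triangle_diff) auto
      also have "sobolev_norm r (\<lambda>n. w t n - X k t n) = sobolev_norm r (\<lambda>n. X k t n - w t n)"
        by (rule sobolev_norm_minus_commute)
      also have "\<dots> \<le> cont_sobolev_norm T r (\<lambda>t n. X k t n - w t n)"
        by (rule sobolev_norm_le_cont[OF cont_sobolev_diff[OF elim c(1)] t])
      also have "sobolev_norm r (\<lambda>n. X k t n - w' t n) \<le> cont_sobolev_norm T r (\<lambda>t n. X k t n - w' t n)"
        by (rule sobolev_norm_le_cont[OF cont_sobolev_diff[OF elim c(2)] t])
      finally show ?case by simp
    qed
  qed
  ultimately have "sobolev_norm r (\<lambda>n. w t n - w' t n) \<le> 0 + 0"
    by (intro tendsto_lowerbound) auto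
  then have "sobolev_norm r (\<lambda>n. w t n - w' t n) = 0" using sobolev_norm_nonneg[of r "\<lambda>n. w t n - w' t n"] by simp
  moreover have "(\<lambda>n. w t n - w' t n) \<in> sobolev r" using c t cont_sobolevD(1) by (intro sobolev_diff) auto
  ultimately show ?thesis using sobolev_norm_eq_0 by (fastforce simp: fun_eq_iff)
qed

section \<open>A Gronwall inequality with continuation\<close>

text \<open>
  At a maximum point of \<open>exp (- 2 * b * t) * y t\<close> the integral inequality bounds this maximum by
  \<open>\<delta>\<close> plus half of itself.
\<close>
lemma gronwall:
  fixes y :: "real \<Rightarrow> real"
  assumes cont: "continuous_on {0..t0} y" and nonneg: "\<And>t. t \<in> {0..t0} \<Longrightarrow> 0 \<le> y t" and "0 \<le> \<delta>" "0 < b" "0 \<le> t0"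
    and le: "\<And>t. t \<in> {0..t0} \<Longrightarrow> ennreal (y t) \<le> ennreal \<delta> + ennreal b * time_integral t (\<lambda>\<tau>. ennreal (y \<tau>))"
  shows "y t0 \<le> 2 * \<delta> * exp (2 * b * t0)"
proof -
  have "continuous_on {0..t0} (\<lambda>t. exp (- (2 * b * t)) * y t)" by (intro continuous_intros cont)
  moreover have "{0..t0} \<noteq> {}" using \<open>0 \<le> t0\<close> by simp
  ultimately obtain t1 where t1: "t1 \<in> {0..t0}" "\<And>t. t \<in> {0..t0} \<Longrightarrow> exp (- (2 * b * t)) * y t \<le> exp (- (2 * b * t1)) * y t1"
    using continuous_attains_sup[OF compact_Icc] by blast
  define Y where "Y = exp (- (2 * b * t1)) * y t1"
  have Y0: "0 \<le> Y" unfolding Y_def using nonneg t1(1) by simp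
  have yY: "y t \<le> Y * exp (2 * b * t)" if "t \<in> {0..t0}" for t
  proof -
    have "y t = exp (2 * b * t) * (exp (- (2 * b * t)) * y t)"
      by (simp add: exp_minus)
    also have "\<dots> \<le> exp (2 * b * t) * Y"
      unfolding Y_def using t1(2)[OF that] by (intro mult_left_mono) auto
    finally show ?thesis by (simp only: mult.commute)
  qed
  have F0: "0 \<le> Y * exp (2 * b * t1) / (2 * b) - Y * exp (2 * b * 0) / (2 * b)"
    using Y0 \<open>0 < b\<close> t1(1) by (simp add: diff_divide_distrib[symmetric]) (simp add: mult_le_cancel_left1)
  have "ennreal (y t1) \<le> ennreal \<delta> + ennreal b * time_integral t1 (\<lambda>\<tau>. ennreal (y \<tau>))"
    by (rule le[OF t1(1)])
  also have "time_integral t1 (\<lambda>\<tau>. ennreal (y \<tau>)) \<le> time_integral t1 (\<lambda>\<tau>. ennreal (Y * exp (2 * b * \<tau>)))"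
    using t1(1) yY by (intro nn_integral_mono) (auto simp: indicator_def intro!: ennreal_leI)
  also have "\<dots> = ennreal (Y * exp (2 * b * t1) / (2 * b) - Y * exp (2 * b * 0) / (2 * b))"
    using t1(1) \<open>0 < b\<close> Y0
    by (intro nn_integral_FTC_Icc) (auto intro!: derivative_eq_intros)
  also have "ennreal \<delta> + ennreal b * \<dots> = ennreal (\<delta> + b * (Y * exp (2 * b * t1) / (2 * b) - Y * exp (2 * b * 0) / (2 * b)))"
    using F0 \<open>0 \<le> \<delta>\<close> \<open>0 < b\<close> by (simp add: ennreal_mult ennreal_plus del: exp_zero)
  finally have "ennreal (y t1) \<le> ennreal (\<delta> + b * (Y * exp (2 * b * t1) / (2 * b) - Y * exp (2 * b * 0) / (2 * b)))"
    by this (intro add_left_mono mult_left_mono, simp_all)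
  then have "y t1 \<le> \<delta> + b * (Y * exp (2 * b * t1) / (2 * b) - Y * exp (2 * b * 0) / (2 * b))"
    using F0 \<open>0 \<le> \<delta>\<close> \<open>0 < b\<close> by (subst (asm) ennreal_le_iff) auto
  also have "\<dots> = \<delta> + Y * exp (2 * b * t1) / 2 - Y / 2" using \<open>0 < b\<close> by (simp add: field_simps)
  also have "\<dots> \<le> \<delta> + Y * exp (2 * b * t1) / 2" using Y0 by simp
  also have "Y * exp (2 * b * t1) = y t1" by (simp add: Y_def exp_minus)
  finally have "y t1 \<le> 2 * \<delta>" by simp
  moreover have "exp (- (2 * b * t1)) \<le> 1" using t1(1) \<open>0 < b\<close> by simp
  ultimately have "Y \<le> 1 * (2 * \<delta>)"
    unfolding Y_def using nonneg[OF t1(1)] by (intro mult_mono) auto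
  then have "Y * exp (2 * b * t0) \<le> 2 * \<delta> * exp (2 * b * t0)" by (intro mult_right_mono) auto
  with yY[of t0] \<open>0 \<le> t0\<close> show ?thesis by (auto elim: order_trans)
qed

text \<open>
  The integral inequality is only required as long as \<open>y\<close> has not exceeded \<open>1\<close>; smallness of the
  source excludes a first time at which \<open>y = 1\<close>.
\<close>
lemma gronwall_continuation:
  fixes y :: "real \<Rightarrow> real"
  assumes cont: "continuous_on {0..T} y" and nonneg: "\<And>t. t \<in> {0..T} \<Longrightarrow> 0 \<le> y t" and y0: "y 0 < 1" and "0 \<le> \<delta>" "0 < b"
    and small: "2 * \<delta> * exp (2 * b * T) < 1"
    and le: "\<And>t. t \<in> {0..T} \<Longrightarrow> (\<And>\<tau>. \<tau> \<in> {0..t} \<Longrightarrow> y \<tau> \<le> 1) \<Longrightarrow>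
       ennreal (y t) \<le> ennreal \<delta> + ennreal b * time_integral t (\<lambda>\<tau>. ennreal (y \<tau>))"
    and t: "t \<in> {0..T}"
  shows "y t \<le> 2 * \<delta> * exp (2 * b * T)"
proof -
  have A: "y t0 \<le> 2 * \<delta> * exp (2 * b * T)" if t0: "t0 \<in> {0..T}" and le1: "\<And>\<tau>. \<tau> \<in> {0..t0} \<Longrightarrow> y \<tau> \<le> 1" for t0
  proof -
    have "y t0 \<le> 2 * \<delta> * exp (2 * b * t0)"
      using t0 le1 assms(4,5) by (intro gronwall continuous_on_subset[OF cont] nonneg le) auto
    also have "\<dots> \<le> 2 * \<delta> * exp (2 * b * T)"
      using t0 \<open>0 \<le> \<delta>\<close> \<open>0 < b\<close> by (intro mult_left_mono) auto
    finally show ?thesis .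
  qed
  have "y \<tau> \<le> 1" if \<tau>: "\<tau> \<in> {0..T}" for \<tau>
  proof (rule ccontr)
    assume "\<not> y \<tau> \<le> 1"
    have hit: "\<exists>t'\<in>{0..\<tau>}. y t' = 1" if "\<tau> \<in> {0..T}" "1 \<le> y \<tau>" for \<tau>
      using IVT'[of y 0 1 \<tau>] y0 that continuous_on_subset[OF cont, of "{0..\<tau>}"] by auto
    define S where "S = {t \<in> {0..T}. y t = 1}"
    have "S = {0..T} \<inter> y -` {1}" by (auto simp: S_def)
    then have "closed S" using continuous_closed_preimage[OF cont, of "{1}"] by simp
    from compact_Int_closed[OF compact_Icc this, of 0 T] have "compact S"
      by (simp add: S_def Int_def conj_ac)
    moreover have "S \<noteq> {}" using hit[OF \<tau>] \<open>\<not> y \<tau> \<le> 1\<close> \<tau> unfolding S_def by force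
    ultimately obtain t0 where t0: "t0 \<in> S" "\<And>t. t \<in> S \<Longrightarrow> t0 \<le> t"
      using compact_attains_inf[of S] by auto
    have "y t' \<le> 1" if t': "t' \<in> {0..t0}" for t'
    proof (rule ccontr)
      assume gt: "\<not> y t' \<le> 1"
      then obtain t'' where t'': "t'' \<in> {0..t'}" "y t'' = 1" using hit[of t'] t' t0(1) by (auto simp: S_def)
      then have "t'' \<in> S" using t' t0(1) by (auto simp: S_def)
      then have "t' = t0" using t0(2)[of t''] t'' t' by auto
      then show False using gt t0(1) by (simp add: S_def)
    qed
    then have "y t0 \<le> 2 * \<delta> * exp (2 * b * T)" using t0(1) by (intro A) (auto simp: S_def)
    then show False using small t0(1) by (simp add: S_def)
  qed
  then show ?thesis using t by (intro A) auto
qed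

section \<open>The difference of two solutions\<close>

lemma evolution_square_time_measurable [measurable]:
  "(\<lambda>t. evolution_square c t n) \<in> borel_measurable borel"
proof -
  have "continuous_on UNIV (\<lambda>t. truncated_square N (bbm_group t c) n)" for N
    unfolding truncated_square_eq bbm_group_def by (intro continuous_intros)
  then have [measurable]: "(\<lambda>t. truncated_square N (bbm_group t c) n) \<in> borel_measurable borel" for N
    by (rule borel_measurable_continuous_onI)
  show ?thesis unfolding evolution_square_def by measurable
qed

text \<open>
  The algebra behind the equation for the difference: apart from the square of \<open>z'\<close> minus \<open>q\<close>, every
  term carries a factor \<open>w\<close> or \<open>z' - z\<close>. Absolute convergence of all products involved justifies
  the expansion.
\<close>
lemma coeff_mult_difference:
  assumes par: "0 \<le> \<sigma>" "\<sigma> \<le> s" "\<sigma> \<le> 1 - s" "\<sigma> < 1 / 2"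
    and z: "z \<in> sobolev (- \<sigma>)" and z': "z' \<in> sobolev s" and v: "v \<in> sobolev s" and w: "w \<in> sobolev s"
  shows "coeff_mult (\<lambda>m. z' m + (v m + w m)) (\<lambda>m. z' m + (v m + w m)) n
      - (coeff_mult v v n + 2 * coeff_mult z v n + q)
    = coeff_mult (\<lambda>m. (v m + v m) + (w m + (z' m + z' m))) w n + 2 * coeff_mult (\<lambda>m. z' m - z m) v n
      + (coeff_mult z' z' n - q)"
proof -
  have low: "x \<in> sobolev (- \<sigma>)" if "x \<in> sobolev s" for x
    using sobolev_mono[of "- \<sigma>" s x] par that by simp
  have add: "coeff_mult (\<lambda>m. a m + a' m) b n = coeff_mult a b n + coeff_mult a' b n"
    if "a \<in> sobolev (- \<sigma>)" "a' \<in> sobolev (- \<sigma>)" "b \<in> sobolev s" for a a' b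
    using that par by (intro coeff_mult_add_left product_summable[of \<sigma> s]) auto
  have neg: "coeff_mult (\<lambda>m. z' m - z m) v n = coeff_mult z' v n - coeff_mult z v n"
    using add[of "z'" "\<lambda>m. - z m" v] coeff_mult_scale_left[of "-1" z v n] low z z' v by (simp add: sobolev_uminus)
  have addr: "coeff_mult b (\<lambda>m. a m + a' m) n = coeff_mult b a n + coeff_mult b a' n"
    if "a \<in> sobolev s" "a' \<in> sobolev s" "b \<in> sobolev s" for a a' b
    using add[of a a' b] that low by (simp add: coeff_mult_commute[of b])
  have vw: "(\<lambda>m. v m + w m) \<in> sobolev s" "(\<lambda>m. z' m + z' m) \<in> sobolev s" "(\<lambda>m. v m + v m) \<in> sobolev s"
    by (rule sobolev_add, fact, fact)+
  then have zvw: "(\<lambda>m. z' m + (v m + w m)) \<in> sobolev s" "(\<lambda>m. w m + (z' m + z' m)) \<in> sobolev s"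
    using w z' by (auto intro: sobolev_add)
  have 1: "coeff_mult (\<lambda>m. z' m + (v m + w m)) (\<lambda>m. z' m + (v m + w m)) n =
     coeff_mult z' z' n + (coeff_mult z' v n + coeff_mult z' w n) + ((coeff_mult v z' n + coeff_mult w z' n)
      + ((coeff_mult v v n + coeff_mult w v n) + (coeff_mult v w n + coeff_mult w w n)))"
    using low z' v w vw zvw by (simp add: add addr)
  have 2: "coeff_mult (\<lambda>m. (v m + v m) + (w m + (z' m + z' m))) w n =
     (coeff_mult v w n + coeff_mult v w n) + (coeff_mult w w n + (coeff_mult z' w n + coeff_mult z' w n))"
    using low z' v w vw zvw by (simp add: add coeff_mult_scale_left)
  show ?thesis
    unfolding 1 2 neg using coeff_mult_commute[of v z'] coeff_mult_commute[of w z'] coeff_mult_commute[of w v]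
    by simp
qed

text \<open>
  The bilinear estimate, with the rough factor in \<open>H^(-\<sigma>)\<close> and the smooth factor \<open>w\<close> or \<open>v\<close> in
  \<open>H^s\<close>. The assumed bound on \<open>w\<close> makes the quadratic term linear.
\<close>
lemma esob_bbm_difference:
  assumes par: "0 \<le> \<sigma>" "\<sigma> \<le> s" "\<sigma> \<le> 1 - s" "\<sigma> < 1 / 2"
    and C: "C \<ge> 0" "\<And>a b. esob s (bbm_nonlinearity (coeff_mult a b)) \<le> ennreal C * (esob (- \<sigma>) a * esob s b)"
    and bounds: "esob s v \<le> ennreal V" "esob s w \<le> 1" "esob (- \<sigma>) z' \<le> ennreal A" "0 \<le> V" "0 \<le> A"
  shows "esob s (bbm_nonlinearity (\<lambda>n. coeff_mult (\<lambda>m. (v m + v m) + (w m + (z' m + z' m))) w n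
       + 2 * coeff_mult (\<lambda>m. z' m - z m) v n + r n))
     \<le> ennreal (4 * C * (8 * V + 4 + 16 * A)) * esob s w + ennreal (16 * C * V) * esob (- \<sigma>) (\<lambda>m. z' m - z m)
       + 2 * esob s (bbm_nonlinearity r)"
proof -
  let ?a = "\<lambda>m. (v m + v m) + (w m + (z' m + z' m))" and ?d = "\<lambda>m. z' m - z m"
  have low: "esob (- \<sigma>) x \<le> esob s x" for x using par by (intro esob_mono) simp
  have dbl: "esob r (\<lambda>m. x m + x m) \<le> 4 * esob r x" for r x
    using esob_add[of r x x] by (simp add: distrib_right[symmetric])
  have num: "ennreal (numeral k * x) = numeral k * ennreal x" if "x \<ge> 0" for k x
    using that by (simp add: ennreal_mult)
  have a: "esob (- \<sigma>) ?a \<le> ennreal (8 * V + 4 + 16 * A)"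
  proof -
    have "esob (- \<sigma>) ?a \<le> 2 * esob (- \<sigma>) (\<lambda>m. v m + v m) + 2 * esob (- \<sigma>) (\<lambda>m. w m + (z' m + z' m))"
      by (rule esob_add)
    also have "\<dots> \<le> 2 * (4 * esob s v) + 2 * (2 * esob s w + 2 * (4 * esob (- \<sigma>) z'))"
      by (intro add_mono mult_left_mono order_trans[OF esob_add] order_trans[OF dbl] low) auto
    also have "\<dots> \<le> 2 * (4 * ennreal V) + 2 * (2 * 1 + 2 * (4 * ennreal A))"
      by (intro add_mono mult_left_mono bounds) auto
    also have "\<dots> = ennreal (8 * V) + (4 + ennreal (16 * A))"
      using bounds by (simp add: num distrib_left mult.assoc[symmetric])
    also have "\<dots> = ennreal (8 * V + 4 + 16 * A)"
      using bounds by (simp add: ennreal_plus[symmetric] ennreal_numeral[symmetric] add.assoc del: ennreal_plus ennreal_numeral)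
    finally show ?thesis .
  qed
  have split: "bbm_nonlinearity (\<lambda>n. x n + y n) = (\<lambda>n. bbm_nonlinearity x n + bbm_nonlinearity y n)" for x y
    by (auto simp: bbm_nonlinearity_def fun_eq_iff distrib_left)
  have scale: "bbm_nonlinearity (\<lambda>n. 2 * x n) = (\<lambda>n. 2 * bbm_nonlinearity x n)" for x
    by (auto simp: bbm_nonlinearity_def fun_eq_iff)
  have "esob s (bbm_nonlinearity (\<lambda>n. coeff_mult ?a w n + 2 * coeff_mult ?d v n + r n))
    \<le> 2 * (2 * esob s (bbm_nonlinearity (coeff_mult ?a w)) + 2 * esob s (bbm_nonlinearity (\<lambda>n. 2 * coeff_mult ?d v n)))
       + 2 * esob s (bbm_nonlinearity r)"
    unfolding split[of "\<lambda>n. coeff_mult ?a w n + 2 * coeff_mult ?d v n"]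
    by (rule order_trans[OF esob_add], rule add_right_mono, rule mult_left_mono)
       (simp_all add: split esob_add)
  also have "esob s (bbm_nonlinearity (\<lambda>n. 2 * coeff_mult ?d v n)) = 4 * esob s (bbm_nonlinearity (coeff_mult ?d v))"
    unfolding scale by (subst esob_scale) simp
  also have "2 * (2 * esob s (bbm_nonlinearity (coeff_mult ?a w)) + 2 * (4 * esob s (bbm_nonlinearity (coeff_mult ?d v)))) + 2 * esob s (bbm_nonlinearity r)
     \<le> 2 * (2 * (ennreal C * (ennreal (8 * V + 4 + 16 * A) * esob s w)) + 2 * (4 * (ennreal C * (esob (- \<sigma>) ?d * ennreal V)))) + 2 * esob s (bbm_nonlinearity r)"
    by (intro add_mono mult_left_mono order_refl order_trans[OF C(2)] mult_mono a bounds) auto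
  also have "\<dots> = ennreal (4 * C * (8 * V + 4 + 16 * A)) * esob s w + ennreal (16 * C * V) * esob (- \<sigma>) ?d + 2 * esob s (bbm_nonlinearity r)"
  proof -
    have "2 * (2 * (ennreal C * (ennreal (8 * V + 4 + 16 * A) * x))) = ennreal (4 * C * (8 * V + 4 + 16 * A)) * x" for x
      using C(1) bounds(4,5) by (simp add: ennreal_mult num mult.assoc[symmetric] del: ennreal_plus)
    moreover have "2 * (2 * (4 * (ennreal C * (x * ennreal V)))) = ennreal (16 * C * V) * x" for x
      using C(1) bounds(4) by (simp add: ennreal_mult num mult.assoc[symmetric]) (simp add: mult.assoc mult.commute[of x])
    ultimately show ?thesis by (simp only: distrib_left)
  qed
  finally show ?thesis .
qed

text \<open>
  Cauchy--Schwarz in time on each Fourier coefficient, summed over the frequencies.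
\<close>
lemma esob_duhamel_le:
  assumes t: "0 \<le> t"
    and w: "\<And>n. w n = - \<i> / 2 * integral {0..t} (\<lambda>\<tau>. bbm_group (t - \<tau>) (bbm_nonlinearity (D \<tau>)) n)"
    and int: "\<And>n. (\<lambda>\<tau>. bbm_group (t - \<tau>) (bbm_nonlinearity (D \<tau>)) n) absolutely_integrable_on {0..t}"
  shows "esob s w \<le> ennreal t * time_integral t (\<lambda>\<tau>. esob s (bbm_nonlinearity (D \<tau>)))"
proof -
  let ?f = "\<lambda>n \<tau>. indicator {0..t} \<tau> *\<^sub>R bbm_group (t - \<tau>) (bbm_nonlinearity (D \<tau>)) n"
  have fint: "integrable lebesgue (?f n)" for n using int[of n] unfolding set_integrable_def .
  have "(\<lambda>\<tau>. ennreal (norm (?f n \<tau>))) \<in> borel_measurable lebesgue" for n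
    by (rule measurable_compose[OF borel_measurable_integrable[OF integrable_norm[OF fint]] measurable_ennreal])
  have "(indicator {0..t} :: real \<Rightarrow> ennreal) \<in> borel_measurable lebesgue"
    by (rule borel_measurable_indicator) simp
  have square: "(\<lambda>\<tau>. (ennreal (norm (?f n \<tau>)))\<^sup>2) \<in> borel_measurable lebesgue" for n
    unfolding power2_eq_square by (rule borel_measurable_times_ennreal; fact)
  have norm_f: "ennreal (norm (?f n \<tau>)) = ennreal (cmod (bbm_nonlinearity (D \<tau>) n)) * indicator {0..t} \<tau>" for n \<tau>
    by (auto simp: indicator_def)
  have coeff: "ennreal ((cmod (w n))\<^sup>2) \<le> ennreal t * (\<integral>\<^sup>+\<tau>. (ennreal (norm (?f n \<tau>)))\<^sup>2 \<partial>lebesgue)" for n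
  proof -
    have "cmod (w n) = cmod (integral {0..t} (\<lambda>\<tau>. bbm_group (t - \<tau>) (bbm_nonlinearity (D \<tau>)) n)) / 2"
      by (simp add: w norm_mult norm_divide)
    also have "\<dots> \<le> cmod (integral {0..t} (\<lambda>\<tau>. bbm_group (t - \<tau>) (bbm_nonlinearity (D \<tau>)) n))" by simp
    also have "integral {0..t} (\<lambda>\<tau>. bbm_group (t - \<tau>) (bbm_nonlinearity (D \<tau>)) n) = (LINT \<tau>|lebesgue. ?f n \<tau>)"
      using set_lebesgue_integral_eq_integral(2)[OF int[of n]] by (simp add: set_lebesgue_integral_def)
    finally have "ennreal (cmod (w n)) \<le> ennreal (norm (LINT \<tau>|lebesgue. ?f n \<tau>))" by (rule ennreal_leI)
    also have "\<dots> \<le> (\<integral>\<^sup>+\<tau>. ennreal (norm (?f n \<tau>)) \<partial>lebesgue)" by (rule integral_norm_bound_ennreal[OF fint])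
    also have "\<dots> = (\<integral>\<^sup>+\<tau>. ennreal (norm (?f n \<tau>)) * indicator {0..t} \<tau> \<partial>lebesgue)"
      by (intro nn_integral_cong) (auto simp: indicator_def)
    finally have "(ennreal (cmod (w n)))\<^sup>2 \<le> (\<integral>\<^sup>+\<tau>. ennreal (norm (?f n \<tau>)) * indicator {0..t} \<tau> \<partial>lebesgue)\<^sup>2"
      by (rule power_mono) simp
    also have "\<dots> \<le> (\<integral>\<^sup>+\<tau>. (ennreal (norm (?f n \<tau>)))\<^sup>2 \<partial>lebesgue) * (\<integral>\<^sup>+\<tau>. (indicator {0..t} \<tau>)\<^sup>2 \<partial>lebesgue)"
      by (rule Cauchy_Schwarz_nn_integral) fact+
    also have "(\<integral>\<^sup>+\<tau>. (indicator {0..t} \<tau>)\<^sup>2 \<partial>lebesgue) = (\<integral>\<^sup>+\<tau>. indicator {0..t} \<tau> \<partial>lebesgue)"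
      by (intro nn_integral_cong) (auto simp: indicator_def)
    also have "\<dots> = ennreal t" using t by simp
    finally show ?thesis by (simp add: ennreal_power mult.commute)
  qed
  have "esob s w \<le> zsum (\<lambda>n. ennreal (jbracket n powr (2 * s)) * (ennreal t * (\<integral>\<^sup>+\<tau>. (ennreal (norm (?f n \<tau>)))\<^sup>2 \<partial>lebesgue)))"
    unfolding esob_def by (rule nn_integral_mono, subst ennreal_mult, simp, simp, rule mult_left_mono[OF coeff], simp)
  also have "\<dots> = zsum (\<lambda>n. ennreal t * (\<integral>\<^sup>+\<tau>. ennreal (jbracket n powr (2 * s)) * (ennreal (norm (?f n \<tau>)))\<^sup>2 \<partial>lebesgue))"
  proof (rule nn_integral_cong)
    fix n
    have "(\<integral>\<^sup>+\<tau>. ennreal (jbracket n powr (2 * s)) * (ennreal (norm (?f n \<tau>)))\<^sup>2 \<partial>lebesgue) =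
       ennreal (jbracket n powr (2 * s)) * (\<integral>\<^sup>+\<tau>. (ennreal (norm (?f n \<tau>)))\<^sup>2 \<partial>lebesgue)"
      by (rule nn_integral_cmult[OF square])
    then show "ennreal (jbracket n powr (2 * s)) * (ennreal t * (\<integral>\<^sup>+\<tau>. (ennreal (norm (?f n \<tau>)))\<^sup>2 \<partial>lebesgue)) =
      ennreal t * (\<integral>\<^sup>+\<tau>. ennreal (jbracket n powr (2 * s)) * (ennreal (norm (?f n \<tau>)))\<^sup>2 \<partial>lebesgue)"
      by (simp only: mult.left_commute)
  qed
  also have "\<dots> = ennreal t * zsum (\<lambda>n. \<integral>\<^sup>+\<tau>. ennreal (jbracket n powr (2 * s)) * (ennreal (norm (?f n \<tau>)))\<^sup>2 \<partial>lebesgue)"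
    by (rule nn_integral_cmult) simp
  also have "zsum (\<lambda>n. \<integral>\<^sup>+\<tau>. ennreal (jbracket n powr (2 * s)) * (ennreal (norm (?f n \<tau>)))\<^sup>2 \<partial>lebesgue) =
     (\<integral>\<^sup>+\<tau>. zsum (\<lambda>n. ennreal (jbracket n powr (2 * s)) * (ennreal (norm (?f n \<tau>)))\<^sup>2) \<partial>lebesgue)"
    by (rule nn_integral_count_space_nn_integral[symmetric])
      (simp, rule borel_measurable_times_ennreal[OF borel_measurable_const square])
  also have "\<dots> = (\<integral>\<^sup>+\<tau>. esob s (bbm_nonlinearity (D \<tau>)) * indicator {0..t} \<tau> \<partial>lebesgue)"
  proof (rule nn_integral_cong)
    fix \<tau>
    show "zsum (\<lambda>n. ennreal (jbracket n powr (2 * s)) * (ennreal (norm (?f n \<tau>)))\<^sup>2) = esob s (bbm_nonlinearity (D \<tau>)) * indicator {0..t} \<tau>"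
      unfolding norm_f esob_def by (cases "\<tau> \<in> {0..t}") (auto simp: ennreal_power ennreal_mult)
  qed
  also have "\<dots> = time_integral t (\<lambda>\<tau>. esob s (bbm_nonlinearity (D \<tau>)))"
    by (rule nn_integral_completion)
  finally show ?thesis .
qed

lemma esob_multiplier_converges:
  assumes c: "c \<in> sobolev r" and m: "\<And>k n. k \<ge> 1 \<Longrightarrow> cmod (m k n) \<le> 1" "\<And>n. (\<lambda>k. m k n) \<longlonglongrightarrow> 1"
  shows "(\<lambda>k. esob r (\<lambda>n. m k n * c n - c n)) \<longlonglongrightarrow> 0"
proof -
  have "(\<lambda>k. esob r (\<lambda>n. m (Suc k) n * c n - c n)) \<longlonglongrightarrow> zsum (\<lambda>n. 0)"
    unfolding esob_def
  proof (rule nn_integral_dominated_convergence)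
    show "AE n in count_space UNIV. ennreal (jbracket n powr (2 * r) * (cmod (m (Suc k) n * c n - c n))\<^sup>2)
       \<le> 4 * ennreal (jbracket n powr (2 * r) * (cmod (c n))\<^sup>2)" for k
    proof (rule always_eventually, rule allI)
      fix n
      have "cmod (m (Suc k) n * c n - c n) = cmod (m (Suc k) n - 1) * cmod (c n)"
        by (simp add: norm_mult[symmetric] left_diff_distrib)
      also have "\<dots> \<le> 2 * cmod (c n)"
        using norm_triangle_ineq4[of "m (Suc k) n" 1] m(1)[of "Suc k" n] by (intro mult_right_mono) auto
      finally have "(cmod (m (Suc k) n * c n - c n))\<^sup>2 \<le> (2 * cmod (c n))\<^sup>2" by (intro power_mono) auto
      then have "jbracket n powr (2 * r) * (cmod (m (Suc k) n * c n - c n))\<^sup>2 \<le> jbracket n powr (2 * r) * (2 * cmod (c n))\<^sup>2"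
        by (intro mult_left_mono) auto
      also have "\<dots> = 4 * (jbracket n powr (2 * r) * (cmod (c n))\<^sup>2)" by (simp add: power_mult_distrib)
      finally have "ennreal (jbracket n powr (2 * r) * (cmod (m (Suc k) n * c n - c n))\<^sup>2)
         \<le> ennreal (4 * (jbracket n powr (2 * r) * (cmod (c n))\<^sup>2))" by (rule ennreal_leI)
      also have "\<dots> = 4 * ennreal (jbracket n powr (2 * r) * (cmod (c n))\<^sup>2)" by (subst ennreal_mult) auto
      finally show "ennreal (jbracket n powr (2 * r) * (cmod (m (Suc k) n * c n - c n))\<^sup>2)
       \<le> 4 * ennreal (jbracket n powr (2 * r) * (cmod (c n))\<^sup>2)" .
    qed
    show "(\<integral>\<^sup>+n. 4 * ennreal (jbracket n powr (2 * r) * (cmod (c n))\<^sup>2) \<partial>count_space UNIV) < \<infinity>"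
      using c by (subst nn_integral_cmult) (auto simp: sobolev_iff_esob esob_def ennreal_mult_less_top)
    show "AE n in count_space UNIV. (\<lambda>k. ennreal (jbracket n powr (2 * r) * (cmod (m (Suc k) n * c n - c n))\<^sup>2)) \<longlonglongrightarrow> 0"
    proof (rule always_eventually, rule allI)
      fix n
      have "(\<lambda>k. jbracket n powr (2 * r) * (cmod (m (Suc k) n * c n - c n))\<^sup>2) \<longlonglongrightarrow> jbracket n powr (2 * r) * (cmod (1 * c n - c n))\<^sup>2"
        by (intro tendsto_intros filterlim_compose[OF m(2) filterlim_Suc])
      from tendsto_ennrealI[OF this]
      show "(\<lambda>k. ennreal (jbracket n powr (2 * r) * (cmod (m (Suc k) n * c n - c n))\<^sup>2)) \<longlonglongrightarrow> 0" by simp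
    qed
  qed auto
  from LIMSEQ_imp_Suc[OF this] show ?thesis by simp
qed

text \<open>
  The Duhamel formulas are subtracted coefficientwise, so that the version \<open>q\<close> of the square only has
  to be compared with the square for the smooth data inside the time integral. The source consists
  of the distance of the data in \<open>H^(-\<sigma>)\<close> and of the distance of the two squares.
\<close>
lemma solution_difference_inequality:
  assumes par: "0 \<le> \<sigma>" "\<sigma> \<le> s" "\<sigma> \<le> 1 - s" "\<sigma> < 1 / 2"
    and C: "C \<ge> 0" "\<And>a b. esob s (bbm_nonlinearity (coeff_mult a b)) \<le> ennreal C * (esob (- \<sigma>) a * esob s b)"
    and T: "0 \<le> T" and c: "c \<in> sobolev (- \<sigma>)" and c': "\<And>r. c' \<in> sobolev r"
    and v: "v \<in> cont_sobolev T s" and u: "\<And>t n. t \<in> {0..T} \<Longrightarrow> u t n = bbm_group t c n + v t n"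
    and duh: "duhamel T c (\<lambda>\<tau> n. coeff_mult (v \<tau>) (v \<tau>) n + 2 * coeff_mult (bbm_group \<tau> c) (v \<tau>) n + q \<tau> n) u"
    and u': "bbm_smooth_solution c' u'"
    and q: "\<And>n. n \<noteq> 0 \<Longrightarrow> (\<lambda>t. q t n) \<in> borel_measurable borel"
    and bounds: "\<And>t. t \<in> {0..T} \<Longrightarrow> esob s (v t) \<le> ennreal V" "esob (- \<sigma>) c' \<le> ennreal A" "0 \<le> V" "0 \<le> A"
    and w_def: "w = (\<lambda>t n. u' t n - bbm_group t c' n - v t n)"
    and t: "t \<in> {0..T}" and small: "\<And>\<tau>. \<tau> \<in> {0..t} \<Longrightarrow> esob s (w \<tau>) \<le> 1"
  shows "esob s (w t) \<le> ennreal T * (ennreal (16 * C * V) * esob (- \<sigma>) (\<lambda>n. c' n - c n) * ennreal T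
        + 2 * time_integral T (\<lambda>\<tau>. esob s (bbm_nonlinearity (\<lambda>n. evolution_square c' \<tau> n - q \<tau> n))))
      + ennreal (T * (4 * C * (8 * V + 4 + 16 * A))) * time_integral t (\<lambda>\<tau>. esob s (w \<tau>))"
proof -
  let ?z = "\<lambda>t. bbm_group t c" and ?z' = "\<lambda>t. bbm_group t c'"
  let ?F = "\<lambda>\<tau> n. coeff_mult (v \<tau>) (v \<tau>) n + 2 * coeff_mult (?z \<tau>) (v \<tau>) n + q \<tau> n"
  let ?F' = "\<lambda>\<tau>. coeff_mult (u' \<tau>) (u' \<tau>)"
  let ?B = "4 * C * (8 * V + 4 + 16 * A)" and ?E = "esob (- \<sigma>) (\<lambda>n. c' n - c n)"
  let ?H = "\<lambda>\<tau>. esob s (bbm_nonlinearity (\<lambda>n. evolution_square c' \<tau> n - q \<tau> n))"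
  have duh': "duhamel T c' ?F' u'" and u'_cont: "u' \<in> cont_sobolev T s"
    using u' T unfolding bbm_smooth_solution_def by auto
  have w_cont: "w \<in> cont_sobolev T s"
    unfolding w_def by (intro cont_sobolev_diff u'_cont v cont_sobolev_bbm_group c')
  define D where "D = (\<lambda>\<tau> n. ?F' \<tau> n - ?F \<tau> n)"
  have lin: "bbm_group a (bbm_nonlinearity (D \<tau>)) n = bbm_group a (bbm_nonlinearity (?F' \<tau>)) n - bbm_group a (bbm_nonlinearity (?F \<tau>)) n" for a \<tau> n
    by (simp add: D_def bbm_nonlinearity_def bbm_group_def right_diff_distrib)
  have int: "(\<lambda>\<tau>. bbm_group (t - \<tau>) (bbm_nonlinearity (?F \<tau>)) n) absolutely_integrable_on {0..t}"
      "(\<lambda>\<tau>. bbm_group (t - \<tau>) (bbm_nonlinearity (?F' \<tau>)) n) absolutely_integrable_on {0..t}" for n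
    using duh duh' t unfolding duhamel_def by auto
  have w_eq: "w t n = - \<i> / 2 * integral {0..t} (\<lambda>\<tau>. bbm_group (t - \<tau>) (bbm_nonlinearity (D \<tau>)) n)" for n
  proof -
    have "v t n = - \<i> / 2 * integral {0..t} (\<lambda>\<tau>. bbm_group (t - \<tau>) (bbm_nonlinearity (?F \<tau>)) n)"
      using duh t u[OF t, of n] unfolding duhamel_def by auto
    moreover have "u' t n - bbm_group t c' n = - \<i> / 2 * integral {0..t} (\<lambda>\<tau>. bbm_group (t - \<tau>) (bbm_nonlinearity (?F' \<tau>)) n)"
      using duh' t unfolding duhamel_def by auto
    moreover have "integral {0..t} (\<lambda>\<tau>. bbm_group (t - \<tau>) (bbm_nonlinearity (D \<tau>)) n) =
       integral {0..t} (\<lambda>\<tau>. bbm_group (t - \<tau>) (bbm_nonlinearity (?F' \<tau>)) n) - integral {0..t} (\<lambda>\<tau>. bbm_group (t - \<tau>) (bbm_nonlinearity (?F \<tau>)) n)"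
      unfolding lin using int[of n] by (intro Henstock_Kurzweil_Integration.integral_diff set_lebesgue_integral_eq_integral(1))
    ultimately show ?thesis unfolding w_def by (simp add: right_diff_distrib)
  qed
  have "esob s (w t) \<le> ennreal t * time_integral t (\<lambda>\<tau>. esob s (bbm_nonlinearity (D \<tau>)))"
  proof (rule esob_duhamel_le[OF _ w_eq])
    show "0 \<le> t" using t by simp
    show "(\<lambda>\<tau>. bbm_group (t - \<tau>) (bbm_nonlinearity (D \<tau>)) n) absolutely_integrable_on {0..t}" for n
      unfolding lin by (intro set_integral_diff(1) int)
  qed
  also have "\<dots> \<le> ennreal T * time_integral t (\<lambda>\<tau>. esob s (bbm_nonlinearity (D \<tau>)))"
    using t by (intro mult_right_mono ennreal_leI) auto
  also have "time_integral t (\<lambda>\<tau>. esob s (bbm_nonlinearity (D \<tau>))) \<le>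
     (\<integral>\<^sup>+\<tau>. ennreal ?B * (esob s (w \<tau>) * indicator {0..t} \<tau>) + (ennreal (16 * C * V) * ?E * indicator {0..T} \<tau> + 2 * (?H \<tau> * indicator {0..T} \<tau>)) \<partial>lborel)"
  proof (rule nn_integral_mono)
    fix \<tau>
    show "esob s (bbm_nonlinearity (D \<tau>)) * indicator {0..t} \<tau> \<le>
      ennreal ?B * (esob s (w \<tau>) * indicator {0..t} \<tau>) + (ennreal (16 * C * V) * ?E * indicator {0..T} \<tau> + 2 * (?H \<tau> * indicator {0..T} \<tau>))"
    proof (cases "\<tau> \<in> {0..t}")
      case True
      then have \<tau>: "\<tau> \<in> {0..T}" using t by auto
      have u'_eq: "u' \<tau> = (\<lambda>n. ?z' \<tau> n + (v \<tau> n + w \<tau> n))" by (simp add: w_def)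
      have "D \<tau> n = coeff_mult (\<lambda>m. (v \<tau> m + v \<tau> m) + (w \<tau> m + (?z' \<tau> m + ?z' \<tau> m))) (w \<tau>) n
          + 2 * coeff_mult (\<lambda>m. ?z' \<tau> m - ?z \<tau> m) (v \<tau>) n + (coeff_mult (?z' \<tau>) (?z' \<tau>) n - q \<tau> n)" for n
        unfolding D_def u'_eq
        by (rule coeff_mult_difference[OF par]) (use c c' cont_sobolevD(1)[OF v \<tau>] cont_sobolevD(1)[OF w_cont \<tau>] in auto)
      then have D_eq: "D \<tau> = (\<lambda>n. coeff_mult (\<lambda>m. (v \<tau> m + v \<tau> m) + (w \<tau> m + (?z' \<tau> m + ?z' \<tau> m))) (w \<tau>) n
          + 2 * coeff_mult (\<lambda>m. ?z' \<tau> m - ?z \<tau> m) (v \<tau>) n + (evolution_square c' \<tau> n - q \<tau> n))"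
        using evolution_square_limit(1)[OF c'] by auto
      have "(\<lambda>m. ?z' \<tau> m - ?z \<tau> m) = bbm_group \<tau> (\<lambda>n. c' n - c n)"
        by (simp add: bbm_group_def fun_eq_iff right_diff_distrib)
      then have E_eq: "esob (- \<sigma>) (\<lambda>m. ?z' \<tau> m - ?z \<tau> m) = ?E" by simp
      have "esob s (bbm_nonlinearity (D \<tau>)) \<le> ennreal ?B * esob s (w \<tau>) + ennreal (16 * C * V) * ?E + 2 * ?H \<tau>"
        unfolding D_eq E_eq[symmetric]
        by (rule esob_bbm_difference[OF par C]) (use bounds \<tau> small[OF True] in auto)
      then show ?thesis using True \<tau> by (simp add: add.assoc)
    qed simp
  qed
  also have "\<dots> = ennreal ?B * time_integral t (\<lambda>\<tau>. esob s (w \<tau>)) + (ennreal (16 * C * V) * ?E * ennreal T + 2 * time_integral T ?H)"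
  proof -
    have [measurable]: "(\<lambda>\<tau>. esob s (w \<tau>) * indicator {0..t} \<tau>) \<in> borel_measurable borel"
    proof -
      have "continuous_on {0..t} (\<lambda>\<tau>. (sobolev_norm s (w \<tau>))\<^sup>2)"
        using t by (intro continuous_intros continuous_on_subset[OF cont_sobolev_norm_continuous[OF w_cont]]) auto
      then have "(\<lambda>\<tau>. indicator {0..t} \<tau> *\<^sub>R (sobolev_norm s (w \<tau>))\<^sup>2) \<in> borel_measurable borel"
        by (intro borel_measurable_continuous_on_indicator) auto
      then have "(\<lambda>\<tau>. ennreal (indicator {0..t} \<tau> *\<^sub>R (sobolev_norm s (w \<tau>))\<^sup>2)) \<in> borel_measurable borel" by measurable
      also have "(\<lambda>\<tau>. ennreal (indicator {0..t} \<tau> *\<^sub>R (sobolev_norm s (w \<tau>))\<^sup>2)) = (\<lambda>\<tau>. esob s (w \<tau>) * indicator {0..t} \<tau>)"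
        using t esob_eq_sobolev_norm[OF cont_sobolevD(1)[OF w_cont]] by (auto simp: fun_eq_iff indicator_def)
      finally show ?thesis .
    qed
    have [measurable]: "?H \<in> borel_measurable borel"
      using q by (intro esob_measurable bbm_nonlinearity_measurable borel_measurable_diff evolution_square_time_measurable)
    show ?thesis using T by (simp add: nn_integral_add nn_integral_cmult)
  qed
  finally have "esob s (w t) \<le> ennreal T * (ennreal ?B * time_integral t (\<lambda>\<tau>. esob s (w \<tau>)) + (ennreal (16 * C * V) * ?E * ennreal T + 2 * time_integral T ?H))"
    by this (rule mult_left_mono, simp_all)
  moreover have "ennreal (T * ?B) = ennreal T * ennreal ?B" using T C(1) bounds(3,4) by (intro ennreal_mult) auto
  ultimately show "esob s (w t) \<le> ennreal T * (ennreal (16 * C * V) * ?E * ennreal T + 2 * time_integral T ?H)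
      + ennreal (T * ?B) * time_integral t (\<lambda>\<tau>. esob s (w \<tau>))"
    by (simp only: distrib_left mult.assoc add.commute)
qed

section \<open>Convergence of the solutions\<close>

lemma multiplier_gain:
  assumes c: "c \<in> sobolev r0" and m: "\<And>n. jbracket n powr (r - r0) * cmod (m n) \<le> C"
  shows "(\<lambda>n. m n * c n) \<in> sobolev r"
proof -
  have "esob r (\<lambda>n. m n * c n) \<le> zsum (\<lambda>n. ennreal (C\<^sup>2) * ennreal (jbracket n powr (2 * r0) * (cmod (c n))\<^sup>2))"
    unfolding esob_def
  proof (rule nn_integral_mono)
    fix n
    have "jbracket n powr (2 * r) * (cmod (m n * c n))\<^sup>2 = (jbracket n powr (r - r0) * cmod (m n))\<^sup>2 * (jbracket n powr (2 * r0) * (cmod (c n))\<^sup>2)"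
    proof -
      have "jbracket n powr (2 * r) = jbracket n powr (2 * (r - r0)) * jbracket n powr (2 * r0)"
        by (simp add: powr_add[symmetric])
      then show ?thesis by (simp add: norm_mult power_mult_distrib jbracket_powr_power2)
    qed
    also have "\<dots> \<le> C\<^sup>2 * (jbracket n powr (2 * r0) * (cmod (c n))\<^sup>2)"
      by (intro mult_right_mono power_mono m) auto
    finally have "ennreal (jbracket n powr (2 * r) * (cmod (m n * c n))\<^sup>2) \<le> ennreal (C\<^sup>2 * (jbracket n powr (2 * r0) * (cmod (c n))\<^sup>2))"
      by (rule ennreal_leI)
    also have "\<dots> = ennreal (C\<^sup>2) * ennreal (jbracket n powr (2 * r0) * (cmod (c n))\<^sup>2)" by (rule ennreal_mult) auto
    finally show "ennreal (jbracket n powr (2 * r) * (cmod (m n * c n))\<^sup>2) \<le> ennreal (C\<^sup>2) * ennreal (jbracket n powr (2 * r0) * (cmod (c n))\<^sup>2)" .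
  qed
  also have "\<dots> = ennreal (C\<^sup>2) * esob r0 c" unfolding esob_def by (rule nn_integral_cmult) simp
  also have "\<dots> < \<infinity>" using c by (simp add: sobolev_iff_esob ennreal_mult_less_top)
  finally show ?thesis by (simp add: sobolev_iff_esob)
qed

text \<open>
  The deterministic part. The constants \<open>V\<close> and \<open>A\<close> bound the remainder \<open>v\<close> and the data uniformly in
  \<open>k\<close>, so the rate \<open>b\<close> in Gronwall's inequality does not depend on \<open>k\<close>, whereas the source \<open>d k\<close>
  tends to zero.
\<close>
theorem smooth_approximation_converges:
  assumes par: "0 \<le> \<sigma>" "\<sigma> \<le> s" "\<sigma> \<le> 1 - s" "\<sigma> < 1 / 2" and r: "r \<le> - \<sigma>"
    and T: "0 \<le> T" and c: "c \<in> sobolev (- \<sigma>)"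
    and m: "\<And>k n. k \<ge> 1 \<Longrightarrow> cmod (m k n) \<le> 1" "\<And>n. (\<lambda>k. m k n) \<longlonglongrightarrow> 1"
    and smooth: "\<And>k r. k \<ge> 1 \<Longrightarrow> (\<lambda>n. m k n * c n) \<in> sobolev r"
    and u: "bbm_rough_solution s T c q u"
    and uk: "\<And>k. k \<ge> 1 \<Longrightarrow> bbm_smooth_solution (\<lambda>n. m k n * c n) (uk k)"
    and q: "\<And>n. n \<noteq> 0 \<Longrightarrow> (\<lambda>t. q t n) \<in> borel_measurable borel"
    and G: "(\<lambda>k. \<integral>\<^sup>+t. esob s (bbm_nonlinearity (\<lambda>n. evolution_square (\<lambda>n. m k n * c n) t n - q t n)) * indicator {0..L} t \<partial>lborel) \<longlonglongrightarrow> 0"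
    and L: "T \<le> L"
  shows "sobolev_converges r (\<lambda>k n. m k n * c n) c" and "cont_sobolev_converges T r uk u"
proof -
  let ?c = "\<lambda>k n. m k n * c n"
  have ev1: "\<forall>\<^sub>F k in sequentially. 1 \<le> (k::nat)" by (rule eventually_ge_at_top)
  define e where "e = (\<lambda>k. esob (- \<sigma>) (\<lambda>n. ?c k n - c n))"
  have e: "e \<longlonglongrightarrow> 0" unfolding e_def by (rule esob_multiplier_converges[OF c m])
  define n0 where "n0 = (\<lambda>k. sobolev_norm (- \<sigma>) (\<lambda>n. ?c k n - c n))"
  have diff_mem: "(\<lambda>n. ?c k n - c n) \<in> sobolev (- \<sigma>)" if "k \<ge> 1" for k
    using smooth[OF that] c by (intro sobolev_diff)
  have n0: "n0 \<longlonglongrightarrow> 0"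
  proof -
    have "(\<lambda>k. sqrt (enn2real (e k))) \<longlonglongrightarrow> sqrt (enn2real 0)"
      by (intro tendsto_real_sqrt tendsto_enn2real) (auto intro: e)
    moreover have "\<forall>\<^sub>F k in sequentially. sqrt (enn2real (e k)) = n0 k"
      using ev1 by eventually_elim (simp add: e_def n0_def esob_eq_sobolev_norm[OF diff_mem] sobolev_norm_nonneg)
    ultimately show ?thesis using Lim_transform_eventually by force
  qed
  have conv_r: "sobolev_norm r (\<lambda>n. ?c k n - c n) \<le> n0 k" if "k \<ge> 1" for k
    unfolding n0_def by (rule sobolev_norm_mono[OF r diff_mem[OF that]])
  show "sobolev_converges r ?c c"
    unfolding sobolev_converges_def
  proof (intro conjI)
    show "c \<in> sobolev r" by (rule sobolev_mono[OF r c])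
    show "\<forall>\<^sub>F k in sequentially. ?c k \<in> sobolev r" using ev1 by eventually_elim (rule smooth)
    show "(\<lambda>k. sobolev_norm r (\<lambda>n. ?c k n - c n)) \<longlonglongrightarrow> 0"
    proof (rule tendsto_sandwich[OF _ _ tendsto_const n0])
      show "\<forall>\<^sub>F k in sequentially. sobolev_norm r (\<lambda>n. ?c k n - c n) \<le> n0 k"
        using ev1 by eventually_elim (rule conv_r)
    qed (simp add: sobolev_norm_nonneg)
  qed

  obtain C where C: "C \<ge> 0" "\<And>a b. esob s (bbm_nonlinearity (coeff_mult a b)) \<le> ennreal C * (esob (- \<sigma>) a * esob s b)"
    using bilinear_estimate[OF par] by blast
  obtain v where v: "v \<in> cont_sobolev T s" and u_eq: "\<And>t n. t \<in> {0..T} \<Longrightarrow> u t n = bbm_group t c n + v t n"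
    and duh: "duhamel T c (\<lambda>\<tau> n. coeff_mult (v \<tau>) (v \<tau>) n + 2 * coeff_mult (bbm_group \<tau> c) (v \<tau>) n + q \<tau> n) u"
    using u unfolding bbm_rough_solution_def by blast
  obtain V0 where V0: "V0 \<ge> 0" "\<And>t. t \<in> {0..T} \<Longrightarrow> sobolev_norm s (v t) \<le> V0"
    using cont_sobolev_bounded[OF v] by blast
  define V where "V = V0\<^sup>2"
  have V: "esob s (v t) \<le> ennreal V" if "t \<in> {0..T}" for t
    unfolding V_def esob_eq_sobolev_norm[OF cont_sobolevD(1)[OF v that]]
    using V0(2)[OF that] by (intro ennreal_leI power_mono sobolev_norm_nonneg)
  define A where "A = (sobolev_norm (- \<sigma>) c)\<^sup>2"
  have A: "esob (- \<sigma>) (?c k) \<le> ennreal A" if "k \<ge> 1" for k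
  proof -
    have "esob (- \<sigma>) (?c k) \<le> ennreal (1\<^sup>2) * esob (- \<sigma>) c"
      using m(1)[OF that] by (intro esob_le_mult) (auto simp: norm_mult mult_left_le_one_le)
    then show ?thesis by (simp add: A_def esob_eq_sobolev_norm[OF c])
  qed
  define w where "w = (\<lambda>k t n. uk k t n - bbm_group t (?c k) n - v t n)"
  define Gk where "Gk = (\<lambda>k. \<integral>\<^sup>+t. esob s (bbm_nonlinearity (\<lambda>n. evolution_square (?c k) t n - q t n)) * indicator {0..L} t \<partial>lborel)"
  define d where "d = (\<lambda>k. ennreal T * (ennreal (16 * C * V) * e k * ennreal T + 2 * Gk k))"
  define B where "B = T * (4 * C * (8 * V + 4 + 16 * A))"
  have VA: "0 \<le> V" "0 \<le> A" by (simp_all add: V_def A_def)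
  have B0: "0 \<le> B" unfolding B_def using T C(1) VA by simp
  have d: "d \<longlonglongrightarrow> 0"
  proof -
    have "(\<lambda>k. ennreal T * ((ennreal (16 * C * V) * ennreal T) * e k + 2 * Gk k)) \<longlonglongrightarrow> ennreal T * ((ennreal (16 * C * V) * ennreal T) * 0 + 2 * 0)"
      using G unfolding Gk_def[symmetric]
      by (intro ennreal_tendsto_cmult tendsto_add e) (auto simp: ennreal_mult_less_top)
    then show ?thesis by (simp add: d_def ac_simps)
  qed
  have w_cont: "w k \<in> cont_sobolev T s" if "k \<ge> 1" for k
    using uk[OF that] T unfolding w_def bbm_smooth_solution_def
    by (intro cont_sobolev_diff cont_sobolev_bbm_group v smooth[OF that]) auto
  have w_le: "esob s (w k t) \<le> d k + ennreal B * time_integral t (\<lambda>\<tau>. esob s (w k \<tau>))"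
    if k: "k \<ge> 1" and t: "t \<in> {0..T}" and small: "\<And>\<tau>. \<tau> \<in> {0..t} \<Longrightarrow> esob s (w k \<tau>) \<le> 1" for k t
  proof -
    note hyps = par C T c smooth[OF k] v u_eq duh uk[OF k] q V A[OF k] VA
    have w_eq: "w k = (\<lambda>t n. uk k t n - bbm_group t (?c k) n - v t n)" by (simp add: w_def)
    have "esob s (w k t) \<le> ennreal T * (ennreal (16 * C * V) * e k * ennreal T
        + 2 * time_integral T (\<lambda>\<tau>. esob s (bbm_nonlinearity (\<lambda>n. evolution_square (?c k) \<tau> n - q \<tau> n))))
      + ennreal B * time_integral t (\<lambda>\<tau>. esob s (w k \<tau>))"
      unfolding e_def B_def by (rule solution_difference_inequality[OF hyps w_eq t small])
    also have "time_integral T (\<lambda>\<tau>. esob s (bbm_nonlinearity (\<lambda>n. evolution_square (?c k) \<tau> n - q \<tau> n))) \<le> Gk k"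
      unfolding Gk_def using L by (intro nn_integral_mono mult_left_mono) (auto simp: indicator_def)
    finally show ?thesis
      unfolding d_def by this (intro add_right_mono mult_left_mono add_left_mono, simp_all)
  qed
  \<comment> \<open>Enlarged to make the rate positive even for T = 0.\<close>
  define b where "b = B + 1"
  define K where "K = exp (2 * b * T)"
  define \<eta> where "\<eta> = (\<lambda>k. 2 * enn2real (d k) * K)"
  have \<eta>: "\<eta> \<longlonglongrightarrow> 0"
  proof -
    have "\<eta> \<longlonglongrightarrow> 2 * enn2real 0 * K" unfolding \<eta>_def by (intro tendsto_mult tendsto_const tendsto_enn2real) (auto intro: d)
    then show ?thesis by simp
  qed
  have bound: "\<forall>\<^sub>F k in sequentially. \<forall>t\<in>{0..T}. (sobolev_norm s (w k t))\<^sup>2 \<le> \<eta> k"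
  proof -
    have "\<forall>\<^sub>F k in sequentially. \<eta> k < 1" using \<eta> by (rule order_tendstoD) simp
    moreover have "\<forall>\<^sub>F k in sequentially. d k < \<infinity>" using d by (rule order_tendstoD) simp
    ultimately show ?thesis using ev1
    proof eventually_elim
      case (elim k)
      let ?y = "\<lambda>t. (sobolev_norm s (w k t))\<^sup>2"
      have y: "ennreal (?y t) = esob s (w k t)" if "t \<in> {0..T}" for t
        by (rule esob_eq_sobolev_norm[symmetric, OF cont_sobolevD(1)[OF w_cont[OF elim(3)] that]])
      have "?y t \<le> 2 * enn2real (d k) * exp (2 * b * T)" if t: "t \<in> {0..T}" for t
      proof (rule gronwall_continuation[OF _ _ _ _ _ _ _ t])
        show "continuous_on {0..T} ?y" by (intro continuous_intros cont_sobolev_norm_continuous w_cont elim)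
        show "2 * enn2real (d k) * exp (2 * b * T) < 1" using elim(1) by (simp add: \<eta>_def K_def)
        show "0 < b" using B0 by (simp add: b_def)
        have "w k 0 n = 0" for n
        proof -
          have "uk k 0 n = bbm_group 0 (?c k) n" "u 0 n = bbm_group 0 c n"
            using uk[OF elim(3)] duh T unfolding bbm_smooth_solution_def duhamel_def by auto
          then show ?thesis using u_eq[of 0 n] T by (simp add: w_def)
        qed
        then show "?y 0 < 1" by (simp add: sobolev_norm_def)
        fix t assume t: "t \<in> {0..T}" and le1: "\<And>\<tau>. \<tau> \<in> {0..t} \<Longrightarrow> ?y \<tau> \<le> 1"
        have "esob s (w k \<tau>) \<le> 1" if "\<tau> \<in> {0..t}" for \<tau>
          using y[of \<tau>] le1[OF that] that t by (metis atLeastAtMost_iff ennreal_1 ennreal_leI order_trans)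
        from w_le[OF elim(3) t this]
        have "ennreal (?y t) \<le> d k + ennreal B * time_integral t (\<lambda>\<tau>. esob s (w k \<tau>))"
          using y[OF t] by simp
        also have "time_integral t (\<lambda>\<tau>. esob s (w k \<tau>)) = time_integral t (\<lambda>\<tau>. ennreal (?y \<tau>))"
          using y t by (intro nn_integral_cong) (auto simp: indicator_def)
        also have "d k + ennreal B * \<dots> \<le> ennreal (enn2real (d k)) + ennreal b * \<dots>"
          using elim(2) by (intro add_mono mult_right_mono ennreal_leI) (auto simp: b_def)
        finally show "ennreal (?y t) \<le> ennreal (enn2real (d k)) + ennreal b * time_integral t (\<lambda>\<tau>. ennreal (?y \<tau>))" .
      qed simp_all
      then show ?case unfolding \<eta>_def K_def by blast
    qed
  qed

  have u_cont: "u \<in> cont_sobolev T r"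
  proof (rule cont_sobolev_cong)
    show "(\<lambda>t n. bbm_group t c n + v t n) \<in> cont_sobolev T r"
      by (intro cont_sobolev_add cont_sobolev_bbm_group sobolev_mono[OF r c] cont_sobolev_mono[OF _ v]) (use r par in linarith)
  qed (auto simp: u_eq)
  have uk_cont: "uk k \<in> cont_sobolev T r" if "k \<ge> 1" for k
    using uk[OF that] T unfolding bbm_smooth_solution_def by blast
  show "cont_sobolev_converges T r uk u"
    unfolding cont_sobolev_converges_def
  proof (intro conjI u_cont)
    show "\<forall>\<^sub>F k in sequentially. uk k \<in> cont_sobolev T r" using ev1 by eventually_elim (rule uk_cont)
    have lim: "(\<lambda>k. n0 k + sqrt (\<eta> k)) \<longlonglongrightarrow> 0"
      using tendsto_add[OF n0 tendsto_real_sqrt[OF \<eta>]] by simp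
    show "(\<lambda>k. cont_sobolev_norm T r (\<lambda>t n. uk k t n - u t n)) \<longlonglongrightarrow> 0"
    proof (rule tendsto_sandwich[OF _ _ tendsto_const lim])
      show "\<forall>\<^sub>F k in sequentially. 0 \<le> cont_sobolev_norm T r (\<lambda>t n. uk k t n - u t n)"
        using ev1
      proof eventually_elim
        case (elim k)
        have "0 \<le> sobolev_norm r (\<lambda>n. uk k 0 n - u 0 n)" by (rule sobolev_norm_nonneg)
        also have "\<dots> \<le> cont_sobolev_norm T r (\<lambda>t n. uk k t n - u t n)"
          using T by (intro sobolev_norm_le_cont cont_sobolev_diff uk_cont elim u_cont) auto
        finally show ?case .
      qed
      show "\<forall>\<^sub>F k in sequentially. cont_sobolev_norm T r (\<lambda>t n. uk k t n - u t n) \<le> n0 k + sqrt (\<eta> k)"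
        using bound ev1
      proof eventually_elim
        case (elim k)
        show ?case
        proof (rule cont_sobolev_norm_le[OF T])
          fix t assume t: "t \<in> {0..T}"
          have eq: "(\<lambda>n. uk k t n - u t n) = (\<lambda>n. bbm_group t (\<lambda>n. ?c k n - c n) n + w k t n)"
            using u_eq[OF t] by (auto simp: w_def bbm_group_def algebra_simps)
          have wt: "w k t \<in> sobolev s" by (rule cont_sobolevD(1)[OF w_cont[OF elim(2)] t])
          have "sobolev_norm r (\<lambda>n. uk k t n - u t n) \<le> sobolev_norm r (bbm_group t (\<lambda>n. ?c k n - c n)) + sobolev_norm r (w k t)"
            unfolding eq using r par wt sobolev_mono[OF r diff_mem[OF elim(2)]]
            by (intro sobolev_norm_triangle sobolev_mono[OF _ wt]) auto
          also have "sobolev_norm r (bbm_group t (\<lambda>n. ?c k n - c n)) = sobolev_norm r (\<lambda>n. ?c k n - c n)"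
            by (simp add: sobolev_norm_def)
          also have "\<dots> \<le> n0 k" by (rule conv_r[OF elim(2)])
          also have "sobolev_norm r (w k t) \<le> sobolev_norm s (w k t)"
            using r par by (intro sobolev_norm_mono wt) linarith
          also have "\<dots> \<le> sqrt (\<eta> k)" using elim(1) t by (intro real_le_rsqrt) blast
          finally show "sobolev_norm r (\<lambda>n. uk k t n - u t n) \<le> n0 k + sqrt (\<eta> k)" by simp
        qed
      qed
    qed
  qed
qed
lemma mol_symbol_tendsto_1:
  assumes "mollifier_kernel \<rho>" shows "(\<lambda>k. mol_symbol \<rho> k n) \<longlonglongrightarrow> 1"
proof -
  have "(\<lambda>k. \<bar>of_int n\<bar> / real k) \<longlonglongrightarrow> 0" by (rule lim_const_over_n)
  then have "(\<lambda>k. mol_symbol \<rho> k n - 1) \<longlonglongrightarrow> 0"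
    by (rule Lim_null_comparison[rotated])
      (use mol_symbol_near_1[OF assms] in \<open>auto intro!: eventually_sequentiallyI[of 1]\<close>)
  then show ?thesis by (rule LIM_zero_cancel)
qed

theorem theorem1p11:
  fixes M :: "'w measure" and g :: "int \<Rightarrow> 'w \<Rightarrow> complex"
    and \<alpha> s \<epsilon> :: real
    and q :: "'w \<Rightarrow> real \<Rightarrow> int \<Rightarrow> complex"
    and \<Sigma> :: "'w set" and T :: "'w \<Rightarrow> real"
    and u :: "'w \<Rightarrow> real \<Rightarrow> int \<Rightarrow> complex"
    and uk :: "(real \<Rightarrow> real) \<Rightarrow> nat \<Rightarrow> 'w \<Rightarrow> real \<Rightarrow> int \<Rightarrow> complex"
  defines "u0 \<equiv> random_data \<alpha> g"
  assumes "prob_space M"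
    and "gaussian_family M g"
    and "1 / 4 < \<alpha>" and "\<alpha> \<le> 1 / 2"
    and "1 / 2 - \<alpha> < s" and "s < 2 * \<alpha>"
    and "\<epsilon> > 0"
    and "linear_square_version M u0 q"
    and "\<Sigma> \<in> sets M" and "measure M \<Sigma> = 1"
    and "\<And>\<omega>. \<omega> \<in> \<Sigma> \<Longrightarrow> T \<omega> > 0"
    and "\<And>\<omega>. \<omega> \<in> \<Sigma> \<Longrightarrow> bbm_rough_solution s (T \<omega>) (u0 \<omega>) (q \<omega>) (u \<omega>)"
    and "\<And>\<omega> w. \<omega> \<in> \<Sigma> \<Longrightarrow> bbm_rough_solution s (T \<omega>) (u0 \<omega>) (q \<omega>) w \<Longrightarrow>
           \<forall>t\<in>{0..T \<omega>}. w t = u \<omega> t"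
    and "\<And>\<rho> k \<omega>. mollifier_kernel \<rho> \<Longrightarrow> k \<ge> 1 \<Longrightarrow> \<omega> \<in> space M \<Longrightarrow>
           (\<And>r. mollify \<rho> k (u0 \<omega>) \<in> sobolev r) \<Longrightarrow>
           bbm_smooth_solution (mollify \<rho> k (u0 \<omega>)) (uk \<rho> k \<omega>)"
  shows "(\<forall>\<rho>. mollifier_kernel \<rho> \<longrightarrow>
           (AE \<omega> in M.
              sobolev_converges (\<alpha> - 1 / 2 - \<epsilon>) (\<lambda>k. mollify \<rho> k (u0 \<omega>)) (u0 \<omega>) \<and>
              cont_sobolev_converges (T \<omega>) (\<alpha> - 1 / 2 - \<epsilon>) (\<lambda>k. uk \<rho> k \<omega>) (u \<omega>))) \<and>
         (\<forall>\<rho> \<rho>'. mollifier_kernel \<rho> \<longrightarrow> mollifier_kernel \<rho>' \<longrightarrow>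
           (AE \<omega> in M. \<forall>w w'.
              cont_sobolev_converges (T \<omega>) (\<alpha> - 1 / 2 - \<epsilon>) (\<lambda>k. uk \<rho> k \<omega>) w \<longrightarrow>
              cont_sobolev_converges (T \<omega>) (\<alpha> - 1 / 2 - \<epsilon>) (\<lambda>k. uk \<rho>' k \<omega>) w' \<longrightarrow>
              (\<forall>t\<in>{0..T \<omega>}. w t = w' t)))"
proof -
  interpret prob_space M by fact
  note g = \<open>gaussian_family M g\<close> and q = \<open>linear_square_version M u0 q\<close>[unfolded u0_def]

  \<comment> \<open>The regularity of the data: every entry of the minimum keeps one of the requirements on \<open>\<sigma>\<close> below.\<close>
  define \<epsilon>' where "\<epsilon>' = min \<epsilon> (min (s - (1 / 2 - \<alpha>)) (min (1 / 2 + \<alpha> - s) (\<alpha> / 2)))"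
  define \<sigma> where "\<sigma> = 1 / 2 - \<alpha> + \<epsilon>'"
  have "\<epsilon>' > 0" unfolding \<epsilon>'_def using assms by auto
  moreover have "\<epsilon>' \<le> \<epsilon>" "\<epsilon>' \<le> s - (1 / 2 - \<alpha>)" "\<epsilon>' \<le> 1 / 2 + \<alpha> - s" "\<epsilon>' \<le> \<alpha> / 2"
    unfolding \<epsilon>'_def by (auto simp: min_def)
  ultimately have \<sigma>: "0 \<le> \<sigma>" "\<sigma> \<le> s" "\<sigma> \<le> 1 - s" "\<sigma> < 1 / 2" "\<alpha> - 1 / 2 - \<epsilon> \<le> - \<sigma>" "\<sigma> > 1 / 2 - \<alpha>"
    unfolding \<sigma>_def using assms(4,5) by linarith+

  \<comment> \<open>The exponents for the quadratic form: \<open>\<beta>\<close> lies halfway between \<open>\<kappa> / 2\<close> and \<open>\<alpha>\<close>, and \<open>\<mu>\<close> halfway between \<open>2 * \<kappa> - 1\<close> and \<open>4 * \<beta> - 1\<close>.\<close>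
  define \<kappa> where "\<kappa> = max (1 / 2) s"
  define \<beta> where "\<beta> = (\<alpha> + \<kappa> / 2) / 2"
  define \<delta> where "\<delta> = \<alpha> - \<beta>"
  define \<mu> where "\<mu> = \<kappa> + 2 * \<beta> - 1"
  have "1 / 2 \<le> \<kappa>" "s \<le> \<kappa>" "\<kappa> < 2 * \<alpha>" unfolding \<kappa>_def using assms(4,7) by auto
  then have par: "0 < \<delta>" "\<delta> \<le> 1" "0 \<le> \<mu>" "\<mu> \<le> 2 * (\<alpha> - \<delta>)" "4 * (\<alpha> - \<delta>) - \<mu> > 1" "2 + \<mu> - 2 * s > 1"
    unfolding \<delta>_def \<mu>_def \<beta>_def using assms(5) by (simp_all add: field_simps)

  have in_\<Sigma>: "AE \<omega> in M. \<omega> \<in> \<Sigma>"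
    using \<open>\<Sigma> \<in> sets M\<close> \<open>measure M \<Sigma> = 1\<close> by (simp add: AE_in_set_eq_1)
  have key: "AE \<omega> in M. sobolev_converges (\<alpha> - 1 / 2 - \<epsilon>) (\<lambda>k. mollify \<rho> k (u0 \<omega>)) (u0 \<omega>) \<and>
              cont_sobolev_converges (T \<omega>) (\<alpha> - 1 / 2 - \<epsilon>) (\<lambda>k. uk \<rho> k \<omega>) (u \<omega>)"
    if \<rho>: "mollifier_kernel \<rho>" for \<rho>
  proof -
    let ?m = "mol_symbol \<rho>"
    have data: "AE \<omega> in M. random_data \<alpha> g \<omega> \<in> sobolev (- \<sigma>)"
      by (rule random_data_sobolev[OF g \<sigma>(6)])
    then have smooth: "AE \<omega> in M. \<forall>k\<ge>1. \<forall>r. (\<lambda>l. ?m k l * random_data \<alpha> g \<omega> l) \<in> sobolev r"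
    proof eventually_elim
      case (elim \<omega>)
      then show ?case using mol_symbol_decay[OF \<rho>] multiplier_gain by blast
    qed
    then have "AE \<omega> in M. \<forall>k\<ge>1. (\<lambda>l. ?m k l * random_data \<alpha> g \<omega> l) \<in> sobolev (1 / 2)"
      by eventually_elim blast
    note conv = evolution_squares_converge[OF g q approximates_identity_mol_symbol[OF \<rho>] this par]
    \<comment> \<open>The existence time depends on the sample point, so one null set has to serve all time intervals.\<close>
    have "AE \<omega> in M. \<forall>L::nat. (\<lambda>k. \<integral>\<^sup>+t. esob s (bbm_nonlinearity (\<lambda>n. evolution_square (\<lambda>l. ?m k l * random_data \<alpha> g \<omega> l) t n - q \<omega> t n))
        * indicator {0..real L} t \<partial>lborel) \<longlonglongrightarrow> 0"
      unfolding AE_all_countable by (intro allI conv)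
    then show ?thesis using data smooth in_\<Sigma> AE_space
    proof eventually_elim
      case (elim \<omega>)
      obtain L :: nat where L: "T \<omega> \<le> real L" using real_arch_simple by blast
      have moll: "mollify \<rho> k (u0 \<omega>) = (\<lambda>n. ?m k n * u0 \<omega> n)" for k by (auto simp: mollify_eq)
      have sm: "(\<lambda>n. ?m k n * u0 \<omega> n) \<in> sobolev r" if "k \<ge> 1" for k r
        using elim(3) that by (simp add: u0_def)
      have uk: "bbm_smooth_solution (\<lambda>n. ?m k n * u0 \<omega> n) (uk \<rho> k \<omega>)" if "k \<ge> 1" for k
        using assms(15)[OF \<rho> that elim(5)] sm[OF that] by (simp add: moll)
      have qm: "(\<lambda>t. q \<omega> t n) \<in> borel_measurable borel" if "n \<noteq> 0" for n
        using q that section_measurable(2)[of "\<lambda>\<omega> t. q \<omega> t n" \<omega>] elim(5)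
        unfolding linear_square_version_def by (simp add: case_prod_beta')
      have T0: "0 \<le> T \<omega>" using assms(12)[OF elim(4)] by simp
      have c: "u0 \<omega> \<in> sobolev (- \<sigma>)" using elim(2) by (simp add: u0_def)
      note hyps = \<sigma>(1-5) T0 c norm_mol_symbol_le_1[OF \<rho>] mol_symbol_tendsto_1[OF \<rho>] sm assms(13)[OF elim(4)] uk qm
        elim(1)[THEN spec, of L, folded u0_def] L
      show ?case unfolding moll
        using smooth_approximation_converges[OF hyps] by blast
    qed
  qed
  moreover have "AE \<omega> in M. \<forall>w w'.
              cont_sobolev_converges (T \<omega>) (\<alpha> - 1 / 2 - \<epsilon>) (\<lambda>k. uk \<rho> k \<omega>) w \<longrightarrow>
              cont_sobolev_converges (T \<omega>) (\<alpha> - 1 / 2 - \<epsilon>) (\<lambda>k. uk \<rho>' k \<omega>) w' \<longrightarrow>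
              (\<forall>t\<in>{0..T \<omega>}. w t = w' t)"
    if "mollifier_kernel \<rho>" "mollifier_kernel \<rho>'" for \<rho> \<rho>'
    using key[OF that(1)] key[OF that(2)] in_\<Sigma>
  proof eventually_elim
    case (elim \<omega>)
    have "0 \<le> T \<omega>" using assms(12)[OF elim(3)] by simp
    with elim show ?case using cont_sobolev_limit_unique by metis
  qed
  ultimately show ?thesis by blast
qed

end
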